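(* Let $d\ge2$ and let $f\in L^d_\#(\mathbb T^d)$. The equation $\mathrm{div}\,U=f$ admits a solution $U\in L^\infty\cap\dot W^{1,d}(\mathbb T^d,\mathbb R^d)$ given by the hierarchical decomposition $U=\sum_{j=1}^\infty\mathbf u_j$, which is constructed by the refinement step $$\mathbf u_{j+1}=\mathop{\mathrm{arg\,min}}_{\mathbf u}\Big\{\|\mathbf u\|_{L^\infty\cap\dot W^{1,d}}+\lambda_1 2^{j}\Big\|f-\mathrm{div}\Big(\sum_{k=1}^{j}\mathbf u_k+\mathbf u\Big)\Big\|_{L^d}^d\Big\},\qquad j=0,1,2,\dots,$$ with sufficiently large $\lambda_1\ge\frac{\beta}{d}\|f\|_{L^d}^{1-d}$.
   Context: $\mathbb T^d$ is the $d$-dimensional torus and $L^d_\#(\mathbb T^d)=\{g\in L^d(\mathbb T^d):\overline g=0\}$, where $\overline g$ is the average of $g$; for $f=0$ the condition on $\lambda_1$ is read as $\lambda_1>0$. $L^\infty\cap\dot W^{1,d}(\mathbb T^d,\mathbb R^d)$ carries the usual norm of an intersection space, e.g. $\|\mathbf u\|_{L^\infty}+\|\nabla\mathbf u\|_{L^d}$. With $d'=d/(d-1)$, $\beta>0$ denotes a constant for which the (known, Bourgain–Brezis) estimate $$\|g-\overline g\|_{L^{d'}(\mathbb T^d)}\le\beta\,\|\nabla g\|_{L^1+\dot W^{-1,d'}(\mathbb T^d,\mathbb R^d)}\qquad\text{for all }g\in L^{d'}(\mathbb T^d)$$ holds, where the norm on the sum space is the infimum of $\|a\|_{L^1}+\|b\|_{\dot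 W^{-1,d'}}$ over decompositions $\nabla g=a+b$. An empty sum $\sum_{k=1}^0$ is $0$. *)

theory Defs
  imports "HOL-Probability.Essential_Supremum"
begin

text \<open>
  The torus is $\mathbb{R}^d / \mathbb{Z}^d$ with $d = $ \<^term>\<open>CARD('n)\<close>. Functions on it are
  functions on \<^typ>\<open>real^'n\<close> of period 1 in each coordinate, integrated over the half-open unit
  cube, which has measure 1. Elements of the function spaces are Borel representatives;
  they are never identified, so equality of classes is equality almost everywhere.
\<close>

definition torus :: "(real^'n) measure" where
  "torus = restrict_space lborel {x. \<forall>i. 0 \<le> x $ i \<and> x $ i < 1}"

definition periodic :: "(real^'n \<Rightarrow> 'b) \<Rightarrow> bool" where
  "periodic g \<longleftrightarrow> (\<forall>x i. g (x + axis i 1) = g x)"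

definition Lp :: "real \<Rightarrow> (real^'n \<Rightarrow> 'b::euclidean_space) set" where
  "Lp p = {g. periodic g \<and> g \<in> borel_measurable borel \<and> integrable torus (\<lambda>x. norm (g x) powr p)}"

definition Lp_norm :: "real \<Rightarrow> (real^'n \<Rightarrow> 'b::euclidean_space) \<Rightarrow> real" where
  "Lp_norm p g = (\<integral>x. norm (g x) powr p \<partial>torus) powr (1 / p)"

definition Linf :: "(real^'n \<Rightarrow> 'b::euclidean_space) set" where
  "Linf = {g. periodic g \<and> g \<in> borel_measurable borel \<and>
              esssup torus (\<lambda>x. ennreal (norm (g x))) < \<infinity>}"

definition Linf_norm :: "(real^'n \<Rightarrow> 'b::euclidean_space) \<Rightarrow> real" where
  "Linf_norm g = enn2real (esssup torus (\<lambda>x. ennreal (norm (g x))))"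

text \<open>The average over the torus; no normalising factor since \<^term>\<open>torus\<close> has mass 1.\<close>

definition average :: "(real^'n \<Rightarrow> real) \<Rightarrow> real" where
  "average g = (\<integral>x. g x \<partial>torus)"

definition Lp_zero_mean :: "real \<Rightarrow> (real^'n \<Rightarrow> real) set" where
  "Lp_zero_mean p = {g \<in> Lp p. average g = 0}"

definition partial_deriv :: "'n \<Rightarrow> (real^'n \<Rightarrow> real) \<Rightarrow> real^'n \<Rightarrow> real" where
  "partial_deriv i \<phi> x = frechet_derivative \<phi> (at x) (axis i 1)"

primrec cont_diff :: "nat \<Rightarrow> (real^'n \<Rightarrow> real) \<Rightarrow> bool" where
  "cont_diff 0 \<phi> \<longleftrightarrow> continuous_on UNIV \<phi>"
| "cont_diff (Suc k) \<phi> \<longleftrightarrow> (\<forall>x. \<phi> differentiable (at x)) \<and> (\<forall>i. cont_diff k (partial_deriv i \<phi>))"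

definition test_fun :: "(real^'n \<Rightarrow> real) \<Rightarrow> bool" where
  "test_fun \<phi> \<longleftrightarrow> periodic \<phi> \<and> (\<forall>k. cont_diff k \<phi>)"

definition test_field :: "(real^'n \<Rightarrow> real^'n) \<Rightarrow> bool" where
  "test_field \<Phi> \<longleftrightarrow> (\<forall>i. test_fun (\<lambda>x. \<Phi> x $ i))"

definition classical_grad :: "(real^'n \<Rightarrow> real^'n) \<Rightarrow> real^'n \<Rightarrow> real^'n^'n" where
  "classical_grad \<Phi> x = (\<chi> j i. partial_deriv i (\<lambda>y. \<Phi> y $ j) x)"

definition classical_div :: "(real^'n \<Rightarrow> real^'n) \<Rightarrow> real^'n \<Rightarrow> real" where
  "classical_div \<Phi> x = (\<Sum>i\<in>UNIV. partial_deriv i (\<lambda>y. \<Phi> y $ i) x)"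

definition has_weak_deriv ::
  "'n \<Rightarrow> (real^'n \<Rightarrow> real) \<Rightarrow> (real^'n \<Rightarrow> real) \<Rightarrow> bool" where
  "has_weak_deriv i g h \<longleftrightarrow> g \<in> Lp 1 \<and> h \<in> Lp 1 \<and>
     (\<forall>\<phi>. test_fun \<phi> \<longrightarrow>
        (\<integral>x. g x * partial_deriv i \<phi> x \<partial>torus) = - (\<integral>x. h x * \<phi> x \<partial>torus))"

text \<open>
  A representative of the weak derivative, which is unique almost everywhere when it exists;
  the value is unspecified for functions that are not weakly differentiable.
\<close>

definition weak_deriv :: "'n \<Rightarrow> (real^'n \<Rightarrow> real) \<Rightarrow> real^'n \<Rightarrow> real" where
  "weak_deriv i g = (SOME h. has_weak_deriv i g h)"

definition weak_grad :: "(real^'n \<Rightarrow> real^'n) \<Rightarrow> real^'n \<Rightarrow> real^'n^'n" where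
  "weak_grad u x = (\<chi> j i. weak_deriv i (\<lambda>y. u y $ j) x)"

definition weak_div :: "(real^'n \<Rightarrow> real^'n) \<Rightarrow> real^'n \<Rightarrow> real" where
  "weak_div u x = (\<Sum>i\<in>UNIV. weak_deriv i (\<lambda>y. u y $ i) x)"

text \<open>
  The space $L^\infty \cap \dot W^{1,d}$ of vector fields with its norm
  $\|u\|_{L^\infty} + \|\nabla u\|_{L^d}$; vectors carry the Euclidean norm and
  matrices the Frobenius norm (which is the norm of \<^typ>\<open>real^'n^'n\<close>).
\<close>

definition Linf_W1d :: "(real^'n \<Rightarrow> real^'n) set" where
  "Linf_W1d = {u \<in> Linf. \<forall>i j. \<exists>h \<in> Lp (real CARD('n)). has_weak_deriv i (\<lambda>x. u x $ j) h}"

definition Linf_W1d_norm :: "(real^'n \<Rightarrow> real^'n) \<Rightarrow> real" where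
  "Linf_W1d_norm u = Linf_norm u + Lp_norm (real CARD('n)) (weak_grad u)"

text \<open>
  Vector distributions on the torus, given by their values on test fields. The space
  $\dot W^{-1,d'}$ is the dual of $\dot W^{1,d}$, and its norm is $\infty$ for distributions
  outside this space.
\<close>

definition dual_W1d_norm :: "((real^'n \<Rightarrow> real^'n) \<Rightarrow> real) \<Rightarrow> ennreal" where
  "dual_W1d_norm b =
     (SUP \<Phi>\<in>{\<Phi>. test_field \<Phi> \<and> Lp_norm (real CARD('n)) (classical_grad \<Phi>) \<le> 1}. ennreal \<bar>b \<Phi>\<bar>)"

definition distr_grad :: "(real^'n \<Rightarrow> real) \<Rightarrow> (real^'n \<Rightarrow> real^'n) \<Rightarrow> real" where
  "distr_grad g \<Phi> = - (\<integral>x. g x * classical_div \<Phi> x \<partial>torus)"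

definition distr_of_field :: "(real^'n \<Rightarrow> real^'n) \<Rightarrow> (real^'n \<Rightarrow> real^'n) \<Rightarrow> real" where
  "distr_of_field a \<Phi> = (\<integral>x. a x \<bullet> \<Phi> x \<partial>torus)"

text \<open>
  The norm of $L^1 + \dot W^{-1,d'}$. Any \<open>b\<close> occurring here agrees on test fields with
  the difference of \<open>T\<close> and an integrable field, so it is linear there whenever \<open>T\<close> is.
\<close>

definition L1_plus_dual_norm :: "((real^'n \<Rightarrow> real^'n) \<Rightarrow> real) \<Rightarrow> ennreal" where
  "L1_plus_dual_norm T =
     (INF (a, b)\<in>{(a, b). a \<in> Lp 1 \<and> (\<forall>\<Phi>. test_field \<Phi> \<longrightarrow> T \<Phi> = distr_of_field a \<Phi> + b \<Phi>)}.
        ennreal (Lp_norm 1 a) + dual_W1d_norm b)"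

text \<open>
  The functional minimised in step \<open>j\<close>, where only \<open>u 1, \<dots>, u j\<close> are used; the sequence is
  indexed from 1 and \<open>u 0\<close> is irrelevant.
\<close>

definition refinement_objective ::
  "(real^'n \<Rightarrow> real) \<Rightarrow> real \<Rightarrow> (nat \<Rightarrow> real^'n \<Rightarrow> real^'n) \<Rightarrow> nat \<Rightarrow> (real^'n \<Rightarrow> real^'n) \<Rightarrow> real" where
  "refinement_objective f lam1 u j v =
     Linf_W1d_norm v + lam1 * 2 ^ j *
       Lp_norm (real CARD('n)) (\<lambda>x. f x - weak_div (\<lambda>y. (\<Sum>k=1..j. u k y) + v y) x) ^ CARD('n)"

definition refinement_minimizer ::
  "(real^'n \<Rightarrow> real) \<Rightarrow> real \<Rightarrow> (nat \<Rightarrow> real^'n \<Rightarrow> real^'n) \<Rightarrow> nat \<Rightarrow> (real^'n \<Rightarrow> real^'n) \<Rightarrow> bool" where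
  "refinement_minimizer f lam1 u j v \<longleftrightarrow>
     is_arg_min (refinement_objective f lam1 u j) (\<lambda>w. w \<in> Linf_W1d) v"

end

theory Submission
  imports Defs "HOL-Probability.Probability_Measure"
begin

text \<open>
  Everything rests on a quantitative solvability statement: every $r \in L^d$ of mean zero is
  $\mathrm{div}\, U$ for some $U$ with $\|U\|_{L^\infty} + \|\nabla U\|_{L^d} \le 8 \beta \|r\|_{L^d}$.
  After scaling so that $\beta \|r\|_{L^d} \le 1/4$, minimise
  $\frac1p \|U\|_p^p + \frac1d \|\nabla U\|_d^d + \frac{\Lambda}{d} \|r - \mathrm{div}\, U\|_d^d$.
  With $s = r - \mathrm{div}\, U$ and $g = \Lambda |s|^{d-2} s$, the Euler--Lagrange equation is an explicit
  decomposition of $\nabla g$ in $L^1 + \dot W^{-1,d'}$, so the estimate of Bourgain and Brezis bounds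
  $\|g - \overline g\|_{L^{d'}}$ by $\beta (2 + \|U\|_p^p + \|\nabla U\|_d^d)$. Testing the equation with $U$
  itself gives $\|U\|_p^p, \|\nabla U\|_d^d \le 1$ and $\|s\|_d^d \le 1 / \Lambda$ uniformly in $p$, and
  one lets $p, \Lambda \to \infty$.

  Comparing a refinement step with an exact solution for the current residual $r_j$ gives
  $\|u_{j+1}\| + \lambda_1 2^j \|r_{j+1}\|^d \le 8 \beta \|r_j\|$; since $\|r_j\|$ is nonincreasing, residuals and
  increments decay geometrically.

  Existence of minimisers and the passage to the limit use the uniform convexity of $L^d$ in
  place of weak compactness: nested bounded closed convex sets have a common point.
\<close>

section \<open>The Lebesgue spaces of the torus\<close>

text \<open>The L-infinity norm is not differentiable, so minimising it directly gives no usable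
  Euler-Lagrange equation. The power \<open>|U|^p / p\<close> does, and the L^1 norm of its gradient
  is at most 1 plus the integral of \<open>|U|^p\<close>, whatever p is; this fits the L^1 summand
  of the estimate and survives the limit of large p. The penalty stands in for the constraint div U
  = r and makes the multiplier g explicit, so that no duality theory has to supply it. The threshold
  1/4 allows the two energies of U to be absorbed from the right-hand side; rescaling by
  \<open>4 * \<beta> * Ld_norm r\<close> and adding two norms of size at most 1 yields the factor 8.

  A second difficulty is that \<open>weak_deriv\<close> is a chosen representative, so
  \<open>weak_grad\<close> is linear only almost everywhere. Closed sets and energies are therefore
  formed from pairs (field, gradient), where everything is exactly linear, and uniqueness of weak
  derivatives carries the results back.\<close>

lemma sets_cube: "{x::real^'n. \<forall>i. 0 \<le> x $ i \<and> x $ i < 1} \<in> sets borel"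
proof -
  have [measurable]: "(\<lambda>x::real^'n. x $ i) \<in> borel_measurable borel" for i
    by (intro borel_measurable_continuous_onI continuous_intros)
  show ?thesis by measurable
qed

lemma space_torus: "space (torus :: (real^'n) measure) = {x. \<forall>i. 0 \<le> x $ i \<and> x $ i < 1}"
  unfolding torus_def by (simp add: space_restrict_space)

lemma torus_measurable [measurable (raw)]:
  "g \<in> borel_measurable borel \<Longrightarrow> g \<in> borel_measurable (torus :: (real^'n) measure)"
  unfolding torus_def by (simp add: measurable_restrict_space1)

text \<open>The half-open cube is squeezed between the open and the closed unit box, both of
  Lebesgue measure 1.\<close>

lemma prob_space_torus: "prob_space (torus :: (real^'n) measure)"
proof
  let ?Q = "{x::real^'n. \<forall>i. 0 \<le> x $ i \<and> x $ i < 1}"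
  have 1: "emeasure lborel (cbox 0 (1::real^'n)) = 1" "emeasure lborel (box 0 (1::real^'n)) = 1"
    by (subst emeasure_lborel_cbox emeasure_lborel_box; auto simp: Basis_vec_def inner_axis intro!: prod.neutral)+
  have "emeasure lborel ?Q \<le> emeasure lborel (cbox 0 (1::real^'n))"
    by (intro emeasure_mono) (auto simp: mem_box_cart less_imp_le)
  moreover have "emeasure lborel (box 0 (1::real^'n)) \<le> emeasure lborel ?Q"
    using sets_cube by (intro emeasure_mono) (auto simp: mem_box_cart less_imp_le)
  ultimately have "emeasure lborel ?Q = 1"
    using 1 by auto
  then show "emeasure torus (space (torus :: (real^'n) measure)) = 1"
    unfolding space_torus unfolding torus_def using sets_cube by (subst emeasure_restrict_space) auto
qed

interpretation torus: prob_space "torus :: (real^'n) measure"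
  by (rule prob_space_torus)

text \<open>Natural exponents serve almost throughout; the main exception is the conjugate exponent
  \<open>d / (d - 1)\<close>. They replace \<open>powr\<close> by ordinary powers, which avoids case
  distinctions at 0 and permits induction on the exponent.\<close>

abbreviation pow_integral :: "nat \<Rightarrow> (real^'n \<Rightarrow> 'b::real_normed_vector) \<Rightarrow> real" where
  "pow_integral q f \<equiv> (\<integral>x. norm (f x) ^ q \<partial>torus)"

abbreviation Ld_norm :: "(real^'n \<Rightarrow> 'b::euclidean_space) \<Rightarrow> real" where
  "Ld_norm f \<equiv> Lp_norm (real CARD('n)) f"

lemma norm_powr_nat: "q > 0 \<Longrightarrow> norm x powr real q = norm x ^ q"
  by (cases "norm x = 0") (auto simp: powr_realpow)

lemma Lp_nat: "q > 0 \<Longrightarrow> g \<in> Lp (real q) \<longleftrightarrow>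
    periodic g \<and> g \<in> borel_measurable borel \<and> integrable torus (\<lambda>x. norm (g x) ^ q)"
  unfolding Lp_def by (simp add: norm_powr_nat)

lemma Lp_measurable: "g \<in> Lp p \<Longrightarrow> g \<in> borel_measurable borel"
  by (simp add: Lp_def)

lemma Lp_integrable_pow: "q > 0 \<Longrightarrow> g \<in> Lp (real q) \<Longrightarrow> integrable torus (\<lambda>x. norm (g x) ^ q)"
  by (simp add: Lp_nat)

lemma Lp_norm_nonneg [simp]: "Lp_norm p g \<ge> 0"
  by (simp add: Lp_norm_def)

lemma Lp_norm_pow: "q > 0 \<Longrightarrow> Lp_norm (real q) g ^ q = pow_integral q g"
proof -
  assume q: "q > 0"
  define I where "I = pow_integral q g"
  have "I \<ge> 0" by (simp add: I_def)
  have "Lp_norm (real q) g = I powr (1 / real q)"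
    using q by (simp add: Lp_norm_def I_def norm_powr_nat)
  moreover have "(I powr (1 / real q)) ^ q = I"
  proof (cases "I = 0")
    case False
    then show ?thesis
      using q \<open>I \<ge> 0\<close> by (simp add: powr_powr flip: powr_realpow)
  qed (use q in simp)
  ultimately show ?thesis by (simp add: I_def)
qed

lemma Lp_norm_le_iff: "q > 0 \<Longrightarrow> B \<ge> 0 \<Longrightarrow>
    Lp_norm (real q) g \<le> B \<longleftrightarrow> pow_integral q g \<le> B ^ q"
  by (metis Lp_norm_nonneg Lp_norm_pow power_mono power_mono_iff)

section \<open>Elementary inequalities for powers\<close>

lemma LIMSEQ_one_over_add_1: "(\<lambda>n. 1 / (real n + 1)) \<longlonglongrightarrow> 0"
  using LIMSEQ_inverse_real_of_nat by (simp add: inverse_eq_divide add.commute)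

text \<open>Bernoulli's inequality for \<open>b / a - 1 \<ge> -1\<close>, multiplied by
  \<open>a ^ Suc n\<close>. Convexity of powers, the comparison of integrals with different
  exponents and the tangent inequality for vectors all go back to it.\<close>

lemma pow_ge_tangent:
  fixes a b :: real
  assumes "a \<ge> 0" "b \<ge> 0"
  shows "a ^ Suc n + real (Suc n) * a ^ n * (b - a) \<le> b ^ Suc n"
proof (cases "a = 0")
  case False
  then have a: "a > 0" using assms by simp
  have "1 + real (Suc n) * (b / a - 1) \<le> (1 + (b / a - 1)) ^ Suc n"
    using assms a by (intro Bernoulli_inequality) (simp add: field_simps)
  then have "a ^ Suc n * (1 + real (Suc n) * (b / a - 1)) \<le> a ^ Suc n * (b / a) ^ Suc n"
    using a by (intro mult_left_mono) auto
  also have "\<dots> = b ^ Suc n"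
    using a by (simp add: power_divide)
  also have "a ^ Suc n * (1 + real (Suc n) * (b / a - 1)) = a ^ Suc n + real (Suc n) * a ^ n * (b - a)"
    using a by (simp add: field_simps)
  finally show ?thesis .
qed (use assms in \<open>cases n; auto\<close>)

lemma pow_le_1_plus_pow:
  fixes t :: real
  assumes "t \<ge> 0" "p \<le> q"
  shows "t ^ p \<le> 1 + t ^ q"
proof (cases "t \<le> 1")
  case True
  then have "t ^ p \<le> 1" using assms by (simp add: power_le_one)
  then show ?thesis using assms by (simp add: add_increasing2)
next
  case False
  then have "t ^ p \<le> t ^ q" using assms by (intro power_increasing) auto
  then show ?thesis by simp
qed

text \<open>Averaging the tangent inequalities at the convex combination \<open>m\<close> with
  weights \<open>t\<close> and \<open>1 - t\<close> cancels the linear terms.\<close>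

lemma pow_convex:
  fixes a b t :: real
  assumes "a \<ge> 0" "b \<ge> 0" "0 \<le> t" "t \<le> 1"
  shows "(t * a + (1 - t) * b) ^ q \<le> t * a ^ q + (1 - t) * b ^ q"
proof (cases q)
  case (Suc n)
  define m where "m = t * a + (1 - t) * b"
  have m: "m \<ge> 0" using assms by (simp add: m_def)
  have "t * (m ^ Suc n + real (Suc n) * m ^ n * (a - m)) + (1 - t) * (m ^ Suc n + real (Suc n) * m ^ n * (b - m))
     \<le> t * a ^ Suc n + (1 - t) * b ^ Suc n"
    by (intro add_mono mult_left_mono pow_ge_tangent m assms) (use assms in auto)
  also have "t * (m ^ Suc n + real (Suc n) * m ^ n * (a - m)) + (1 - t) * (m ^ Suc n + real (Suc n) * m ^ n * (b - m))
     = m ^ Suc n + real (Suc n) * m ^ n * (t * a + (1 - t) * b - m)"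
    by (simp add: algebra_simps)
  finally show ?thesis using Suc by (simp add: m_def)
qed simp

lemma norm_add_pow_le:
  fixes x y :: "'b::real_normed_vector"
  shows "norm (x + y) ^ q \<le> 2 ^ q * (norm x ^ q + norm y ^ q)"
proof -
  have "norm (x + y) ^ q \<le> (2 * max (norm x) (norm y)) ^ q"
    by (intro power_mono) (use norm_triangle_ineq[of x y] in auto)
  also have "\<dots> \<le> 2 ^ q * (norm x ^ q + norm y ^ q)"
    by (simp add: power_mult_distrib max_def)
  finally show ?thesis .
qed

section \<open>Linear structure and norm of the Lebesgue spaces\<close>

lemma periodic_comp: "periodic g \<Longrightarrow> periodic (\<lambda>x. h (g x))"
  by (simp add: periodic_def)

lemma periodic_comp2: "periodic f \<Longrightarrow> periodic g \<Longrightarrow> periodic (\<lambda>x. h (f x) (g x))"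
  by (simp add: periodic_def)

lemma Lp_bound:
  assumes "q > 0" "f \<in> Lp (real q)" "periodic g" "g \<in> borel_measurable borel"
    and "\<And>x. norm (g x) \<le> norm (f x)"
  shows "g \<in> Lp (real q)"
proof -
  have [measurable]: "g \<in> borel_measurable borel" by fact
  have "integrable torus (\<lambda>x. norm (g x) ^ q)"
    using Lp_integrable_pow[OF assms(1,2)]
    by (rule Bochner_Integration.integrable_bound) (auto intro!: power_mono AE_I2 assms)
  then show ?thesis using assms by (simp add: Lp_nat)
qed

lemma Lp_scaleR [intro]:
  assumes "q > 0" "f \<in> Lp (real q)"
  shows "(\<lambda>x. c *\<^sub>R f x) \<in> Lp (real q)"
  using assms periodic_comp[of f "\<lambda>y. c *\<^sub>R y"] by (auto simp: Lp_nat power_mult_distrib)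

lemma Lp_add [intro]:
  assumes "q > 0" "f \<in> Lp (real q)" "g \<in> Lp (real q)"
  shows "(\<lambda>x. f x + g x) \<in> Lp (real q)"
proof -
  have [measurable]: "f \<in> borel_measurable borel" "g \<in> borel_measurable borel"
    using assms by (auto simp: Lp_def)
  have "integrable torus (\<lambda>x. 2 ^ q * (norm (f x) ^ q + norm (g x) ^ q))"
    using assms by (auto simp: Lp_nat)
  then have "integrable torus (\<lambda>x. norm (f x + g x) ^ q)"
    by (rule Bochner_Integration.integrable_bound) (auto intro!: AE_I2 norm_add_pow_le)
  then show ?thesis using assms periodic_comp2[of f g "(+)"] by (auto simp: Lp_nat)
qed

lemma Lp_diff [intro]:
  assumes "q > 0" "f \<in> Lp (real q)" "g \<in> Lp (real q)"
  shows "(\<lambda>x. f x - g x) \<in> Lp (real q)"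
  using Lp_add[OF assms(1,2) Lp_scaleR[OF assms(1,3), of "-1"]] by simp

lemma Lp_zero [simp]: "q > 0 \<Longrightarrow> (\<lambda>x. 0) \<in> Lp (real q)"
  by (simp add: Lp_nat periodic_def power_0_left)

lemma Lp_sum [intro]:
  assumes "q > 0" "\<And>k. k \<in> A \<Longrightarrow> f k \<in> Lp (real q)"
  shows "(\<lambda>x. \<Sum>k\<in>A. f k x) \<in> Lp (real q)"
  using assms(2) by (induction A rule: infinite_finite_induct) (auto simp: assms(1))

lemma Lp_bounded_linear:
  assumes q: "q > 0" and f: "f \<in> Lp (real q)" and L: "bounded_linear L"
  shows "(\<lambda>x. L (f x)) \<in> Lp (real q)"
proof -
  obtain K where K: "\<And>x. norm (L x) \<le> norm x * K"
    using bounded_linear.bounded[OF L] by blast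
  have [measurable]: "f \<in> borel_measurable borel" using f by (rule Lp_measurable)
  have "L \<in> borel_measurable borel"
    by (intro borel_measurable_continuous_onI bounded_linear.continuous_on[OF L] continuous_on_id)
  then have m: "(\<lambda>x. L (f x)) \<in> borel_measurable borel" by measurable
  have "norm (L (f x)) \<le> norm (\<bar>K\<bar> *\<^sub>R f x)" for x
    using K[of "f x"] mult_right_mono[OF abs_ge_self[of K], of "norm (f x)"] by (simp add: mult.commute)
  moreover have "periodic (\<lambda>x. L (f x))"
    by (rule periodic_comp) (use f in \<open>simp add: Lp_def\<close>)
  ultimately show ?thesis
    by (intro Lp_bound[OF q Lp_scaleR[OF q f] _ m])
qed

lemma Lp_norm_cong_AE:
  assumes "AE x in torus. norm (f x) = norm (g x)" "f \<in> borel_measurable borel" "g \<in> borel_measurable borel"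
  shows "Lp_norm p f = Lp_norm p g"
proof -
  have [measurable]: "f \<in> borel_measurable borel" "g \<in> borel_measurable borel" by fact+
  have "(\<integral>x. norm (f x) powr p \<partial>torus) = (\<integral>x. norm (g x) powr p \<partial>torus)"
    by (rule integral_cong_AE) (use assms(1) in auto)
  then show ?thesis by (simp add: Lp_norm_def)
qed

lemma Lp_norm_mono:
  assumes "q > 0" "g \<in> Lp (real q)" "f \<in> borel_measurable borel"
    and "AE x in torus. norm (f x) \<le> norm (g x)"
  shows "Lp_norm (real q) f \<le> Lp_norm (real q) g"
proof -
  have [measurable]: "f \<in> borel_measurable borel" by fact
  have g: "integrable torus (\<lambda>x. norm (g x) ^ q)" using assms by (simp add: Lp_nat)
  have AE: "AE x in torus. norm (f x) ^ q \<le> norm (g x) ^ q"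
    using assms(4) by eventually_elim (auto intro: power_mono)
  have f: "integrable torus (\<lambda>x. norm (f x) ^ q)"
    using g by (rule Bochner_Integration.integrable_bound) (use AE in auto)
  have "Lp_norm (real q) f ^ q \<le> Lp_norm (real q) g ^ q"
    unfolding Lp_norm_pow[OF assms(1)] by (rule integral_mono_AE) (use f g AE in auto)
  then show ?thesis using assms(1) by (simp add: power_mono_iff)
qed

lemma Lp_norm_scaleR: "q > 0 \<Longrightarrow> Lp_norm (real q) (\<lambda>x. c *\<^sub>R f x) = \<bar>c\<bar> * Lp_norm (real q) f"
proof -
  assume q: "q > 0"
  have "Lp_norm (real q) (\<lambda>x. c *\<^sub>R f x) ^ q = (\<bar>c\<bar> * Lp_norm (real q) f) ^ q"
    unfolding power_mult_distrib Lp_norm_pow[OF q] by (simp add: power_mult_distrib)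
  then show ?thesis using q power_eq_imp_eq_base by fastforce
qed

lemma Lp_norm_zero [simp]: "q > 0 \<Longrightarrow> Lp_norm (real q) (\<lambda>x. 0) = 0"
  using Lp_norm_pow[of q "\<lambda>x. 0"] by (simp add: power_0_left)

lemma Lp_norm_eq_0_AE:
  assumes "q > 0" "f \<in> Lp (real q)" "Lp_norm (real q) f = 0"
  shows "AE x in torus. f x = 0"
proof -
  have "pow_integral q f = 0"
    using assms Lp_norm_pow[of q f] by (simp add: power_0_left)
  then have "AE x in torus. norm (f x) ^ q = 0"
    by (subst (asm) integral_nonneg_eq_0_iff_AE) (use assms in \<open>auto simp: Lp_nat\<close>)
  then show ?thesis by simp
qed

text \<open>Minkowski's inequality from convexity of the power: the sum is
  \<open>\<alpha> + \<beta>\<close> times a convex combination of \<open>f / \<alpha>\<close> and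
  \<open>g / \<beta>\<close>, two functions of norm at most 1.\<close>

lemma Lp_norm_triangle:
  assumes q: "q > 0" and f: "f \<in> Lp (real q)" and g: "g \<in> Lp (real q)"
  shows "Lp_norm (real q) (\<lambda>x. f x + g x) \<le> Lp_norm (real q) f + Lp_norm (real q) g"
proof (rule field_le_epsilon)
  fix e :: real assume e: "e > 0"
  \<comment> \<open>The extra \<open>e / 2\<close> keeps both denominators positive when a norm
    vanishes; it disappears with \<open>e\<close>.\<close>
  define \<alpha> \<beta> where "\<alpha> = Lp_norm (real q) f + e / 2" and "\<beta> = Lp_norm (real q) g + e / 2"
  have pos: "\<alpha> > 0" "\<beta> > 0" using e by (auto simp: \<alpha>_def \<beta>_def add_nonneg_pos)
  define t where "t = \<alpha> / (\<alpha> + \<beta>)"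
  have t: "0 \<le> t" "t \<le> 1" "1 - t = \<beta> / (\<alpha> + \<beta>)" using pos by (auto simp: t_def field_simps)
  have fi: "integrable torus (\<lambda>x. norm (f x) ^ q)" and gi: "integrable torus (\<lambda>x. norm (g x) ^ q)"
    using f g q by (auto simp: Lp_nat)
  have fg: "integrable torus (\<lambda>x. norm (f x + g x) ^ q)"
    using Lp_add[OF q f g] q by (auto simp: Lp_nat)
  have pt: "norm (f x + g x) ^ q \<le> (\<alpha> + \<beta>) ^ q * (t * (norm (f x) ^ q / \<alpha> ^ q) + (1 - t) * (norm (g x) ^ q / \<beta> ^ q))" for x
  proof -
    have "norm (f x + g x) ^ q \<le> (norm (f x) + norm (g x)) ^ q"
      by (intro power_mono norm_triangle_ineq) auto
    also have "norm (f x) + norm (g x) = (\<alpha> + \<beta>) * (t * (norm (f x) / \<alpha>) + (1 - t) * (norm (g x) / \<beta>))"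
    proof -
      have "(\<alpha> + \<beta>) * (t * (norm (f x) / \<alpha>)) = norm (f x)" "(\<alpha> + \<beta>) * ((1 - t) * (norm (g x) / \<beta>)) = norm (g x)"
        unfolding t(3) unfolding t_def using pos by (auto simp: divide_simps)
      then show ?thesis by (simp only: distrib_left)
    qed
    also have "\<dots> ^ q = (\<alpha> + \<beta>) ^ q * (t * (norm (f x) / \<alpha>) + (1 - t) * (norm (g x) / \<beta>)) ^ q"
      by (simp add: power_mult_distrib)
    also have "\<dots> \<le> (\<alpha> + \<beta>) ^ q * (t * (norm (f x) / \<alpha>) ^ q + (1 - t) * (norm (g x) / \<beta>) ^ q)"
      by (intro mult_left_mono pow_convex) (use pos t in auto)
    finally show ?thesis by (simp add: power_divide)
  qed
  have "pow_integral q (\<lambda>x. f x + g x) \<le>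
      (\<integral>x. (\<alpha> + \<beta>) ^ q * (t * (norm (f x) ^ q / \<alpha> ^ q) + (1 - t) * (norm (g x) ^ q / \<beta> ^ q)) \<partial>torus)"
    using fi gi by (intro integral_mono fg pt) auto
  also have "\<dots> = (\<alpha> + \<beta>) ^ q * (t * (pow_integral q f / \<alpha> ^ q) + (1 - t) * (pow_integral q g / \<beta> ^ q))"
    using fi gi by simp
  also have "\<dots> \<le> (\<alpha> + \<beta>) ^ q * (t * 1 + (1 - t) * 1)"
    unfolding Lp_norm_pow[OF q, symmetric] using pos t e
    by (intro mult_left_mono add_mono) (auto simp: divide_le_eq_1 \<alpha>_def \<beta>_def intro!: power_mono)
  finally have "pow_integral q (\<lambda>x. f x + g x) \<le> (\<alpha> + \<beta>) ^ q" by simp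
  then have "Lp_norm (real q) (\<lambda>x. f x + g x) \<le> \<alpha> + \<beta>"
    using pos q by (subst Lp_norm_le_iff) auto
  then show "Lp_norm (real q) (\<lambda>x. f x + g x) \<le> Lp_norm (real q) f + Lp_norm (real q) g + e"
    by (simp add: \<alpha>_def \<beta>_def)
qed

lemma Lp_norm_minus: "Lp_norm p (\<lambda>x. f x - g x) = Lp_norm p (\<lambda>x. g x - f x)"
  by (simp add: Lp_norm_def norm_minus_commute)

lemma Lp_norm_diff_triangle:
  assumes q: "q > 0" and f: "f \<in> Lp (real q)" and g: "g \<in> Lp (real q)" and h: "h \<in> Lp (real q)"
  shows "Lp_norm (real q) (\<lambda>x. f x - h x) \<le> Lp_norm (real q) (\<lambda>x. f x - g x) + Lp_norm (real q) (\<lambda>x. g x - h x)"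
  using Lp_norm_triangle[OF q Lp_diff[OF q f g] Lp_diff[OF q g h]] by simp

lemma Lp_norm_abs_diff:
  assumes q: "q > 0" and f: "f \<in> Lp (real q)" and g: "g \<in> Lp (real q)"
  shows "\<bar>Lp_norm (real q) f - Lp_norm (real q) g\<bar> \<le> Lp_norm (real q) (\<lambda>x. f x - g x)"
  using Lp_norm_triangle[OF q Lp_diff[OF q f g] g] Lp_norm_triangle[OF q Lp_diff[OF q g f] f]
  by (simp add: Lp_norm_minus[of _ g f])

lemma Lp_norm_tendsto:
  assumes q: "q > 0" and f: "f \<in> Lp (real q)" and X: "\<And>k. X k \<in> Lp (real q)"
    and l: "(\<lambda>k. Lp_norm (real q) (\<lambda>x. X k x - f x)) \<longlonglongrightarrow> 0"
  shows "(\<lambda>k. Lp_norm (real q) (X k)) \<longlonglongrightarrow> Lp_norm (real q) f"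
proof -
  have "(\<lambda>k. Lp_norm (real q) (X k) - Lp_norm (real q) f) \<longlonglongrightarrow> 0"
    by (rule Lim_null_comparison[OF _ l]) (use Lp_norm_abs_diff[OF q X f] in auto)
  then show ?thesis by (simp add: LIM_zero_iff)
qed

section \<open>Hoelder's inequality and inclusions on a space of mass 1\<close>

text \<open>Young's inequality for the normalised functions, once the case of a vanishing integral
  is split off. The exponents are real because the conjugate of a natural number is in general not
  natural.\<close>

lemma Holder:
  fixes p q :: real and f :: "real^'n \<Rightarrow> 'b::euclidean_space" and g :: "real^'n \<Rightarrow> 'c::euclidean_space"
  assumes pq: "p > 1" "q > 1" "1 / p + 1 / q = 1" and f: "f \<in> Lp p" and g: "g \<in> Lp q"
  shows Holder_integrable: "integrable torus (\<lambda>x. norm (f x) * norm (g x))"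
    and Holder_le: "(\<integral>x. norm (f x) * norm (g x) \<partial>torus) \<le> Lp_norm p f * Lp_norm q g"
proof -
  have [measurable]: "f \<in> borel_measurable borel" "g \<in> borel_measurable borel"
    using f g by (auto simp: Lp_def)
  have fi: "integrable torus (\<lambda>x. norm (f x) powr p)" and gi: "integrable torus (\<lambda>x. norm (g x) powr q)"
    using f g by (auto simp: Lp_def)
  define I J where "I = (\<integral>x. norm (f x) powr p \<partial>torus)" and "J = (\<integral>x. norm (g x) powr q \<partial>torus)"
  have IJ: "I \<ge> 0" "J \<ge> 0" by (auto simp: I_def J_def)
  have Y: "norm (f x) * norm (g x) \<le> norm (f x) powr p / p + norm (g x) powr q / q" for x
    by (rule Youngs_inequality) (use pq in auto)
  show fg: "integrable torus (\<lambda>x. norm (f x) * norm (g x))"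
    by (rule Bochner_Integration.integrable_bound[where f = "\<lambda>x. norm (f x) powr p / p + norm (g x) powr q / q"])
      (use fi gi Y pq in \<open>auto intro!: AE_I2 order_trans[OF Y] \<close>)
  show "(\<integral>x. norm (f x) * norm (g x) \<partial>torus) \<le> Lp_norm p f * Lp_norm q g"
  proof (cases "I = 0 \<or> J = 0")
    case True
    then have "AE x in torus. norm (f x) * norm (g x) = 0"
    proof
      assume "I = 0"
      then have "AE x in torus. norm (f x) powr p = 0"
        unfolding I_def by (subst (asm) integral_nonneg_eq_0_iff_AE) (use fi in auto)
      then show ?thesis by auto
    next
      assume "J = 0"
      then have "AE x in torus. norm (g x) powr q = 0"
        unfolding J_def by (subst (asm) integral_nonneg_eq_0_iff_AE) (use gi in auto)
      then show ?thesis by auto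
    qed
    then have "(\<integral>x. norm (f x) * norm (g x) \<partial>torus) = 0"
      by (rule integral_eq_zero_AE)
    then show ?thesis by simp
  next
    case False
    then have pos: "I > 0" "J > 0" using IJ by auto
    define A B where "A = I powr (1 / p)" and "B = J powr (1 / q)"
    have AB: "A > 0" "B > 0" "A powr p = I" "B powr q = J"
      using pos pq by (auto simp: A_def B_def powr_powr)
    have "norm (f x) * norm (g x) \<le> A * B * (norm (f x) powr p / I / p + norm (g x) powr q / J / q)" for x
    proof -
      have "(norm (f x) / A) * (norm (g x) / B) \<le> (norm (f x) / A) powr p / p + (norm (g x) / B) powr q / q"
        by (rule Youngs_inequality) (use pq AB in auto)
      also have "\<dots> = norm (f x) powr p / I / p + norm (g x) powr q / J / q"
        using AB by (auto simp: powr_divide)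
      finally have "A * B * ((norm (f x) / A) * (norm (g x) / B)) \<le> A * B * (norm (f x) powr p / I / p + norm (g x) powr q / J / q)"
        using AB by (intro mult_left_mono) auto
      then show ?thesis using AB by simp
    qed
    then have "(\<integral>x. norm (f x) * norm (g x) \<partial>torus) \<le> (\<integral>x. A * B * (norm (f x) powr p / I / p + norm (g x) powr q / J / q) \<partial>torus)"
      by (intro integral_mono fg) (use fi gi in auto)
    also have "\<dots> = A * B * (I / I / p + J / J / q)"
      using fi gi unfolding I_def[symmetric] J_def[symmetric] by (simp add: I_def J_def)
    also have "\<dots> = A * B" using pos pq by simp
    finally show ?thesis by (simp add: A_def B_def Lp_norm_def I_def J_def)
  qed
qed

lemma Lp_mono:
  assumes "p > 0" "p \<le> q" "f \<in> Lp (real q)"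
  shows "f \<in> Lp (real p)"
proof -
  have [measurable]: "f \<in> borel_measurable borel" using assms by (auto simp: Lp_def)
  have q: "q > 0" using assms by auto
  have *: "norm (f x) ^ p \<le> 1 + norm (f x) ^ q" for x
    by (rule pow_le_1_plus_pow) (use assms in auto)
  have "integrable torus (\<lambda>x. 1 + norm (f x) ^ q)" using assms q by (auto simp: Lp_nat)
  then have "integrable torus (\<lambda>x. norm (f x) ^ p)"
    by (rule Bochner_Integration.integrable_bound) (auto intro!: AE_I2 * simp: abs_of_nonneg add_nonneg_nonneg)
  then show ?thesis using assms q by (auto simp: Lp_nat)
qed

lemma Lp_integrable:
  fixes f :: "real^'n \<Rightarrow> 'b::euclidean_space"
  assumes "q > 0" "f \<in> Lp (real q)"
  shows "integrable torus f"
proof -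
  have [measurable]: "f \<in> borel_measurable borel" using assms by (auto simp: Lp_def)
  have "f \<in> Lp (real 1)" by (rule Lp_mono[of 1 q]) (use assms in auto)
  then have "integrable torus (\<lambda>x. norm (f x))" using Lp_integrable_pow[of 1 f] by simp
  then show ?thesis by (rule integrable_norm_cancel) auto
qed

text \<open>Hoelder's inequality against the constant 1, whose norm is 1 because the torus has mass
  1.\<close>

lemma Lp_norm_1_le:
  fixes f :: "real^'n \<Rightarrow> 'b::euclidean_space"
  assumes q: "q \<ge> 2" and f: "f \<in> Lp (real q)"
  shows "(\<integral>x. norm (f x) \<partial>torus) \<le> Lp_norm (real q) f"
proof -
  define q' where "q' = real q / (real q - 1)"
  have c: "(\<lambda>x::real^'n. 1::real) \<in> Lp q'" by (simp add: Lp_def periodic_def)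
  have "(\<integral>x. norm (f x) * norm (1::real) \<partial>torus) \<le> Lp_norm (real q) f * Lp_norm q' (\<lambda>x::real^'n. 1::real)"
    by (rule Holder_le[OF _ _ _ f c]) (use q in \<open>auto simp: q'_def field_simps\<close>)
  also have "Lp_norm q' (\<lambda>x::real^'n. 1::real) = 1"
    by (simp add: Lp_norm_def torus.prob_space)
  finally show ?thesis by simp
qed

text \<open>The exponent descends one unit at a time: the tangent of the power \<open>Suc p\<close>
  at \<open>t\<close>, evaluated at 1, gives \<open>Suc p * t ^ p \<le> p * t ^ Suc p + 1\<close>.
  This is what makes the constraint sets in \<open>solve_div_small\<close> decrease as the exponent
  grows.\<close>

lemma integral_pow_le_1:
  assumes "q > 0" "f \<in> Lp (real q)" "pow_integral q f \<le> 1" "0 < p" "p \<le> q"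
  shows "pow_integral p f \<le> 1"
proof -
  have pos: "\<And>p. p > 0 \<Longrightarrow> p \<le> q \<Longrightarrow> integrable torus (\<lambda>x. norm (f x) ^ p)"
    using Lp_mono[OF _ _ assms(2)] by (auto simp: Lp_nat)
  have *: "pow_integral p f \<le> 1"
    if p: "p > 0" "p < q" "pow_integral (Suc p) f \<le> 1" for p
  proof -
    have pt: "norm (f x) ^ p \<le> (real p * norm (f x) ^ Suc p + 1) / real (Suc p)" for x
      using pow_ge_tangent[of "norm (f x)" 1 p] by (simp add: field_simps)
    have "pow_integral p f \<le> (\<integral>x. (real p * norm (f x) ^ Suc p + 1) / real (Suc p) \<partial>torus)"
      using p pos[of p] pos[of "Suc p"] by (intro integral_mono pt) auto
    also have "\<dots> = (real p * pow_integral (Suc p) f + 1) / real (Suc p)"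
      using p pos[of "Suc p"] by (simp add: torus.prob_space)
    also have "\<dots> \<le> (real p * 1 + 1) / real (Suc p)"
      using p by (intro divide_right_mono add_mono mult_left_mono) auto
    also have "\<dots> = 1" by (simp add: field_simps)
    finally show ?thesis .
  qed
  show ?thesis using assms(5,3)
  proof (induction rule: inc_induct)
    case (step n)
    then show ?case using *[of n] assms by auto
  qed auto
qed

section \<open>Completeness and uniform convexity\<close>

text \<open>The bound \<open>B m\<close> may vary with \<open>m\<close>: in a sublevel set of an
  energy, the term that is only lower semicontinuous is bounded by what the remaining, convergent
  terms leave over. Membership of the limit in the space comes out of the same estimate.\<close>

lemma Lp_Fatou:
  fixes X :: "nat \<Rightarrow> real^'n \<Rightarrow> 'b::euclidean_space"
  assumes q: "q > 0" and X: "\<And>m. X m \<in> Lp (real q)" and lim: "AE x in torus. (\<lambda>m. X m x) \<longlonglongrightarrow> g x"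
    and g: "periodic g" "g \<in> borel_measurable borel"
    and B: "\<forall>\<^sub>F m in sequentially. pow_integral q (\<lambda>x. X m x) \<le> B m" "B \<longlonglongrightarrow> L"
  shows "g \<in> Lp (real q)" "pow_integral q g \<le> L"
proof -
  have [measurable]: "g \<in> borel_measurable borel" "\<And>m. X m \<in> borel_measurable borel"
    using X g by (auto simp: Lp_def)
  have L: "L \<ge> 0"
  proof (rule tendsto_lowerbound[OF B(2)])
    show "\<forall>\<^sub>F m in sequentially. 0 \<le> B m"
      using B(1) by eventually_elim (auto intro: order_trans[rotated])
  qed auto
  have "(\<integral>\<^sup>+x. ennreal (norm (g x) ^ q) \<partial>torus) = (\<integral>\<^sup>+x. liminf (\<lambda>m. ennreal (norm (X m x) ^ q)) \<partial>torus)"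
  proof (rule nn_integral_cong_AE)
    show "AE x in torus. ennreal (norm (g x) ^ q) = liminf (\<lambda>m. ennreal (norm (X m x) ^ q))"
      using lim
    proof eventually_elim
      case (elim x)
      then have "(\<lambda>m. ennreal (norm (X m x) ^ q)) \<longlonglongrightarrow> ennreal (norm (g x) ^ q)"
        by (intro tendsto_ennrealI tendsto_intros)
      then show ?case by (intro lim_imp_Liminf[symmetric]) auto
    qed
  qed
  also have "\<dots> \<le> liminf (\<lambda>m. \<integral>\<^sup>+x. ennreal (norm (X m x) ^ q) \<partial>torus)"
    by (rule nn_integral_liminf) auto
  also have "\<dots> = liminf (\<lambda>m. ennreal (pow_integral q (\<lambda>x. X m x)))"
    using Lp_integrable_pow[OF q X] by (simp add: nn_integral_eq_integral)
  also have "\<dots> \<le> liminf (\<lambda>m. ennreal (B m))"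
    by (rule Liminf_mono) (use B(1) in eventually_elim, simp add: ennreal_leI)
  also have "\<dots> = ennreal L"
    using B(2) by (intro lim_imp_Liminf tendsto_ennrealI) auto
  finally have *: "(\<integral>\<^sup>+x. ennreal (norm (g x) ^ q) \<partial>torus) \<le> ennreal L" .
  have int: "integrable torus (\<lambda>x. norm (g x) ^ q)"
  proof (rule integrableI_bounded)
    have "(\<integral>\<^sup>+x. ennreal (norm (norm (g x) ^ q)) \<partial>torus) \<le> ennreal L" using * by simp
    also have "\<dots> < \<infinity>" by simp
    finally show "(\<integral>\<^sup>+x. ennreal (norm (norm (g x) ^ q)) \<partial>torus) < \<infinity>" .
  qed auto
  show "g \<in> Lp (real q)" using q g int by (simp add: Lp_nat)
  show "pow_integral q g \<le> L"
    using * L by (simp add: nn_integral_eq_integral[OF int])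
qed

text \<open>The Riesz-Fischer argument. The almost everywhere convergent subsequence is exported
  along with the norm limit, since later closedness proofs apply Fatou and pointwise bounds along
  it.\<close>

lemma Lp_complete:
  fixes X :: "nat \<Rightarrow> real^'n \<Rightarrow> 'b::euclidean_space"
  assumes q: "q \<ge> 2" and X: "\<And>m. X m \<in> Lp (real q)"
    and cauchy: "\<And>e. e > 0 \<Longrightarrow> \<exists>N. \<forall>m\<ge>N. \<forall>n\<ge>N. Lp_norm (real q) (\<lambda>x. X m x - X n x) < e"
  obtains r f where "strict_mono r" "f \<in> Lp (real q)" "AE x in torus. (\<lambda>k. X (r k) x) \<longlonglongrightarrow> f x"
    "(\<lambda>k. Lp_norm (real q) (\<lambda>x. X (r k) x - f x)) \<longlonglongrightarrow> 0"
proof -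
  have q0: "q > 0" using q by simp
  have [measurable]: "\<And>m. X m \<in> borel_measurable borel"
    using X by (auto simp: Lp_def)
  obtain N where N: "\<And>k m n. m \<ge> N k \<Longrightarrow> n \<ge> N k \<Longrightarrow> Lp_norm (real q) (\<lambda>x. X m x - X n x) < (1/2::real) ^ k"
    using cauchy[of "(1/2) ^ _"] by (metis zero_less_power half_gt_zero zero_less_one)
  \<comment> \<open>The sum dominates every \<open>N i\<close> with \<open>i \<le> k\<close>, and
    the summand \<open>k\<close> makes the selection strictly increasing.\<close>
  define r where "r k = (\<Sum>i\<le>k. N i) + k" for k
  have r: "strict_mono r" by (rule strict_monoI_Suc) (simp add: r_def)
  have rN: "N k \<le> r m" if "k \<le> m" for k m
    using member_le_sum[of k "{..m}" N] that by (simp add: r_def)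
  have D: "Lp_norm (real q) (\<lambda>x. X (r m) x - X (r n) x) < (1/2) ^ k" if "k \<le> m" "k \<le> n" for k m n
    using N rN that by blast
  define Y where "Y k x = X (r (Suc k)) x - X (r k) x" for k x
  have YL: "Y k \<in> Lp (real q)" for k unfolding Y_def using X q0 by auto
  have [measurable]: "Y k \<in> borel_measurable borel" for k using YL by (auto simp: Lp_def)
  \<comment> \<open>Taking \<open>lim\<close> at every point, convergent or not, yields a
    representative that is Borel and periodic everywhere.\<close>
  define f where "f x = lim (\<lambda>k. X (r k) x)" for x
  have f: "periodic f" "f \<in> borel_measurable borel"
    using X unfolding f_def by (auto simp: periodic_def Lp_def)
  have "(\<integral>\<^sup>+x. (\<Sum>k. ennreal (norm (Y k x))) \<partial>torus) = (\<Sum>k. \<integral>\<^sup>+x. ennreal (norm (Y k x)) \<partial>torus)"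
    by (rule nn_integral_suminf) auto
  also have "\<dots> = (\<Sum>k. ennreal (\<integral>x. norm (Y k x) \<partial>torus))"
    using Lp_integrable[OF q0 YL] by (simp add: nn_integral_eq_integral)
  also have "\<dots> \<le> (\<Sum>k. ennreal ((1/2) ^ k))"
  proof (intro suminf_le ennreal_leI)
    fix k
    have "(\<integral>x. norm (Y k x) \<partial>torus) \<le> Lp_norm (real q) (Y k)"
      by (rule Lp_norm_1_le[OF q YL])
    also have "\<dots> \<le> (1/2) ^ k" unfolding Y_def using D[of k "Suc k" k] by simp
    finally show "(\<integral>x. norm (Y k x) \<partial>torus) \<le> (1/2) ^ k" .
  qed auto
  also have "\<dots> = ennreal (\<Sum>k. (1/2) ^ k)"
    by (rule suminf_ennreal2) auto
  also have "\<dots> < \<infinity>" by simp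
  finally have "AE x in torus. (\<Sum>k. ennreal (norm (Y k x))) \<noteq> \<infinity>"
    by (intro nn_integral_PInf_AE) auto
  then have lim: "AE x in torus. (\<lambda>k. X (r k) x) \<longlonglongrightarrow> f x"
  proof eventually_elim
    case (elim x)
    then have "summable (\<lambda>k. norm (Y k x))"
      by (intro summable_suminf_not_top) auto
    then have "summable (\<lambda>k. Y k x)" by (rule summable_norm_cancel)
    then have "convergent (\<lambda>n. (\<Sum>k<n. Y k x))" by (simp add: summable_iff_convergent)
    then have "convergent (\<lambda>n. X (r n) x - X (r 0) x)"
      unfolding Y_def sum_lessThan_telescope[of "\<lambda>n. X (r n) x"] .
    then have "convergent (\<lambda>n. (X (r n) x - X (r 0) x) + X (r 0) x)"
      by (intro convergent_add convergent_const)
    then show ?case by (simp add: f_def convergent_LIMSEQ_iff)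
  qed
  \<comment> \<open>Fatou's lemma in \<open>m\<close> applied to \<open>X (r k) - X (r m)\<close>,
    whose norm is below \<open>(1/2) ^ k\<close> for all \<open>m \<ge> k\<close>.\<close>
  have F: "(\<lambda>x. X (r k) x - f x) \<in> Lp (real q)" "pow_integral q (\<lambda>x. X (r k) x - f x) \<le> ((1/2) ^ k) ^ q" for k
  proof -
    have l: "AE x in torus. (\<lambda>m. X (r k) x - X (r m) x) \<longlonglongrightarrow> X (r k) x - f x"
      using lim by eventually_elim (intro tendsto_intros)
    have p: "periodic (\<lambda>x. X (r k) x - f x)" "(\<lambda>x. X (r k) x - f x) \<in> borel_measurable borel"
      using f X[of "r k"] by (auto simp: periodic_def Lp_def)
    have b: "\<forall>\<^sub>F m in sequentially. pow_integral q (\<lambda>x. X (r k) x - X (r m) x) \<le> ((1/2) ^ k) ^ q"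
      using eventually_ge_at_top[of k]
    proof eventually_elim
      case (elim m)
      then show ?case
        using D[of k k m] q0 by (subst Lp_norm_le_iff[symmetric]) auto
    qed
    note * = Lp_Fatou[OF q0 _ l p b tendsto_const, OF Lp_diff[OF q0 X X]]
    show "(\<lambda>x. X (r k) x - f x) \<in> Lp (real q)" by (rule *(1))
    show "pow_integral q (\<lambda>x. X (r k) x - f x) \<le> ((1/2) ^ k) ^ q" by (rule *(2))
  qed
  have fL: "f \<in> Lp (real q)"
    using Lp_diff[OF q0 X[of "r 0"] F(1)[of 0]] by simp
  have l0: "(\<lambda>k. Lp_norm (real q) (\<lambda>x. X (r k) x - f x)) \<longlonglongrightarrow> 0"
  proof (rule Lim_null_comparison)
    show "\<forall>\<^sub>F k in sequentially. norm (Lp_norm (real q) (\<lambda>x. X (r k) x - f x)) \<le> (1/2) ^ k"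
      using F(2) q0 by (auto simp: Lp_norm_le_iff intro!: always_eventually)
  qed (rule LIMSEQ_power_zero, simp)
  show ?thesis by (rule that[OF r fL lim l0])
qed

section \<open>Clarkson's inequality\<close>

text \<open>Convexity of the power \<open>(n + 2) / 2\<close> as a function of the square: the left
  side is its tangent at the square of \<open>z\<close>. Induction in steps of two avoids fractional
  powers; the odd chain starts from the factorisation of the cubic case.\<close>

lemma pow_ge_tangent_square:
  fixes t z :: real
  assumes "t \<ge> 0" "z \<ge> 0"
  shows "z ^ (n + 2) + (real n + 2) / 2 * z ^ n * (t\<^sup>2 - z\<^sup>2) \<le> t ^ (n + 2)"
proof (induction n rule: nat_induct2)
  case 1
  have "t ^ 3 - (z ^ 3 + 3 / 2 * z * (t\<^sup>2 - z\<^sup>2)) = (t - z)\<^sup>2 * (t + z / 2)"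
    by (simp add: power2_eq_square power3_eq_cube algebra_simps diff_divide_distrib)
  also have "\<dots> \<ge> 0" using assms by simp
  finally show ?case by (simp add: eval_nat_numeral)
next
  case (step n)
  define c where "c = (real n + 2) / 2"
  have c: "(real (n + 2) + 2) / 2 = c + 1" "c \<ge> 0" by (auto simp: c_def)
  have "t\<^sup>2 * (z ^ (n + 2) + c * z ^ n * (t\<^sup>2 - z\<^sup>2)) - (z ^ (n + 2 + 2) + (c + 1) * z ^ (n + 2) * (t\<^sup>2 - z\<^sup>2))
     = c * z ^ n * (t\<^sup>2 - z\<^sup>2)\<^sup>2"
    by (simp add: power_add power2_eq_square algebra_simps)
  also have "\<dots> \<ge> 0" using assms c by simp
  finally have "z ^ (n + 2 + 2) + (c + 1) * z ^ (n + 2) * (t\<^sup>2 - z\<^sup>2) \<le> t\<^sup>2 * (z ^ (n + 2) + c * z ^ n * (t\<^sup>2 - z\<^sup>2))"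
    by simp
  also have "\<dots> \<le> t\<^sup>2 * t ^ (n + 2)"
    by (intro mult_left_mono) (use step.IH in \<open>auto simp: c_def\<close>)
  finally show ?case unfolding c by (simp add: power_add power2_eq_square mult_ac)
qed (simp add: power2_eq_square)

text \<open>With \<open>X\<close>, \<open>Y\<close> the norms of half the sum and half the
  difference, \<open>X ^ q + Y ^ q\<close> is at most \<open>Z ^ q\<close> for \<open>Z\<close> the
  Euclidean length of \<open>(X, Y)\<close>. The parallelogram law turns the square of
  \<open>Z\<close> into the mean of the squared norms of \<open>x\<close> and \<open>y\<close>, and
  convexity in the square finishes.\<close>

lemma Clarkson_pointwise:
  fixes x y :: "'b::real_inner"
  assumes "q \<ge> 2"
  shows "norm ((1/2) *\<^sub>R (x + y)) ^ q + norm ((1/2) *\<^sub>R (x - y)) ^ q \<le> (norm x ^ q + norm y ^ q) / 2"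
proof -
  obtain n where q: "q = n + 2" using assms le_Suc_ex by (metis add.commute)
  define X Y where "X = norm ((1/2) *\<^sub>R (x + y))" and "Y = norm ((1/2) *\<^sub>R (x - y))"
  define Z where "Z = sqrt (X\<^sup>2 + Y\<^sup>2)"
  have pos: "X \<ge> 0" "Y \<ge> 0" "Z \<ge> 0" by (auto simp: X_def Y_def Z_def)
  have Z2: "Z\<^sup>2 = X\<^sup>2 + Y\<^sup>2" by (simp add: Z_def)
  have Z2': "Z\<^sup>2 = ((norm x)\<^sup>2 + (norm y)\<^sup>2) / 2"
    unfolding Z2 X_def Y_def
    unfolding power2_norm_eq_inner
    by (simp add: inner_add_left inner_add_right inner_diff_left inner_diff_right inner_commute[of y x] add_divide_distrib diff_divide_distrib)
  have XZ: "X \<le> Z" "Y \<le> Z" using pos by (auto simp: Z_def intro!: real_le_rsqrt)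
  have "X ^ q + Y ^ q \<le> X\<^sup>2 * Z ^ n + Y\<^sup>2 * Z ^ n"
    unfolding q power_add by (subst (1 2) mult.commute) (intro add_mono mult_left_mono power_mono; use pos XZ in simp)
  also have "\<dots> = Z ^ q" unfolding q power_add Z2 by (simp add: algebra_simps)
  also have "2 * Z ^ q = (Z ^ (n + 2) + (real n + 2) / 2 * Z ^ n * ((norm x)\<^sup>2 - Z\<^sup>2))
      + (Z ^ (n + 2) + (real n + 2) / 2 * Z ^ n * ((norm y)\<^sup>2 - Z\<^sup>2))"
    unfolding q Z2' by (simp add: algebra_simps add_divide_distrib)
  then have "Z ^ q \<le> (norm x ^ q + norm y ^ q) / 2"
    using pow_ge_tangent_square[of "norm x" Z n] pow_ge_tangent_square[of "norm y" Z n] pos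
    unfolding q by simp
  finally show ?thesis by (simp add: X_def Y_def)
qed

lemma Clarkson:
  assumes q: "q \<ge> 2" and f: "f \<in> Lp (real q)" and g: "g \<in> Lp (real q)"
  shows "Lp_norm (real q) (\<lambda>x. (1/2) *\<^sub>R (f x + g x)) ^ q + Lp_norm (real q) (\<lambda>x. (1/2) *\<^sub>R (f x - g x)) ^ q
     \<le> (Lp_norm (real q) f ^ q + Lp_norm (real q) g ^ q) / 2"
proof -
  have q0: "q > 0" using q by simp
  have 1: "integrable torus (\<lambda>x. norm ((1/2) *\<^sub>R (f x + g x)) ^ q)" "integrable torus (\<lambda>x. norm ((1/2) *\<^sub>R (f x - g x)) ^ q)"
    by (rule Lp_integrable_pow[OF q0], intro Lp_scaleR Lp_add Lp_diff q0 f g)+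
  have 2: "integrable torus (\<lambda>x. norm (f x) ^ q)" "integrable torus (\<lambda>x. norm (g x) ^ q)"
    using Lp_integrable_pow[OF q0] f g by auto
  have "(\<integral>x. norm ((1/2) *\<^sub>R (f x + g x)) ^ q + norm ((1/2) *\<^sub>R (f x - g x)) ^ q \<partial>torus)
     \<le> (\<integral>x. (norm (f x) ^ q + norm (g x) ^ q) / 2 \<partial>torus)"
    using 1 2 by (intro integral_mono Clarkson_pointwise q) auto
  also have "\<dots> = (pow_integral q f + pow_integral q g) / 2"
    using 2 by simp
  finally show ?thesis
    unfolding Lp_norm_pow[OF q0] using Bochner_Integration.integral_add[OF 1] by simp
qed

section \<open>Nested convex sets and existence of minimisers\<close>

text \<open>Midpoints are all that Clarkson's inequality asks for, so no other convex combinations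
  are required.\<close>

definition mid_convex :: "('a \<Rightarrow> 'b::real_vector) set \<Rightarrow> bool" where
  "mid_convex C \<longleftrightarrow> (\<forall>f\<in>C. \<forall>g\<in>C. (\<lambda>x. (1/2) *\<^sub>R (f x + g x)) \<in> C)"

text \<open>Only sequences converging both in norm and almost everywhere are tested.
  \<open>Lp_complete\<close> delivers such sequences, and the pointwise convergence is what the
  lower semicontinuous terms need.\<close>

definition Lp_closed :: "real \<Rightarrow> (real^'n \<Rightarrow> 'b::euclidean_space) set \<Rightarrow> bool" where
  "Lp_closed p C \<longleftrightarrow> (\<forall>X f. (\<forall>k. X k \<in> C) \<longrightarrow> f \<in> Lp p \<longrightarrow> (AE x in torus. (\<lambda>k. X k x) \<longlonglongrightarrow> f x) \<longrightarrow>
     (\<lambda>k. Lp_norm p (\<lambda>x. X k x - f x)) \<longlonglongrightarrow> 0 \<longrightarrow> f \<in> C)"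

lemma Lp_closedI:
  assumes "\<And>X f. (\<And>k. X k \<in> C) \<Longrightarrow> f \<in> Lp p \<Longrightarrow> AE x in torus. (\<lambda>k. X k x) \<longlonglongrightarrow> f x \<Longrightarrow>
     (\<lambda>k. Lp_norm p (\<lambda>x. X k x - f x)) \<longlonglongrightarrow> 0 \<Longrightarrow> f \<in> C"
  shows "Lp_closed p C"
  using assms unfolding Lp_closed_def by blast

lemma Lp_closedD:
  assumes "Lp_closed p C" "f \<in> Lp p" "\<And>k. X k \<in> C" "AE x in torus. (\<lambda>k. X k x) \<longlonglongrightarrow> f x"
     "(\<lambda>k. Lp_norm p (\<lambda>x. X k x - f x)) \<longlonglongrightarrow> 0"
  shows "f \<in> C"
  using assms(1)[unfolded Lp_closed_def, rule_format, of X f] assms(2-) by simp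

text \<open>
  Elements of almost minimal norm in the sets form a Cauchy sequence, by uniform convexity;
  this replaces weak compactness of bounded sets.
\<close>

lemma nested_inter_nonempty:
  fixes C :: "nat \<Rightarrow> (real^'n \<Rightarrow> 'b::euclidean_space) set"
  assumes q: "q \<ge> 2" and sub: "\<And>n. C n \<subseteq> Lp (real q)" and dec: "decseq C"
    and ne: "\<And>n. C n \<noteq> {}" and conv: "\<And>n. mid_convex (C n)" and cl: "\<And>n. Lp_closed (real q) (C n)"
    and bd: "\<And>f. f \<in> C 0 \<Longrightarrow> Lp_norm (real q) f \<le> B"
  obtains f where "\<And>n. f \<in> C n"
proof -
  have q0: "q > 0" using q by simp
  define I where "I f = Lp_norm (real q) f ^ q" for f :: "real^'n \<Rightarrow> 'b"
  define m where "m n = Inf (I ` C n)" for n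
  have dec': "C k \<subseteq> C n" if "n \<le> k" for n k using dec that by (auto simp: decseq_def)
  have bb: "bdd_below (I ` C n)" for n by (rule bdd_belowI[of _ 0]) (auto simp: I_def)
  have m_le: "m n \<le> I f" if "f \<in> C n" for f n
    unfolding m_def using that bb by (intro cInf_lower) auto
  have m_mono: "m n \<le> m k" if "n \<le> k" for n k
    unfolding m_def using ne[of k] bb dec'[OF that] by (intro cInf_superset_mono) auto
  have m_bd: "m n \<le> B ^ q" for n
  proof -
    obtain f where f: "f \<in> C n" using ne by blast
    then have "f \<in> C 0" using dec'[of 0 n] by auto
    then have "I f \<le> B ^ q" unfolding I_def by (intro power_mono bd) auto
    then show ?thesis using m_le[OF f] by linarith
  qed
  \<comment> \<open>Infima over smaller sets are larger, and the bound \<open>B\<close> caps them;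
    the convergence of \<open>m\<close> is what forces near-minimisers of different sets
    together.\<close>
  have inc: "incseq m" by (auto simp: incseq_def m_mono)
  obtain M where M: "m \<longlonglongrightarrow> M"
    by (rule incseq_convergent[OF inc]) (use m_bd in auto)
  have "\<exists>f\<in>C n. I f < m n + 1 / (real n + 1)" for n
    using cInf_lessD[of "I ` C n" "m n + 1 / (real n + 1)"] ne[of n] unfolding m_def[symmetric] by auto
  then obtain w where w: "\<And>n. w n \<in> C n" "\<And>n. I (w n) < m n + 1 / (real n + 1)"
    by metis
  have wL: "w n \<in> Lp (real q)" for n using w sub by blast
  \<comment> \<open>What remains of Clarkson's inequality for two near-minimisers: half the gap
    between the infima, plus the slack allowed in choosing them.\<close>
  define \<delta> where "\<delta> n = (M - m n) / 2 + 1 / (real n + 1)" for n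
  have mM: "m n \<le> M" for n
    using M by (rule incseq_le[rotated]) (auto simp: incseq_def m_mono)
  have \<delta>0: "\<delta> \<longlonglongrightarrow> 0"
  proof -
    have "\<delta> \<longlonglongrightarrow> (M - M) / 2 + 0"
      unfolding \<delta>_def by (intro tendsto_intros M LIMSEQ_one_over_add_1) simp
    then show ?thesis by simp
  qed
  have key: "Lp_norm (real q) (\<lambda>x. w n x - w k x) ^ q \<le> 2 ^ q * \<delta> n" if nk: "n \<le> k" for n k
  proof -
    \<comment> \<open>Both points lie in the larger set \<open>C n\<close>, hence so does their
      midpoint, whose norm to the power \<open>q\<close> cannot drop below
      \<open>m n\<close>.\<close>
    have "w k \<in> C n" using dec'[OF nk] w(1)[of k] by auto
    then have "(\<lambda>x. (1/2) *\<^sub>R (w n x + w k x)) \<in> C n" using conv[of n] w(1)[of n] by (auto simp: mid_convex_def)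
    then have "m n \<le> I (\<lambda>x. (1/2) *\<^sub>R (w n x + w k x))" by (rule m_le)
    also have "\<dots> \<le> (I (w n) + I (w k)) / 2 - Lp_norm (real q) (\<lambda>x. (1/2) *\<^sub>R (w n x - w k x)) ^ q"
      using Clarkson[OF q wL[of n] wL[of k]] unfolding I_def by linarith
    also have "\<dots> \<le> (m n + 1 / (real n + 1) + (M + 1 / (real n + 1))) / 2 - Lp_norm (real q) (\<lambda>x. (1/2) *\<^sub>R (w n x - w k x)) ^ q"
    proof -
      have "1 / (real k + 1) \<le> 1 / (real n + 1)" using nk by (simp add: frac_le)
      moreover have "(i + i') / 2 - l \<le> (a + s + (M + s)) / 2 - l"
        if "t \<le> s" "i < a + s" "i' < b + t" "b \<le> M" for a b i i' l s t :: real
        using that by argo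
      ultimately show ?thesis using w(2)[of n] w(2)[of k] mM[of k] by blast
    qed
    finally have *: "m n \<le> (m n + 1 / (real n + 1) + (M + 1 / (real n + 1))) / 2 - Lp_norm (real q) (\<lambda>x. (1/2) *\<^sub>R (w n x - w k x)) ^ q" .
    have "l \<le> (M - a) / 2 + s" if "a \<le> (a + s + (M + s)) / 2 - l" for a s l :: real
      using that by argo
    from this[OF *] have "Lp_norm (real q) (\<lambda>x. (1/2) *\<^sub>R (w n x - w k x)) ^ q \<le> \<delta> n"
      by (simp only: \<delta>_def)
    then have "2 ^ q * (\<bar>1/2\<bar> * Lp_norm (real q) (\<lambda>x. w n x - w k x)) ^ q \<le> 2 ^ q * \<delta> n"
      unfolding Lp_norm_scaleR[OF q0] by (intro mult_left_mono) auto
    then show ?thesis by (simp add: power_divide)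
  qed
  have "\<exists>N. \<forall>n\<ge>N. \<forall>k\<ge>N. Lp_norm (real q) (\<lambda>x. w n x - w k x) < e" if e: "e > 0" for e
  proof -
    have "(\<lambda>n. 2 ^ q * \<delta> n) \<longlonglongrightarrow> 2 ^ q * 0" by (intro tendsto_intros \<delta>0)
    then have "\<forall>\<^sub>F n in sequentially. 2 ^ q * \<delta> n < e ^ q"
      by (rule order_tendstoD(2)) (use e in simp)
    then obtain N where N: "\<And>n. n \<ge> N \<Longrightarrow> 2 ^ q * \<delta> n < e ^ q"
      by (auto simp: eventually_sequentially)
    have *: "Lp_norm (real q) (\<lambda>x. w n x - w k x) < e" if "n \<ge> N" "n \<le> k" for n k
    proof -
      have "Lp_norm (real q) (\<lambda>x. w n x - w k x) ^ q < e ^ q"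
        using key[OF that(2)] N[OF that(1)] by linarith
      then show ?thesis using e by (meson less_imp_le power_less_imp_less_base)
    qed
    show ?thesis
    proof (intro exI allI impI)
      fix n k assume nk: "N \<le> n" "N \<le> k"
      show "Lp_norm (real q) (\<lambda>x. w n x - w k x) < e"
        using *[of n k] *[of k n] nk by (cases "n \<le> k") (auto simp: Lp_norm_minus[of _ "w n"])
    qed
  qed
  from Lp_complete[OF q wL this] obtain r f where rf: "strict_mono r" "f \<in> Lp (real q)"
    "AE x in torus. (\<lambda>k. w (r k) x) \<longlonglongrightarrow> f x" "(\<lambda>k. Lp_norm (real q) (\<lambda>x. w (r k) x - f x)) \<longlonglongrightarrow> 0"
    by blast
  have "f \<in> C n" for n
  proof -
    \<comment> \<open>Dropping the first \<open>n\<close> terms suffices, because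
      \<open>r (k + n) \<ge> n\<close> and the sets decrease.\<close>
    have "w (r (k + n)) \<in> C n" for k
      using dec'[of n "r (k + n)"] w(1)[of "r (k + n)"] seq_suble[OF rf(1), of "k + n"] by auto
    moreover have "AE x in torus. (\<lambda>k. w (r (k + n)) x) \<longlonglongrightarrow> f x"
      using rf(3) by eventually_elim (rule LIMSEQ_ignore_initial_segment)
    moreover have "(\<lambda>k. Lp_norm (real q) (\<lambda>x. w (r (k + n)) x - f x)) \<longlonglongrightarrow> 0"
      using rf(4) by (rule LIMSEQ_ignore_initial_segment)
    ultimately show ?thesis by (intro Lp_closedD[OF cl rf(2), of "\<lambda>k. w (r (k + n))"])
  qed
  then show ?thesis by (rule that)
qed

text \<open>A common point of the sublevel sets at the heights infimum plus
  \<open>1 / (real n + 1)\<close> attains the infimum. Lower semicontinuity of \<open>J\<close>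
  enters as closedness of its sublevel sets, convexity as their midpoint convexity.\<close>

lemma minimizer_exists:
  fixes J :: "(real^'n \<Rightarrow> 'b::euclidean_space) \<Rightarrow> real"
  assumes q: "q \<ge> 2" and W: "W \<subseteq> Lp (real q)" "W \<noteq> {}" and J0: "\<And>f. f \<in> W \<Longrightarrow> J f \<ge> 0"
    and conv: "\<And>c. mid_convex {f \<in> W. J f \<le> c}" and cl: "\<And>c. Lp_closed (real q) {f \<in> W. J f \<le> c}"
    and bd: "\<And>c. \<exists>B. \<forall>f\<in>W. J f \<le> c \<longrightarrow> Lp_norm (real q) f \<le> B"
  obtains f where "f \<in> W" "\<And>g. g \<in> W \<Longrightarrow> J f \<le> J g"
proof -
  define m where "m = Inf (J ` W)"
  have bb: "bdd_below (J ` W)" using J0 by (intro bdd_belowI[of _ 0]) auto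
  define C where "C n = {f \<in> W. J f \<le> m + 1 / (real n + 1)}" for n :: nat
  have ne: "C n \<noteq> {}" for n
    using cInf_lessD[of "J ` W" "m + 1 / (real n + 1)"] W(2) unfolding m_def[symmetric] C_def
    by (auto intro: less_imp_le)
  have dec: "decseq C"
  proof (rule decseq_SucI)
    fix n show "C (Suc n) \<subseteq> C n"
    proof -
      have "1 / (real (Suc n) + 1) \<le> 1 / (real n + 1)" by (simp add: frac_le)
      then show ?thesis by (auto simp: C_def)
    qed
  qed
  obtain B where "\<And>f. f \<in> C 0 \<Longrightarrow> Lp_norm (real q) f \<le> B"
    using bd[of "m + 1 / (real 0 + 1)"] by (auto simp: C_def)
  then obtain f where f: "\<And>n. f \<in> C n"
    using nested_inter_nonempty[of q C B] q W(1) dec ne conv cl unfolding C_def by blast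
  have "J f \<le> m"
  proof (rule field_le_epsilon)
    fix e :: real assume "e > 0"
    then obtain n where "inverse (real (Suc n)) < e" using reals_Archimedean by blast
    then have "1 / (real n + 1) \<le> e" by (simp add: inverse_eq_divide add.commute)
    moreover have "J f \<le> m + 1 / (real n + 1)" using f[of n] by (simp add: C_def)
    ultimately show "J f \<le> m + e" by linarith
  qed
  moreover have "m \<le> J g" if "g \<in> W" for g
    unfolding m_def using that bb by (intro cInf_lower) auto
  moreover have "f \<in> W" using f[of 0] by (simp add: C_def)
  ultimately show ?thesis by (intro that[of f]) force+
qed

section \<open>Test functions and uniqueness of weak derivatives\<close>

lemma AE_torus_space: "AE x in (torus :: (real^'n) measure). \<forall>i. 0 \<le> x $ i \<and> x $ i < 1"
  using AE_space[of "torus :: (real^'n) measure"] by (simp add: space_torus)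

lemma bounded_integrable_torus:
  fixes f :: "real^'n \<Rightarrow> 'b::euclidean_space"
  assumes "f \<in> borel_measurable borel" "\<And>x. norm (f x) \<le> K"
  shows "integrable torus f"
proof -
  have [measurable]: "f \<in> borel_measurable borel" by fact
  show ?thesis by (rule torus.integrable_const_bound[of _ K]) (use assms in auto)
qed

section \<open>Periodic functions and their partial derivatives\<close>

lemma periodic_int_shift:
  fixes g :: "real^'n \<Rightarrow> 'b"
  assumes "periodic g"
  shows "g (x + of_int m *\<^sub>R axis i 1) = g x"
proof -
  have n: "g (x + of_nat n *\<^sub>R axis i 1) = g x" for n x
  proof (induction n)
    case (Suc n)
    have "x + of_nat (Suc n) *\<^sub>R axis i 1 = (x + of_nat n *\<^sub>R axis i 1) + axis i 1"
      by (simp add: algebra_simps)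
    then show ?case using Suc assms by (simp only: periodic_def)
  qed simp
  show ?thesis
  proof (cases "m \<ge> 0")
    case True
    then show ?thesis using n[of x "nat m"] by simp
  next
    case False
    then show ?thesis using n[of "x + of_int m *\<^sub>R axis i 1" "nat (- m)"] by simp
  qed
qed

lemma periodic_reduce:
  fixes g :: "real^'n \<Rightarrow> 'b"
  assumes "periodic g"
  obtains y where "y \<in> cbox 0 (1 :: real^'n)" "g x = g y"
proof -
  have *: "g (x + (\<Sum>i\<in>S. of_int (m i) *\<^sub>R axis i 1)) = g x" if "finite S" for S :: "'n set" and m :: "'n \<Rightarrow> int"
    using that
  proof induction
    case (insert i S)
    then show ?case
      using periodic_int_shift[OF assms, of "x + (\<Sum>i\<in>S. of_int (m i) *\<^sub>R axis i 1)" "m i" i]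
      by (simp add: add_ac)
  qed simp
  define y where "y = x + (\<Sum>i\<in>UNIV. of_int (- \<lfloor>x $ i\<rfloor>) *\<^sub>R axis i 1)"
  have "y $ j = x $ j - of_int \<lfloor>x $ j\<rfloor>" for j
  proof -
    have "(\<Sum>i\<in>UNIV. (of_int (- \<lfloor>x $ i\<rfloor>) *\<^sub>R axis i (1::real)) $ j) = (\<Sum>i\<in>UNIV. if i = j then - of_int \<lfloor>x $ j\<rfloor> else 0)"
      by (rule sum.cong) (auto simp: axis_def)
    then show ?thesis by (simp add: y_def sum_component)
  qed
  then have "y \<in> cbox 0 1" by (auto simp: mem_box_cart) linarith
  moreover have "g x = g y" unfolding y_def using *[of UNIV "\<lambda>i. - \<lfloor>x $ i\<rfloor>"] by simp
  ultimately show ?thesis by (rule that)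
qed

lemma periodic_continuous_bounded:
  fixes g :: "real^'n \<Rightarrow> 'b::real_normed_vector"
  assumes "periodic g" "continuous_on UNIV g"
  obtains K where "\<And>x. norm (g x) \<le> K"
proof -
  have "bounded (g ` cbox 0 1)"
    by (intro compact_imp_bounded compact_continuous_image continuous_on_subset[OF assms(2)]) auto
  then obtain K where "\<And>y. y \<in> cbox 0 1 \<Longrightarrow> norm (g y) \<le> K"
    by (auto simp: bounded_iff)
  then have "norm (g x) \<le> K" for x
    using periodic_reduce[OF assms(1), of x] by metis
  then show ?thesis by (rule that)
qed

lemma partial_deriv_eqI: "(f has_derivative f') (at x) \<Longrightarrow> partial_deriv i f x = f' (axis i 1)"
  unfolding partial_deriv_def by (metis frechet_derivative_at)

lemma partial_deriv_add:
  assumes "f differentiable (at x)" "g differentiable (at x)"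
  shows "partial_deriv i (\<lambda>x. f x + g x) x = partial_deriv i f x + partial_deriv i g x"
  unfolding partial_deriv_def[of i f] partial_deriv_def[of i g]
  using assms by (intro partial_deriv_eqI has_derivative_add) (auto simp: frechet_derivative_works)

lemma partial_deriv_mult:
  assumes "f differentiable (at x)" "g differentiable (at x)"
  shows "partial_deriv i (\<lambda>x. f x * g x) x = f x * partial_deriv i g x + partial_deriv i f x * g x"
  unfolding partial_deriv_def[of i f] partial_deriv_def[of i g]
  using assms by (intro partial_deriv_eqI has_derivative_mult) (auto simp: frechet_derivative_works)

lemma periodic_partial_deriv:
  assumes "periodic f" "\<And>x. f differentiable (at x)"
  shows "periodic (partial_deriv i f)"
  unfolding periodic_def
proof (intro allI)
  fix x j
  have "(f has_derivative frechet_derivative f (at (x + axis j 1))) (at (x + axis j 1))"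
    using assms(2) by (simp add: frechet_derivative_works)
  then have "((\<lambda>y. f (y + axis j 1)) has_derivative (\<lambda>h. frechet_derivative f (at (x + axis j 1)) h)) (at x)"
    by (intro has_derivative_compose[of "\<lambda>y. y + axis j 1" "\<lambda>h. h" x UNIV f, simplified])
       (auto intro!: derivative_eq_intros)
  moreover have "(\<lambda>y. f (y + axis j 1)) = f" using assms(1) by (simp add: periodic_def)
  ultimately show "partial_deriv i f (x + axis j 1) = partial_deriv i f x"
    unfolding partial_deriv_def[of i f "x + _"] by (subst partial_deriv_eqI) auto
qed

section \<open>Trigonometric polynomials\<close>

text \<open>The free phase \<open>c\<close> covers sines as well, so the generators are closed under
  differentiation up to constants; presenting the set as a generated algebra lets every property be
  proved by rule induction.\<close>

inductive_set trig_poly :: "(real^'n \<Rightarrow> real) set" where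
  const: "(\<lambda>x. c) \<in> trig_poly"
| cos: "(\<lambda>x. cos (2 * pi * x $ i + c)) \<in> trig_poly"
| add: "f \<in> trig_poly \<Longrightarrow> g \<in> trig_poly \<Longrightarrow> (\<lambda>x. f x + g x) \<in> trig_poly"
| mult: "f \<in> trig_poly \<Longrightarrow> g \<in> trig_poly \<Longrightarrow> (\<lambda>x. f x * g x) \<in> trig_poly"

lemma trig_poly_periodic: "(f :: real^'n \<Rightarrow> real) \<in> trig_poly \<Longrightarrow> periodic f"
proof (induction rule: trig_poly.induct)
  case (cos i c)
  have "cos (2 * pi * (x + axis j 1) $ i + c) = cos (2 * pi * x $ i + c)" for x :: "real^'n" and j
  proof (cases "i = j")
    case True
    have "2 * pi * (x + axis j 1) $ i + c = (2 * pi * x $ i + c) + 2 * pi"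
      using True by (simp add: axis_def algebra_simps)
    then show ?thesis by (simp only: cos_periodic)
  qed (simp add: axis_def)
  then show ?case by (simp add: periodic_def)
qed (auto simp: periodic_def)

lemma trig_poly_differentiable: "f \<in> trig_poly \<Longrightarrow> f differentiable (at x)"
proof (induction rule: trig_poly.induct)
  case (cos i c)
  show ?case
    by (rule differentiableI) (auto intro!: derivative_eq_intros bounded_linear.has_derivative[OF bounded_linear_vec_nth])
qed auto

lemma trig_poly_partial_deriv: "(f :: real^'n \<Rightarrow> real) \<in> trig_poly \<Longrightarrow> partial_deriv i f \<in> trig_poly"
proof (induction rule: trig_poly.induct)
  case (const c)
  have "partial_deriv i (\<lambda>x. c) = (\<lambda>x. 0)"
    by (rule ext) (auto intro!: partial_deriv_eqI[where f' = "\<lambda>h. 0", simplified])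
  then show ?case by (simp add: trig_poly.const)
next
  case (cos j c)
  have d: "((\<lambda>x::real^'n. cos (2 * pi * x $ j + c)) has_derivative (\<lambda>h. - (2 * pi * h $ j * sin (2 * pi * x $ j + c)))) (at x)" for x
    by (auto intro!: derivative_eq_intros bounded_linear.has_derivative[OF bounded_linear_vec_nth])
  \<comment> \<open>A sine is a cosine with its phase shifted by \<open>pi / 2\<close>.\<close>
  have "partial_deriv i (\<lambda>x::real^'n. cos (2 * pi * x $ j + c))
      = (\<lambda>x. (if i = j then - 2 * pi else 0) * cos (2 * pi * x $ j + (c - pi / 2)))"
  proof
    fix x :: "real^'n"
    have "cos (2 * pi * x $ j + (c - pi / 2)) = sin (2 * pi * x $ j + c)"
      using cos_diff[of "2 * pi * x $ j + c" "pi / 2"] by (simp add: add_diff_eq)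
    then show "partial_deriv i (\<lambda>x::real^'n. cos (2 * pi * x $ j + c)) x
      = (if i = j then - 2 * pi else 0) * cos (2 * pi * x $ j + (c - pi / 2))"
      by (subst partial_deriv_eqI[OF d]) (auto simp: axis_def)
  qed
  then show ?case by (simp only:) (intro trig_poly.intros)
next
  case (add f g)
  have "partial_deriv i (\<lambda>x. f x + g x) = (\<lambda>x. partial_deriv i f x + partial_deriv i g x)"
    using add by (auto simp: partial_deriv_add trig_poly_differentiable)
  then show ?case using add by (auto intro: trig_poly.intros)
next
  case (mult f g)
  have "partial_deriv i (\<lambda>x. f x * g x) = (\<lambda>x. f x * partial_deriv i g x + partial_deriv i f x * g x)"
    using mult by (auto simp: partial_deriv_mult trig_poly_differentiable)
  then show ?case using mult by (auto intro!: trig_poly.intros(3,4))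
qed

lemma differentiable_continuous_UNIV: "(\<And>x. f differentiable (at x)) \<Longrightarrow> continuous_on UNIV f"
  by (simp add: continuous_at_imp_continuous_on differentiable_imp_continuous_within)

lemma trig_poly_test_fun:
  assumes "f \<in> trig_poly"
  shows "test_fun f"
proof -
  have "f \<in> trig_poly \<Longrightarrow> cont_diff k f" for k f
    by (induction k arbitrary: f)
      (auto simp: trig_poly_differentiable trig_poly_partial_deriv differentiable_continuous_UNIV)
  then show ?thesis using assms by (auto simp: test_fun_def trig_poly_periodic)
qed

lemma test_fun_facts:
  assumes "test_fun \<phi>"
  shows "periodic \<phi>" "\<phi> differentiable (at x)" "continuous_on UNIV \<phi>"
    "continuous_on UNIV (partial_deriv i \<phi>)" "periodic (partial_deriv i \<phi>)"
proof -
  show p: "periodic \<phi>" using assms by (simp add: test_fun_def)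
  have c: "cont_diff k \<phi>" for k using assms by (simp add: test_fun_def)
  show d: "\<phi> differentiable (at x)" for x using c[of 1] by simp
  show "continuous_on UNIV \<phi>" using c[of 0] by simp
  show "continuous_on UNIV (partial_deriv i \<phi>)" using c[of 1] by simp
  show "periodic (partial_deriv i \<phi>)" by (rule periodic_partial_deriv[OF p d])
qed

lemma test_fun_measurable: "test_fun \<phi> \<Longrightarrow> \<phi> \<in> borel_measurable borel"
  "test_fun \<phi> \<Longrightarrow> partial_deriv i \<phi> \<in> borel_measurable borel"
  by (auto intro!: borel_measurable_continuous_onI test_fun_facts)

lemma test_fun_bounded:
  assumes "test_fun \<phi>"
  shows "\<exists>K. \<forall>x. \<bar>\<phi> x\<bar> \<le> K" "\<exists>K. \<forall>x. \<bar>partial_deriv i \<phi> x\<bar> \<le> K"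
  using periodic_continuous_bounded[OF test_fun_facts(1,3)[OF assms]]
    periodic_continuous_bounded[OF test_fun_facts(5,4)[OF assms]]
  by (metis real_norm_def)+

text \<open>Supplies the approximants when Weierstrass' theorem is applied to a continuous function
  composed with \<open>p\<close>.\<close>

lemma trig_poly_polynomial:
  assumes "real_polynomial_function g" "p \<in> trig_poly"
  shows "(\<lambda>x. g (p x)) \<in> trig_poly"
  using assms(1)
proof induction
  case (linear f)
  have "(\<lambda>x. f (p x)) = (\<lambda>x. f 1 * p x)"
  proof
    fix x show "f (p x) = f 1 * p x"
      using linear_cmul[OF bounded_linear.linear[OF linear], of "p x" 1] by simp
  qed
  then show ?case using assms(2) by (auto intro: trig_poly.intros)
qed (auto intro: trig_poly.intros)

section \<open>Integrable functions orthogonal to all trigonometric polynomials\<close>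

text \<open>The difference of two weak derivatives of the same function has this property. The goal
  is that it forces the function to vanish almost everywhere.\<close>

definition annihilates :: "(real^'n \<Rightarrow> real) \<Rightarrow> bool" where
  "annihilates h \<longleftrightarrow> h \<in> borel_measurable borel \<and> integrable torus h \<and>
     (\<forall>\<phi>\<in>trig_poly. (\<integral>x. h x * \<phi> x \<partial>torus) = 0)"

lemma annihilates_integral:
  assumes "annihilates h"
  shows "(\<integral>x. h x \<partial>torus) = 0"
proof -
  have "(\<integral>x. h x * (\<lambda>x. 1) x \<partial>torus) = 0"
    using assms trig_poly.const unfolding annihilates_def by fast
  then show ?thesis by simp
qed

lemma integrable_mult_bounded:
  fixes h :: "real^'n \<Rightarrow> real"
  assumes "integrable torus h" "\<phi> \<in> borel_measurable borel" "\<And>x. \<bar>\<phi> x\<bar> \<le> K"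
  shows "integrable torus (\<lambda>x. h x * \<phi> x)"
proof -
  have [measurable]: "\<phi> \<in> borel_measurable borel" by fact
  have [measurable]: "h \<in> borel_measurable torus" using assms by auto
  have "integrable torus (\<lambda>x. K * h x)" using assms by simp
  then show ?thesis
  proof (rule Bochner_Integration.integrable_bound)
    have "\<bar>h x * \<phi> x\<bar> \<le> \<bar>K * h x\<bar>" for x
    proof -
      have "\<bar>\<phi> x\<bar> \<le> \<bar>K\<bar>" using assms(3)[of x] by linarith
      then show ?thesis by (simp add: abs_mult mult.commute[of "\<bar>h x\<bar>"] mult_right_mono)
    qed
    then show "AE x in torus. norm (h x * \<phi> x) \<le> norm (K * h x)" by auto
  qed simp
qed

text \<open>
  A continuous function of a trigonometric polynomial is a uniform limit of trigonometric
  polynomials, so $h$ may be multiplied by the indicator of a set $\{p > 0\}$ without losing the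
  annihilation property. Products of arcs $\{\cos (2 \pi x_i - c) > c'\}$ are boxes.
\<close>

lemma annihilates_positive:
  fixes h :: "real^'n \<Rightarrow> real"
  assumes h: "annihilates h" and p: "p \<in> trig_poly"
  shows "annihilates (\<lambda>x. h x * indicator {x. p x > 0} x)"
proof -
  have hm [measurable]: "h \<in> borel_measurable borel" and hi: "integrable torus h"
    and h0: "\<And>\<phi>. \<phi> \<in> trig_poly \<Longrightarrow> (\<integral>x. h x * \<phi> x \<partial>torus) = 0"
    using h by (auto simp: annihilates_def)
  have [measurable]: "p \<in> borel_measurable borel" using p by (simp add: test_fun_measurable trig_poly_test_fun)
  obtain K where K: "\<And>x. \<bar>p x\<bar> \<le> K" using test_fun_bounded(1)[OF trig_poly_test_fun[OF p]] by auto
  have *: "(\<integral>x. h x * indicator {x. p x > 0} x * \<phi> x \<partial>torus) = 0" if \<phi>: "\<phi> \<in> trig_poly" for \<phi>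
  proof -
    have [measurable]: "\<phi> \<in> borel_measurable borel" using \<phi> by (simp add: test_fun_measurable trig_poly_test_fun)
    obtain L where L: "\<And>x. \<bar>\<phi> x\<bar> \<le> L" using test_fun_bounded(1)[OF trig_poly_test_fun[OF \<phi>]] by auto
    have h\<phi>: "integrable torus (\<lambda>x. h x * \<phi> x)" by (rule integrable_mult_bounded[OF hi _ L]) simp
    have r: "(\<integral>x. h x * \<phi> x * r (p x) \<partial>torus) = 0" if r: "continuous_on UNIV r" for r :: "real \<Rightarrow> real"
    proof -
      have [measurable]: "r \<in> borel_measurable borel" using r by (rule borel_measurable_continuous_onI)
      have "bounded (r ` {-K..K})"
        by (intro compact_imp_bounded compact_continuous_image continuous_on_subset[OF r]) auto
      then obtain B where "\<forall>t\<in>{-K..K}. \<bar>r t\<bar> \<le> B" by (auto simp: bounded_iff)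
      then have B: "\<bar>r (p x)\<bar> \<le> B" for x using K[of x] by (auto simp: abs_le_iff)
      have i1: "integrable torus (\<lambda>x. h x * \<phi> x * r (p x))"
        by (rule integrable_mult_bounded[OF h\<phi> _ B]) simp
      have "\<bar>\<integral>x. h x * \<phi> x * r (p x) \<partial>torus\<bar> \<le> 0 + e" if e: "e > 0" for e
      proof -
        \<comment> \<open>A uniform error \<open>e'\<close> in approximating \<open>r\<close> costs
          at most \<open>e\<close> in the integral; the added 1 guards against a vanishing
          integral.\<close>
        define e' where "e' = e / ((\<integral>x. \<bar>h x * \<phi> x\<bar> \<partial>torus) + 1)"
        have nn: "(\<integral>x. \<bar>h x * \<phi> x\<bar> \<partial>torus) \<ge> 0" by simp
        have e': "e' > 0" unfolding e'_def using e nn by (intro divide_pos_pos add_nonneg_pos) auto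
        have "\<exists>g. real_polynomial_function g \<and> (\<forall>t\<in>{-K..K}. \<bar>r t - g t\<bar> < e')"
          by (rule Stone_Weierstrass_real_polynomial_function[of "{-K..K}", OF compact_Icc continuous_on_subset[OF r subset_UNIV] e']) blast
        then obtain g where g: "real_polynomial_function g" "\<And>t. t \<in> {-K..K} \<Longrightarrow> \<bar>r t - g t\<bar> < e'"
          by blast
        have gp: "(\<lambda>x. g (p x)) \<in> trig_poly" by (rule trig_poly_polynomial[OF g(1) p])
        have gm: "(\<lambda>x. g (p x)) \<in> borel_measurable borel" using gp by (simp add: test_fun_measurable trig_poly_test_fun)
        obtain G where G: "\<And>x. \<bar>g (p x)\<bar> \<le> G" using test_fun_bounded(1)[OF trig_poly_test_fun[OF gp]] by auto
        have i2: "integrable torus (\<lambda>x. h x * \<phi> x * g (p x))"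
          by (rule integrable_mult_bounded[OF h\<phi> gm G])
        have "(\<integral>x. h x * \<phi> x * g (p x) \<partial>torus) = 0"
          using h0[OF trig_poly.mult[OF \<phi> gp]] by (simp add: mult.assoc)
        then have "\<bar>\<integral>x. h x * \<phi> x * r (p x) \<partial>torus\<bar> = \<bar>\<integral>x. h x * \<phi> x * (r (p x) - g (p x)) \<partial>torus\<bar>"
          using i1 i2 by (simp add: right_diff_distrib)
        also have "\<dots> \<le> (\<integral>x. e' * \<bar>h x * \<phi> x\<bar> \<partial>torus)"
        proof (rule order_trans[OF integral_abs_bound integral_mono])
          fix x
          have "p x \<in> {-K..K}" using K[of x] by auto
          from g(2)[OF this] have "\<bar>h x * \<phi> x\<bar> * \<bar>r (p x) - g (p x)\<bar> \<le> \<bar>h x * \<phi> x\<bar> * e'"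
            by (intro mult_left_mono) auto
          then show "\<bar>h x * \<phi> x * (r (p x) - g (p x))\<bar> \<le> e' * \<bar>h x * \<phi> x\<bar>"
            by (simp only: abs_mult mult.commute[of e'])
        qed (use i1 i2 h\<phi> in \<open>auto simp: right_diff_distrib\<close>)
        also have "\<dots> = e' * (\<integral>x. \<bar>h x * \<phi> x\<bar> \<partial>torus)" by simp
        also have "\<dots> \<le> e' * ((\<integral>x. \<bar>h x * \<phi> x\<bar> \<partial>torus) + 1)"
          using e' by (intro mult_left_mono) auto
        also have "\<dots> = e"
        proof -
          have "(\<integral>x. \<bar>h x * \<phi> x\<bar> \<partial>torus) + 1 \<noteq> 0" using nn by linarith
          then show ?thesis by (simp add: e'_def)
        qed
        finally show ?thesis by simp
      qed
      then have "\<bar>\<integral>x. h x * \<phi> x * r (p x) \<partial>torus\<bar> \<le> 0" by (rule field_le_epsilon)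
      then show ?thesis by simp
    qed
    \<comment> \<open>Continuous ramps with values in [0, 1] that vanish for
      \<open>t \<le> 0\<close> and converge pointwise to the indicator of the positive
      reals.\<close>
    define R where "R n t = min 1 (max 0 (real n * t))" for n :: nat and t :: real
    have Rc: "continuous_on UNIV (R n)" for n unfolding R_def by (intro continuous_intros)
    have [measurable]: "R n \<in> borel_measurable borel" for n by (rule borel_measurable_continuous_onI[OF Rc])
    have R_lim: "(\<lambda>n. R n t) \<longlonglongrightarrow> indicator {t. t > 0} t" for t
    proof (cases "t > 0")
      case True
      have "\<forall>\<^sub>F n in sequentially. R n t = 1"
        using eventually_ge_at_top[of "nat \<lceil>1 / t\<rceil>"]
      proof eventually_elim
        case (elim n)
        then have "1 / t \<le> real n" by linarith
        then have "1 \<le> real n * t" using True by (simp add: field_simps)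
        then show ?case by (simp add: R_def)
      qed
      then show ?thesis using True by (simp add: tendsto_eventually)
    next
      case False
      then have "R n t = 0" for n by (simp add: R_def mult_nonneg_nonpos)
      then show ?thesis using False by simp
    qed
    have "(\<lambda>n. \<integral>x. h x * \<phi> x * R n (p x) \<partial>torus) \<longlonglongrightarrow> (\<integral>x. h x * \<phi> x * indicator {t. t > 0} (p x) \<partial>torus)"
    proof (rule integral_dominated_convergence[where w = "\<lambda>x. \<bar>h x * \<phi> x\<bar>"])
      show "AE x in torus. norm (h x * \<phi> x * R n (p x)) \<le> \<bar>h x * \<phi> x\<bar>" for n
        by (rule AE_I2) (auto simp: abs_mult R_def intro!: mult_left_le)
      show "AE x in torus. (\<lambda>n. h x * \<phi> x * R n (p x)) \<longlonglongrightarrow> h x * \<phi> x * indicator {t. t > 0} (p x)"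
        by (intro AE_I2 tendsto_intros R_lim)
    qed (use h\<phi> in auto)
    then have "(\<integral>x. h x * \<phi> x * indicator {t. t > 0} (p x) \<partial>torus) = 0"
      by (simp add: r[OF Rc] LIMSEQ_const_iff)
    moreover have "(\<lambda>x. h x * \<phi> x * indicator {t. t > 0} (p x)) = (\<lambda>x. h x * indicator {x. p x > 0} x * \<phi> x)"
      by (auto simp: indicator_def)
    ultimately show ?thesis by simp
  qed
  have "integrable torus (\<lambda>x. h x * indicator {x. p x > 0} x)"
    by (rule integrable_mult_bounded[OF hi, of _ 1]) (auto simp: indicator_def)
  then show ?thesis using * by (auto simp: annihilates_def)
qed

text \<open>On the circle, the cosine centred at the midpoint of \<open>a\<close> and
  \<open>b\<close> exceeds its value at the endpoints exactly on the arc between them. The rescaled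
  distance \<open>y\<close> from the midpoint decides: the cosine of \<open>pi * y\<close> decreases
  up to \<open>y = 1\<close>.\<close>

lemma arc_iff:
  fixes t a b :: real
  assumes "0 \<le> a" "a < b" "b \<le> 1" "0 \<le> t" "t < 1"
  shows "cos (2 * pi * t - pi * (a + b)) > cos (pi * (b - a)) \<longleftrightarrow> a < t \<and> t < b"
proof -
  define y where "y = \<bar>2 * t - (a + b)\<bar>"
  have "cos (2 * pi * t - pi * (a + b)) = cos (pi * y)"
  proof -
    have "2 * pi * t - pi * (a + b) = pi * (2 * t - (a + b))" by (simp add: algebra_simps)
    moreover have "cos (pi * (2 * t - (a + b))) = cos (pi * y)"
      using cos_minus[of "pi * (2 * t - (a + b))"] unfolding y_def abs_if minus_mult_right by simp
    ultimately show ?thesis by simp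
  qed
  moreover have "y \<ge> 0" "y \<le> 2 - (b - a)" using assms by (auto simp: y_def abs_if)
  moreover have "cos (pi * y) > cos (pi * (b - a)) \<longleftrightarrow> y < b - a"
  proof (cases "y \<le> 1")
    case True
    then show ?thesis using assms \<open>y \<ge> 0\<close> by (subst cos_mono_less_eq) (auto simp: mult_le_cancel_left1)
  next
    case False
    \<comment> \<open>Past the antipode the reflected distance \<open>2 - y\<close> takes over. It
      is at least \<open>b - a\<close> because the arc lies inside [0, 1].\<close>
    have "cos (pi * y) = cos (pi * (2 - y))" using cos_2pi_minus[of "pi * y"] by (simp add: algebra_simps)
    also have "\<dots> \<le> cos (pi * (b - a))"
      using False assms \<open>y \<le> 2 - (b - a)\<close> by (subst cos_mono_le_eq) (auto simp: mult_le_cancel_left1)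
    finally show ?thesis using False assms by auto
  qed
  moreover have "y < b - a \<longleftrightarrow> a < t \<and> t < b" by (auto simp: y_def abs_if)
  ultimately show ?thesis by simp
qed

lemma annihilates_box:
  fixes h :: "real^'n \<Rightarrow> real"
  assumes h: "annihilates h"
  shows "(\<integral>x. h x * indicator (box a b) x \<partial>torus) = 0"
proof -
  \<comment> \<open>An arbitrary box is clipped to the unit cube so that each side becomes an arc to
    which \<open>arc_iff\<close> applies.\<close>
  define a' b' where "a' i = max 0 (a $ i)" and "b' i = min 1 (b $ i)" for i
  \<comment> \<open>Clipping a side with \<open>a $ i < 0\<close> loses the face
    \<open>x $ i = 0\<close>, which is a null set.\<close>
  have "AE x in lborel. \<forall>i. (x::real^'n) $ i \<noteq> 0"
  proof (subst AE_all_countable, intro allI)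
    fix i
    have "{x::real^'n. x $ i = 0} \<in> null_sets lebesgue"
      using negligible_standard_hyperplane_cart[of i] by (simp add: negligible_iff_null_sets)
    moreover have "{x::real^'n. x $ i = 0} \<in> sets borel"
      by (intro borel_closed closed_Collect_eq continuous_intros)
    ultimately have "{x::real^'n. x $ i = 0} \<in> null_sets lborel"
      by (auto simp: null_sets_def)
    then show "AE x in lborel. (x::real^'n) $ i \<noteq> 0" by (auto dest: AE_not_in)
  qed
  then have AE0: "AE x in torus. \<forall>i. (x::real^'n) $ i \<noteq> 0"
    unfolding torus_def using sets_cube by (subst AE_restrict_space_iff) (auto elim: eventually_mono)
  have box: "AE x in torus. indicator (box a b) x = (if \<forall>i. a' i < x $ i \<and> x $ i < b' i then 1 else (0::real))"
    using AE0 AE_torus_space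
  proof eventually_elim
    case (elim x)
    then have "0 < x $ i" "x $ i < 1" for i by (auto simp: less_le)
    then show ?case by (simp add: indicator_def mem_box_cart a'_def b'_def)
  qed
  have hm [measurable]: "h \<in> borel_measurable borel" using h by (simp add: annihilates_def)
  have [measurable]: "(\<lambda>x::real^'n. x $ i) \<in> borel_measurable borel" for i
    by (intro borel_measurable_continuous_onI continuous_intros)
  have eq1: "(\<integral>x. h x * indicator (box a b) x \<partial>torus) = (\<integral>x. h x * (if \<forall>i. a' i < x $ i \<and> x $ i < b' i then 1 else 0) \<partial>torus)"
    by (rule integral_cong_AE) (use box in auto)
  show ?thesis
  proof (cases "\<forall>i. a' i < b' i")
    case False
    then obtain i where "\<not> a' i < b' i" by blast
    then have "\<not> (\<forall>i. a' i < x $ i \<and> x $ i < b' i)" for x :: "real^'n" using less_trans by blast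
    then show ?thesis unfolding eq1 by (simp only: if_False mult_zero_right Bochner_Integration.integral_zero)
  next
    case True
    define p where "p i x = cos (2 * pi * x $ i + (- pi * (a' i + b' i))) + (- cos (pi * (b' i - a' i)))" for i and x :: "real^'n"
    have p: "p i \<in> trig_poly" for i unfolding p_def by (intro trig_poly.intros)
    \<comment> \<open>Each coordinate contributes one indicator factor, so the box is built by
      multiplying them in one after another.\<close>
    have "annihilates (\<lambda>x. h x * (if \<forall>i\<in>I. p i x > 0 then 1 else 0))" if "finite I" for I
      using that
    proof induction
      case empty
      then show ?case using h by simp
    next
      case (insert j I)
      have "(\<lambda>x. h x * (if \<forall>i\<in>insert j I. p i x > 0 then 1 else 0)) =
         (\<lambda>x. h x * (if \<forall>i\<in>I. p i x > 0 then 1 else 0) * indicator {x. p j x > 0} x)"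
        by (auto simp: indicator_def)
      then show ?case using annihilates_positive[OF insert.IH p[of j]] by simp
    qed
    from this[of UNIV] have "annihilates (\<lambda>x. h x * (if \<forall>i. p i x > 0 then 1 else 0))" by simp
    then have "(\<integral>x. h x * (if \<forall>i. p i x > 0 then 1 else 0) \<partial>torus) = 0"
      by (rule annihilates_integral)
    moreover have "(\<integral>x. h x * (if \<forall>i. a' i < x $ i \<and> x $ i < b' i then 1 else 0) \<partial>torus)
       = (\<integral>x. h x * (if \<forall>i. p i x > 0 then 1 else 0) \<partial>torus)"
    proof (rule Bochner_Integration.integral_cong[OF refl])
      fix x :: "real^'n" assume "x \<in> space torus"
      then have "0 \<le> x $ i" "x $ i < 1" for i by (auto simp: space_torus)
      then have "p i x > 0 \<longleftrightarrow> a' i < x $ i \<and> x $ i < b' i" for i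
        using arc_iff[of "a' i" "b' i" "x $ i"] True by (simp add: p_def a'_def b'_def)
      then show "h x * (if \<forall>i. a' i < x $ i \<and> x $ i < b' i then 1 else 0) = h x * (if \<forall>i. p i x > 0 then 1 else 0)"
        by simp
    qed
    ultimately show ?thesis using eq1 by simp
  qed
qed

text \<open>Open boxes form an intersection-stable generator of the Borel sets, so a Dynkin argument
  extends the vanishing integral from boxes to all Borel sets. Testing with the sets where
  \<open>h\<close> is positive and where it is negative then gives the claim.\<close>

lemma annihilates_AE_0:
  fixes h :: "real^'n \<Rightarrow> real"
  assumes h: "annihilates h"
  shows "AE x in torus. h x = 0"
proof -
  have hm [measurable]: "h \<in> borel_measurable borel" and hi: "integrable torus h"
    using h by (auto simp: annihilates_def)
  have hA: "integrable torus (\<lambda>x. h x * indicator A x)" if "A \<in> sets borel" for A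
    by (rule integrable_mult_bounded[OF hi, of _ 1]) (use that in \<open>auto simp: indicator_def\<close>)
  have h0: "(\<integral>x. h x \<partial>torus) = 0" by (rule annihilates_integral[OF h])
  have *: "(\<integral>x. h x * indicator A x \<partial>torus) = 0" if "A \<in> sets borel" for A
  proof -
    let ?G = "range (\<lambda>(a, b). box a b :: (real^'n) set)"
    have "Int_stable ?G"
      by (auto simp: Int_stable_def box_Int_box)
    moreover have "?G \<subseteq> Pow UNIV" by auto
    moreover have "A \<in> sigma_sets UNIV ?G" using that unfolding borel_eq_box by simp
    ultimately show ?thesis
    proof (induction rule: sigma_sets_induct_disjoint)
      case (basic A)
      then show ?case using annihilates_box[OF h] by auto
    next
      case (compl A)
      have A: "A \<in> sets borel" using compl(1) by (simp add: borel_eq_box)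
      have "(\<lambda>x. h x * indicator (UNIV - A) x) = (\<lambda>x. h x - h x * indicator A x)"
        by (auto simp: indicator_def)
      then show ?case using compl hA[OF A] hi h0 by simp
    next
      case (union A)
      have A: "A i \<in> sets borel" for i using union(2) by (auto simp: borel_eq_box)
      have "(\<lambda>n. \<integral>x. h x * indicator (\<Union>i<n. A i) x \<partial>torus) \<longlonglongrightarrow> (\<integral>x. h x * indicator (\<Union>i. A i) x \<partial>torus)"
      proof (rule integral_dominated_convergence[where w = "\<lambda>x. \<bar>h x\<bar>"])
        show "AE x in torus. (\<lambda>n. h x * indicator (\<Union>i<n. A i) x) \<longlonglongrightarrow> h x * indicator (\<Union>i. A i) x"
        proof (intro AE_I2 tendsto_intros)
          fix x
          show "(\<lambda>n. indicator (\<Union>i<n. A i) x) \<longlonglongrightarrow> (indicator (\<Union>i. A i) x :: real)"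
          proof (cases "x \<in> (\<Union>i. A i)")
            case True
            then obtain i where i: "x \<in> A i" by auto
            have "\<forall>\<^sub>F n in sequentially. indicator (\<Union>i<n. A i) x = (1::real)"
              using eventually_gt_at_top[of i] by eventually_elim (use i in \<open>auto simp: indicator_def\<close>)
            then show ?thesis using True by (simp add: tendsto_eventually)
          qed (auto simp: indicator_def)
        qed
        show "AE x in torus. norm (h x * indicator (\<Union>i<n. A i) x) \<le> \<bar>h x\<bar>" for n
          by (rule AE_I2) (auto simp: indicator_def)
      qed (use hi A in auto)
      moreover have "(\<integral>x. h x * indicator (\<Union>i<n. A i) x \<partial>torus) = 0" for n
      proof -
        have "(\<lambda>x. h x * indicator (\<Union>i<n. A i) x) = (\<lambda>x. \<Sum>i<n. h x * indicator (A i) x)"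
        proof
          fix x
          have "indicator (\<Union>i<n. A i) x = (\<Sum>i<n. indicator (A i) x :: real)"
            using union(1) by (subst indicator_UN_disjoint) (auto intro: disjoint_family_on_mono)
          then show "h x * indicator (\<Union>i<n. A i) x = (\<Sum>i<n. h x * indicator (A i) x)"
            by (simp add: sum_distrib_left)
        qed
        then have "(\<integral>x. h x * indicator (\<Union>i<n. A i) x \<partial>torus) = (\<Sum>i<n. \<integral>x. h x * indicator (A i) x \<partial>torus)"
          using hA[OF A] by (simp only: Bochner_Integration.integral_sum)
        then show ?thesis using union(3) by simp
      qed
      ultimately show ?case by (simp add: LIMSEQ_const_iff)
    qed simp
  qed
  have P: "AE x in torus. h x * indicator {x. h x > 0} x = 0"
    using *[of "{x. h x > 0}"] hA[of "{x. h x > 0}"]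
    by (subst integral_nonneg_eq_0_iff_AE[symmetric]) (auto simp: indicator_def)
  have N: "AE x in torus. - (h x * indicator {x. h x < 0} x) = 0"
    using *[of "{x. h x < 0}"] hA[of "{x. h x < 0}"]
    by (subst integral_nonneg_eq_0_iff_AE[symmetric]) (auto simp: indicator_def)
  show ?thesis using P N by eventually_elim (auto simp: indicator_def split: if_splits)
qed

text \<open>This connects the arbitrary choice made by \<open>weak_deriv\<close> with any concrete
  weak derivative at hand.\<close>

lemma weak_deriv_unique:
  assumes "has_weak_deriv i g h" "has_weak_deriv i g h'"
  shows "AE x in torus. h x = h' x"
proof -
  have L: "h \<in> Lp (real 1)" "h' \<in> Lp (real 1)" using assms by (auto simp: has_weak_deriv_def)
  have i: "integrable torus h" "integrable torus h'" using Lp_integrable[of 1] L by auto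
  have m: "h \<in> borel_measurable borel" "h' \<in> borel_measurable borel" using L by (auto simp: Lp_def)
  have "(\<integral>x. (h x - h' x) * \<phi> x \<partial>torus) = 0" if \<phi>: "\<phi> \<in> trig_poly" for \<phi>
  proof -
    note t = trig_poly_test_fun[OF \<phi>]
    obtain K where "\<And>x. \<bar>\<phi> x\<bar> \<le> K" using test_fun_bounded(1)[OF t] by auto
    then have "integrable torus (\<lambda>x. h x * \<phi> x)" "integrable torus (\<lambda>x. h' x * \<phi> x)"
      using i test_fun_measurable(1)[OF t] by (auto intro: integrable_mult_bounded)
    moreover have "(\<integral>x. h x * \<phi> x \<partial>torus) = (\<integral>x. h' x * \<phi> x \<partial>torus)"
      using assms t by (auto simp: has_weak_deriv_def)
    ultimately show ?thesis by (simp add: left_diff_distrib)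
  qed
  then have "annihilates (\<lambda>x. h x - h' x)" using i m by (auto simp: annihilates_def)
  from annihilates_AE_0[OF this] show ?thesis by auto
qed

section \<open>Integration by parts and the Sobolev space\<close>

lemma lborel_integral_shift:
  fixes f :: "real^'n \<Rightarrow> real"
  assumes "f \<in> borel_measurable borel"
  shows "(\<integral>x. f (c + x) \<partial>lborel) = (\<integral>x. f x \<partial>lborel)"
proof -
  have "(\<integral>x. f x \<partial>lborel) = (\<integral>x. f x \<partial>distr lborel borel ((+) c))"
    by (simp add: lborel_distr_plus)
  also have "\<dots> = (\<integral>x. f (c + x) \<partial>lborel)"
    by (rule integral_distr) (use assms in auto)
  finally show ?thesis ..
qed

text \<open>The shifted cube overhangs the unit cube by a slab of width \<open>t\<close>;
  periodicity moves the slab back by one period, where it fills the gap left at the other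
  end.\<close>

lemma torus_integral_shift:
  fixes g :: "real^'n \<Rightarrow> real"
  assumes g: "periodic g" and gm [measurable]: "g \<in> borel_measurable borel" and K: "\<And>x. \<bar>g x\<bar> \<le> K"
    and t: "0 \<le> t" "t \<le> 1"
  shows "(\<integral>x. g (x + t *\<^sub>R axis i 1) \<partial>torus) = (\<integral>x. g x \<partial>torus)"
proof -
  have [measurable]: "(\<lambda>x::real^'n. x $ i) \<in> borel_measurable borel" for i
    by (intro borel_measurable_continuous_onI continuous_intros)
  \<comment> \<open>The unit cube with its side in direction \<open>i\<close> replaced by
    \<open>I\<close>; half-open intervals split without overlaps or gaps.\<close>
  define C where "C I = {y::real^'n. (\<forall>j. j \<noteq> i \<longrightarrow> 0 \<le> y $ j \<and> y $ j < 1) \<and> y $ i \<in> I}" for I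
  have Cm [measurable]: "C {a..<b} \<in> sets borel" for a b
    unfolding C_def by measurable
  have Q: "{x. \<forall>i. 0 \<le> x $ i \<and> x $ i < 1} = C {0..<1}"
    unfolding C_def by auto
  have Qm: "C {0..<1} \<inter> space lborel \<in> sets lborel" by simp
  have int: "integrable lborel (\<lambda>x. indicator (C {a..<b}) x * g x)" if "0 \<le> a" "b \<le> 2" for a b
  proof (rule Bochner_Integration.integrable_bound)
    show "integrable lborel (\<lambda>x. K * indicator (cbox 0 (\<chi> i. 2)) x :: real)"
      by (intro integrable_mult_right integrable_real_indicator) (auto simp: emeasure_lborel_cbox_eq)
    have K0: "K \<ge> 0" using K[of 0] by linarith
    have "C {a..<b} \<subseteq> cbox 0 (\<chi> i. 2)"
    proof
      fix x assume x: "x \<in> C {a..<b}"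
      have "0 \<le> x $ j \<and> x $ j \<le> 2" for j
        using x that by (cases "j = i") (force simp: C_def)+
      then show "x \<in> cbox 0 (\<chi> i. 2)" by (simp add: mem_box_cart)
    qed
    then show "AE x in lborel. norm (indicator (C {a..<b}) x * g x) \<le> norm (K * indicator (cbox 0 (\<chi> i. 2)) x)"
      using K K0 by (intro AE_I2) (auto simp: indicator_def)
  qed simp
  have split: "(\<integral>x. indicator (C {a..<b}) x * g x \<partial>lborel) + (\<integral>x. indicator (C {b..<c}) x * g x \<partial>lborel)
      = (\<integral>x. indicator (C {a..<c}) x * g x \<partial>lborel)" if "0 \<le> a" "a \<le> b" "b \<le> c" "c \<le> 2" for a b c
  proof -
    have "(\<lambda>x. indicator (C {a..<c}) x * g x) = (\<lambda>x. indicator (C {a..<b}) x * g x + indicator (C {b..<c}) x * g x)"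
      using that by (auto simp: indicator_def C_def fun_eq_iff)
    then show ?thesis using int[of a b] int[of b c] that by simp
  qed
  have "(\<integral>x. g (x + t *\<^sub>R axis i 1) \<partial>torus) = (\<integral>x. indicator (C {0..<1}) x * g (x + t *\<^sub>R axis i 1) \<partial>lborel)"
    unfolding torus_def Q by (subst integral_restrict_space[OF Qm]) simp
  also have "\<dots> = (\<integral>x. indicator (C {0..<1}) (- (t *\<^sub>R axis i 1) + x) * g (- (t *\<^sub>R axis i 1) + x + t *\<^sub>R axis i 1) \<partial>lborel)"
    by (rule lborel_integral_shift[symmetric]) measurable
  also have "(\<lambda>x. indicator (C {0..<1}) (- (t *\<^sub>R axis i 1) + x) * g (- (t *\<^sub>R axis i 1) + x + t *\<^sub>R axis i 1))
     = (\<lambda>x. indicator (C {t..<1+t}) x * g x)"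
    by (auto simp: indicator_def C_def axis_def fun_eq_iff)
  also have "(\<integral>x. indicator (C {t..<1+t}) x * g x \<partial>lborel)
     = (\<integral>x. indicator (C {t..<1}) x * g x \<partial>lborel) + (\<integral>x. indicator (C {1..<1+t}) x * g x \<partial>lborel)"
    using t by (intro split[symmetric]) auto
  also have "(\<integral>x. indicator (C {1..<1+t}) x * g x \<partial>lborel)
     = (\<integral>x. indicator (C {1..<1+t}) (axis i 1 + x) * g (axis i 1 + x) \<partial>lborel)"
    by (rule lborel_integral_shift[symmetric]) measurable
  also have "(\<lambda>x. indicator (C {1..<1+t}) (axis i 1 + x) * g (axis i 1 + x)) = (\<lambda>x. indicator (C {0..<t}) x * g x)"
    using g by (auto simp: indicator_def C_def axis_def fun_eq_iff periodic_def add.commute)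
  also have "(\<integral>x. indicator (C {t..<1}) x * g x \<partial>lborel) + (\<integral>x. indicator (C {0..<t}) x * g x \<partial>lborel)
     = (\<integral>x. indicator (C {0..<1}) x * g x \<partial>lborel)"
    using t split[of 0 t 1] by simp
  also have "\<dots> = (\<integral>x. g x \<partial>torus)"
    unfolding torus_def Q by (subst integral_restrict_space[OF Qm]) simp
  finally show ?thesis .
qed

text \<open>Every difference quotient integrates to 0 by translation invariance, and the quotients
  converge to the derivative. The mean value theorem bounds them by a constant, which justifies
  dominated convergence and makes iterated integration unnecessary.\<close>

lemma integral_partial_deriv_0:
  fixes h :: "real^'n \<Rightarrow> real"
  assumes h: "periodic h" "\<And>x. h differentiable (at x)" and c: "continuous_on UNIV (partial_deriv i h)"
  shows "(\<integral>x. partial_deriv i h x \<partial>torus) = 0"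
proof -
  have hc: "continuous_on UNIV h" by (rule differentiable_continuous_UNIV[OF h(2)])
  have hm [measurable]: "h \<in> borel_measurable borel" "partial_deriv i h \<in> borel_measurable borel"
    by (intro borel_measurable_continuous_onI hc c)+
  have "\<exists>B. \<forall>x. \<bar>h x\<bar> \<le> B" "\<exists>K. \<forall>x. \<bar>partial_deriv i h x\<bar> \<le> K"
    using periodic_continuous_bounded[OF h(1) hc] periodic_continuous_bounded[OF periodic_partial_deriv[OF h] c]
    by (metis real_norm_def)+
  then obtain B K where B: "\<And>x. \<bar>h x\<bar> \<le> B" and K: "\<And>x. \<bar>partial_deriv i h x\<bar> \<le> K" by auto
  have D: "((\<lambda>s. h (x + s *\<^sub>R axis i 1)) has_field_derivative partial_deriv i h (x + s *\<^sub>R axis i 1)) (at s)" for x s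
  proof -
    let ?D = "frechet_derivative h (at (x + s *\<^sub>R axis i 1))"
    have d: "(h has_derivative ?D) (at (x + s *\<^sub>R axis i 1))"
      using h(2) by (simp add: frechet_derivative_works)
    have "((\<lambda>s. h (x + s *\<^sub>R axis i 1)) has_derivative (\<lambda>r. ?D (r *\<^sub>R axis i 1))) (at s)"
      by (rule has_derivative_compose[where f = "\<lambda>s. x + s *\<^sub>R axis i 1" and g = h, OF _ d])
        (auto intro!: derivative_eq_intros)
    moreover have "?D (r *\<^sub>R axis i 1) = partial_deriv i h (x + s *\<^sub>R axis i 1) * r" for r
      using linear_cmul[OF has_derivative_linear[OF d]] by (simp add: partial_deriv_def)
    ultimately show ?thesis by (simp add: has_field_derivative_def)
  qed
  define \<tau> where "\<tau> n = 1 / (real n + 1)" for n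
  have \<tau>: "0 < \<tau> n" "\<tau> n \<le> 1" for n by (auto simp: \<tau>_def)
  have \<tau>0: "\<tau> \<longlonglongrightarrow> 0"
    unfolding \<tau>_def by (rule LIMSEQ_one_over_add_1)
  define q where "q n x = (h (x + \<tau> n *\<^sub>R axis i 1) - h x) / \<tau> n" for n x
  have lim: "(\<lambda>n. q n x) \<longlonglongrightarrow> partial_deriv i h x" for x
  proof -
    have "((\<lambda>t. (h (x + (0 + t) *\<^sub>R axis i 1) - h (x + 0 *\<^sub>R axis i 1)) / t) \<longlongrightarrow> partial_deriv i h (x + 0 *\<^sub>R axis i 1)) (at 0)"
      by (rule DERIV_D[OF D])
    then have "((\<lambda>t. (h (x + t *\<^sub>R axis i 1) - h x) / t) \<longlongrightarrow> partial_deriv i h x) (at 0)" by simp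
    moreover have "filterlim \<tau> (at 0) sequentially"
      using \<tau>0 \<tau>(1) by (auto simp: filterlim_at less_imp_neq[symmetric] intro!: always_eventually) 
    ultimately show ?thesis unfolding q_def by (rule filterlim_compose)
  qed
  have bnd: "\<bar>q n x\<bar> \<le> K" for n x
  proof -
    obtain z where "h (x + \<tau> n *\<^sub>R axis i 1) - h (x + 0 *\<^sub>R axis i 1) = (\<tau> n - 0) * partial_deriv i h (x + z *\<^sub>R axis i 1)"
      using MVT2[of 0 "\<tau> n" "\<lambda>s. h (x + s *\<^sub>R axis i 1)" "\<lambda>s. partial_deriv i h (x + s *\<^sub>R axis i 1)"] D \<tau>(1)[of n]
      by blast
    then have "q n x = partial_deriv i h (x + z *\<^sub>R axis i 1)"
      using \<tau>(1)[of n] by (simp add: q_def)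
    then show ?thesis using K by simp
  qed
  have "(\<lambda>n. \<integral>x. q n x \<partial>torus) \<longlonglongrightarrow> (\<integral>x. partial_deriv i h x \<partial>torus)"
  proof (rule integral_dominated_convergence[where w = "\<lambda>x. K"])
    show "q n \<in> borel_measurable torus" for n unfolding q_def by measurable
    show "AE x in torus. norm (q n x) \<le> K" for n using bnd by simp
  qed (use lim in auto)
  moreover have "(\<integral>x. q n x \<partial>torus) = 0" for n
  proof -
    have "(\<integral>x. q n x \<partial>torus) = ((\<integral>x. h (x + \<tau> n *\<^sub>R axis i 1) \<partial>torus) - (\<integral>x. h x \<partial>torus)) / \<tau> n"
      unfolding q_def
      by (subst Bochner_Integration.integral_diff[symmetric]) (auto intro!: bounded_integrable_torus[of _ B] B)
    also have "\<dots> = 0"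
      using torus_integral_shift[OF h(1) hm(1) B, of "\<tau> n" i] \<tau>[of n] by simp
    finally show ?thesis .
  qed
  ultimately show ?thesis by (simp add: LIMSEQ_const_iff)
qed

lemma bounded_Lp:
  fixes f :: "real^'n \<Rightarrow> 'b::euclidean_space"
  assumes "q > 0" "periodic f" "f \<in> borel_measurable borel" "\<And>x. norm (f x) \<le> K"
  shows "f \<in> Lp (real q)"
proof -
  have [measurable]: "f \<in> borel_measurable borel" by fact
  have "integrable torus (\<lambda>x. norm (f x) ^ q)"
    by (rule bounded_integrable_torus[of _ "K ^ q"]) (auto intro!: power_mono assms)
  then show ?thesis using assms by (simp add: Lp_nat)
qed

section \<open>Calculus of weak derivatives\<close>

text \<open>Integration by parts: the partial derivative of the product of two test functions has
  integral 0.\<close>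

lemma has_weak_deriv_test_fun:
  assumes "test_fun \<phi>"
  shows "has_weak_deriv i \<phi> (partial_deriv i \<phi>)"
proof -
  note f = test_fun_facts[OF assms]
  obtain K where K: "\<And>x. \<bar>\<phi> x\<bar> \<le> K"
    using test_fun_bounded(1)[OF assms] by auto
  obtain L where L: "\<And>x. \<bar>partial_deriv i \<phi> x\<bar> \<le> L"
    using test_fun_bounded(2)[OF assms, of i] by auto
  have "\<phi> \<in> Lp 1" "partial_deriv i \<phi> \<in> Lp 1"
    using bounded_Lp[of 1 \<phi> K] bounded_Lp[of 1 "partial_deriv i \<phi>" L] f(1,5) K L test_fun_measurable[OF assms]
    by simp_all
  moreover have "(\<integral>x. \<phi> x * partial_deriv i \<psi> x \<partial>torus) = - (\<integral>x. partial_deriv i \<phi> x * \<psi> x \<partial>torus)"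
    if \<psi>: "test_fun \<psi>" for \<psi>
  proof -
    note f' = test_fun_facts[OF \<psi>]
    obtain K' where K': "\<And>x. \<bar>\<psi> x\<bar> \<le> K'"
    using test_fun_bounded(1)[OF \<psi>] by auto
  obtain L' where L': "\<And>x. \<bar>partial_deriv i \<psi> x\<bar> \<le> L'"
    using test_fun_bounded(2)[OF \<psi>, of i] by auto
    note [measurable] = test_fun_measurable[OF assms] test_fun_measurable[OF \<psi>]
    have i: "integrable torus \<phi>" "integrable torus (partial_deriv i \<phi>)"
      using bounded_integrable_torus[of \<phi> K] bounded_integrable_torus[of "partial_deriv i \<phi>" L] K L by simp_all
    have ii: "integrable torus (\<lambda>x. \<phi> x * partial_deriv i \<psi> x)" "integrable torus (\<lambda>x. partial_deriv i \<phi> x * \<psi> x)"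
      using integrable_mult_bounded[OF i(1) _ L'] integrable_mult_bounded[OF i(2) _ K'] by simp_all
    have eq: "partial_deriv i (\<lambda>x. \<phi> x * \<psi> x) = (\<lambda>x. \<phi> x * partial_deriv i \<psi> x + partial_deriv i \<phi> x * \<psi> x)"
      using f(2) f'(2) by (simp add: partial_deriv_mult fun_eq_iff)
    have "(\<integral>x. partial_deriv i (\<lambda>x. \<phi> x * \<psi> x) x \<partial>torus) = 0"
    proof (rule integral_partial_deriv_0)
      show "periodic (\<lambda>x. \<phi> x * \<psi> x)" by (rule periodic_comp2[OF f(1) f'(1)])
      show "continuous_on UNIV (partial_deriv i (\<lambda>x. \<phi> x * \<psi> x))"
        unfolding eq by (intro continuous_intros f(3,4) f'(3,4))
    qed (intro differentiable_mult f(2) f'(2))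
    then have "(\<integral>x. \<phi> x * partial_deriv i \<psi> x \<partial>torus) + (\<integral>x. partial_deriv i \<phi> x * \<psi> x \<partial>torus) = 0"
      unfolding eq Bochner_Integration.integral_add[OF ii] .
    then show ?thesis by linarith
  qed
  ultimately show ?thesis by (simp add: has_weak_deriv_def)
qed

lemma has_weak_deriv_integrable:
  assumes "has_weak_deriv i g h" "test_fun \<phi>"
  shows "integrable torus (\<lambda>x. g x * partial_deriv j \<phi> x)" "integrable torus (\<lambda>x. h x * \<phi> x)"
proof -
  have i: "integrable torus g" "integrable torus h"
    using assms(1) Lp_integrable[of 1 g] Lp_integrable[of 1 h] by (auto simp: has_weak_deriv_def)
  obtain K where K: "\<And>x. \<bar>\<phi> x\<bar> \<le> K"
    using test_fun_bounded(1)[OF assms(2)] by auto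
  obtain L where L: "\<And>x. \<bar>partial_deriv j \<phi> x\<bar> \<le> L"
    using test_fun_bounded(2)[OF assms(2), of j] by auto
  show "integrable torus (\<lambda>x. g x * partial_deriv j \<phi> x)"
    by (rule integrable_mult_bounded[OF i(1) test_fun_measurable(2)[OF assms(2)] L])
  show "integrable torus (\<lambda>x. h x * \<phi> x)"
    by (rule integrable_mult_bounded[OF i(2) test_fun_measurable(1)[OF assms(2)] K])
qed

lemma has_weak_deriv_add:
  assumes "has_weak_deriv i g h" "has_weak_deriv i g' h'"
  shows "has_weak_deriv i (\<lambda>x. g x + g' x) (\<lambda>x. h x + h' x)"
proof -
  have "(\<lambda>x. g x + g' x) \<in> Lp 1" "(\<lambda>x. h x + h' x) \<in> Lp 1"
    using assms by (auto simp: has_weak_deriv_def intro!: Lp_add[of 1, simplified])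
  then show ?thesis
    using assms has_weak_deriv_integrable[OF assms(1)] has_weak_deriv_integrable[OF assms(2)]
    by (simp add: has_weak_deriv_def distrib_right)
qed

lemma has_weak_deriv_scale:
  assumes "has_weak_deriv i g h"
  shows "has_weak_deriv i (\<lambda>x. c * g x) (\<lambda>x. c * h x)"
proof -
  have "(\<lambda>x. c *\<^sub>R g x) \<in> Lp 1" "(\<lambda>x. c *\<^sub>R h x) \<in> Lp 1"
    using assms Lp_scaleR[of 1 g c] Lp_scaleR[of 1 h c] by (simp_all add: has_weak_deriv_def)
  then show ?thesis
    using assms by (simp add: has_weak_deriv_def mult.assoc)
qed

lemma has_weak_deriv_integral_0:
  fixes g h :: "real^'n \<Rightarrow> real"
  assumes "has_weak_deriv i g h"
  shows "(\<integral>x. h x \<partial>torus) = 0"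
proof -
  have t: "test_fun (\<lambda>x :: real^'n. 1 :: real)" by (rule trig_poly_test_fun[OF trig_poly.const])
  have "partial_deriv i (\<lambda>x :: real^'n. 1 :: real) x = 0" for x
    by (rule partial_deriv_eqI[where f' = "\<lambda>h. 0", simplified]) simp
  then show ?thesis using assms t by (auto simp: has_weak_deriv_def)
qed

text \<open>Test functions and their derivatives are bounded, so L^1 convergence of the functions
  and of their derivatives passes through both sides of the defining identity.\<close>

lemma has_weak_deriv_limit:
  fixes g :: "real^'n \<Rightarrow> real"
  assumes X: "\<And>k. has_weak_deriv i (X k) (Y k)"
    and L: "g \<in> Lp (real 1)" "h \<in> Lp (real 1)"
    and g: "(\<lambda>k. \<integral>x. \<bar>X k x - g x\<bar> \<partial>torus) \<longlonglongrightarrow> 0" and h: "(\<lambda>k. \<integral>x. \<bar>Y k x - h x\<bar> \<partial>torus) \<longlonglongrightarrow> 0"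
  shows "has_weak_deriv i g h"
proof -
  have *: "(\<lambda>k. \<integral>x. U k x * \<phi> x \<partial>torus) \<longlonglongrightarrow> (\<integral>x. u x * \<phi> x \<partial>torus)"
    if U: "\<And>k. U k \<in> Lp (real 1)" and u: "u \<in> Lp (real 1)" and \<phi>m: "\<phi> \<in> borel_measurable borel"
      and K: "\<And>x. \<bar>\<phi> x\<bar> \<le> K" and l: "(\<lambda>k. \<integral>x. \<bar>U k x - u x\<bar> \<partial>torus) \<longlonglongrightarrow> 0"
    for U u K and \<phi> :: "real^'n \<Rightarrow> real"
  proof -
    have i: "integrable torus (U k)" "integrable torus u" for k using U u Lp_integrable[of 1] by auto
    have i': "integrable torus (\<lambda>x. U k x * \<phi> x)" "integrable torus (\<lambda>x. u x * \<phi> x)" for k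
      using integrable_mult_bounded[OF i(1) \<phi>m K] integrable_mult_bounded[OF i(2) \<phi>m K] by auto
    have "(\<lambda>k. (\<integral>x. U k x * \<phi> x \<partial>torus) - (\<integral>x. u x * \<phi> x \<partial>torus)) \<longlonglongrightarrow> 0"
    proof (rule Lim_null_comparison)
      show "\<forall>\<^sub>F k in sequentially. norm ((\<integral>x. U k x * \<phi> x \<partial>torus) - (\<integral>x. u x * \<phi> x \<partial>torus))
          \<le> K * (\<integral>x. \<bar>U k x - u x\<bar> \<partial>torus)"
      proof (intro always_eventually allI)
        fix k
        have "norm ((\<integral>x. U k x * \<phi> x \<partial>torus) - (\<integral>x. u x * \<phi> x \<partial>torus)) = \<bar>\<integral>x. (U k x - u x) * \<phi> x \<partial>torus\<bar>"
          using i'(1)[of k] i'(2) by (simp add: left_diff_distrib)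
        also have "\<dots> \<le> (\<integral>x. K * \<bar>U k x - u x\<bar> \<partial>torus)"
        proof (rule order_trans[OF integral_abs_bound integral_mono])
          show "\<bar>(U k x - u x) * \<phi> x\<bar> \<le> K * \<bar>U k x - u x\<bar>" for x
            using mult_left_mono[OF K[of x], of "\<bar>U k x - u x\<bar>"] by (simp add: abs_mult mult.commute[of K])
        qed (use i(1)[of k] i(2) i'(1)[of k] i'(2) in \<open>auto simp: left_diff_distrib\<close>)
        also have "\<dots> = K * (\<integral>x. \<bar>U k x - u x\<bar> \<partial>torus)" by simp
        finally show "norm ((\<integral>x. U k x * \<phi> x \<partial>torus) - (\<integral>x. u x * \<phi> x \<partial>torus)) \<le> K * (\<integral>x. \<bar>U k x - u x\<bar> \<partial>torus)" .
      qed
      show "(\<lambda>k. K * (\<integral>x. \<bar>U k x - u x\<bar> \<partial>torus)) \<longlonglongrightarrow> 0" using tendsto_mult_right_zero[OF l] .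
    qed
    then show ?thesis by (simp add: LIM_zero_iff)
  qed
  have XL: "X k \<in> Lp (real 1)" "Y k \<in> Lp (real 1)" for k using X[of k] by (auto simp: has_weak_deriv_def)
  have "(\<integral>x. g x * partial_deriv i \<phi> x \<partial>torus) = - (\<integral>x. h x * \<phi> x \<partial>torus)" if \<phi>: "test_fun \<phi>" for \<phi>
  proof -
    obtain K where K: "\<And>x. \<bar>\<phi> x\<bar> \<le> K"
    using test_fun_bounded(1)[OF \<phi>] by auto
  obtain K' where K': "\<And>x. \<bar>partial_deriv i \<phi> x\<bar> \<le> K'"
    using test_fun_bounded(2)[OF \<phi>, of i] by auto
    have "(\<lambda>k. \<integral>x. X k x * partial_deriv i \<phi> x \<partial>torus) \<longlonglongrightarrow> (\<integral>x. g x * partial_deriv i \<phi> x \<partial>torus)"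
      by (rule *[OF XL(1) L(1) test_fun_measurable(2)[OF \<phi>] K' g])
    moreover have "(\<lambda>k. - (\<integral>x. Y k x * \<phi> x \<partial>torus)) \<longlonglongrightarrow> - (\<integral>x. h x * \<phi> x \<partial>torus)"
      by (intro tendsto_minus *[OF XL(2) L(2) test_fun_measurable(1)[OF \<phi>] K h])
    moreover have "(\<integral>x. X k x * partial_deriv i \<phi> x \<partial>torus) = - (\<integral>x. Y k x * \<phi> x \<partial>torus)" for k
      using X[of k] \<phi> by (auto simp: has_weak_deriv_def)
    ultimately show ?thesis by (simp add: LIMSEQ_unique)
  qed
  then show ?thesis using L by (simp add: has_weak_deriv_def)
qed

section \<open>Essentially bounded fields\<close>

lemma Linf_iff: "v \<in> Linf \<longleftrightarrow> periodic v \<and> v \<in> borel_measurable borel \<and> (\<exists>M. AE x in torus. norm (v x) \<le> M)"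
proof
  assume v: "v \<in> Linf"
  then have [measurable]: "v \<in> borel_measurable borel" by (simp add: Linf_def)
  let ?s = "esssup torus (\<lambda>x. ennreal (norm (v x)))"
  have fin: "?s < \<infinity>" using v by (simp add: Linf_def)
  have "AE x in torus. ennreal (norm (v x)) \<le> ?s" by (rule esssup_AE)
  then have "AE x in torus. norm (v x) \<le> enn2real ?s"
    by eventually_elim (use fin in \<open>metis enn2real_ennreal enn2real_mono norm_ge_zero infinity_ennreal_def\<close>)
  then show "periodic v \<and> v \<in> borel_measurable borel \<and> (\<exists>M. AE x in torus. norm (v x) \<le> M)"
    using v by (auto simp: Linf_def)
next
  assume *: "periodic v \<and> v \<in> borel_measurable borel \<and> (\<exists>M. AE x in torus. norm (v x) \<le> M)"
  then have [measurable]: "v \<in> borel_measurable borel" by simp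
  obtain M where M: "AE x in torus. norm (v x) \<le> M" using * by blast
  have "esssup torus (\<lambda>x. ennreal (norm (v x))) \<le> ennreal M"
    by (rule esssup_I) (use M in \<open>auto elim!: eventually_mono intro: ennreal_leI\<close>)
  also have "\<dots> < \<infinity>" by simp
  finally show "v \<in> Linf" using * by (simp add: Linf_def)
qed

lemma Linf_norm_nonneg [simp]: "Linf_norm v \<ge> 0"
  by (simp add: Linf_norm_def)

lemma Linf_norm_AE:
  assumes "v \<in> Linf"
  shows "AE x in torus. norm (v x) \<le> Linf_norm v"
proof -
  let ?s = "esssup torus (\<lambda>x. ennreal (norm (v x)))"
  have fin: "?s < \<infinity>" using assms by (simp add: Linf_def)
  have "AE x in torus. ennreal (norm (v x)) \<le> ?s" by (rule esssup_AE)
  then show ?thesis unfolding Linf_norm_def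
    by eventually_elim (use fin in \<open>metis enn2real_ennreal enn2real_mono norm_ge_zero infinity_ennreal_def\<close>)
qed

lemma Linf_norm_le:
  assumes "v \<in> borel_measurable borel" "M \<ge> 0" "AE x in torus. norm (v x) \<le> M"
  shows "Linf_norm v \<le> M"
proof -
  have [measurable]: "v \<in> borel_measurable borel" by fact
  have "esssup torus (\<lambda>x. ennreal (norm (v x))) \<le> ennreal M"
    by (rule esssup_I) (use assms in \<open>auto elim!: eventually_mono intro: ennreal_leI\<close>)
  then show ?thesis
    unfolding Linf_norm_def by (metis assms(2) enn2real_ennreal enn2real_mono ennreal_less_top)
qed

lemma Linf_measurable: "v \<in> Linf \<Longrightarrow> v \<in> borel_measurable borel"
  by (simp add: Linf_def)

lemma Linf_Lp:
  assumes "q > 0" "v \<in> Linf"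
  shows "v \<in> Lp (real q)" "Lp_norm (real q) v \<le> Linf_norm v"
proof -
  have m [measurable]: "v \<in> borel_measurable borel" using assms by (simp add: Linf_measurable)
  have AE: "AE x in torus. norm (v x) ^ q \<le> Linf_norm v ^ q"
    using Linf_norm_AE[OF assms(2)] by eventually_elim (auto intro: power_mono)
  have i: "integrable torus (\<lambda>x. norm (v x) ^ q)"
    by (rule torus.integrable_const_bound[of _ "Linf_norm v ^ q"]) (use AE in auto)
  then show "v \<in> Lp (real q)" using assms by (auto simp: Lp_nat Linf_def)
  have "pow_integral q v \<le> (\<integral>x. Linf_norm v ^ q \<partial>(torus :: (real^'a) measure))"
    by (rule integral_mono_AE) (use i AE in auto)
  then show "Lp_norm (real q) v \<le> Linf_norm v"
    using assms(1) by (simp add: Lp_norm_le_iff torus.prob_space)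
qed

lemma Linf_add:
  assumes "u \<in> Linf" "v \<in> Linf"
  shows "(\<lambda>x. u x + v x) \<in> Linf" "Linf_norm (\<lambda>x. u x + v x) \<le> Linf_norm u + Linf_norm v"
proof -
  have m: "(\<lambda>x. u x + v x) \<in> borel_measurable borel" using assms Linf_measurable by (intro borel_measurable_add) auto
  have AE: "AE x in torus. norm (u x + v x) \<le> Linf_norm u + Linf_norm v"
    using Linf_norm_AE[OF assms(1)] Linf_norm_AE[OF assms(2)]
    by eventually_elim (rule order_trans[OF norm_triangle_ineq], simp)
  show "(\<lambda>x. u x + v x) \<in> Linf"
    using assms m AE periodic_comp2[of u v "(+)"] by (auto simp: Linf_iff)
  show "Linf_norm (\<lambda>x. u x + v x) \<le> Linf_norm u + Linf_norm v"
    using m AE by (intro Linf_norm_le) auto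
qed

lemma Linf_scaleR:
  assumes "u \<in> Linf"
  shows "(\<lambda>x. c *\<^sub>R u x) \<in> Linf" "Linf_norm (\<lambda>x. c *\<^sub>R u x) \<le> \<bar>c\<bar> * Linf_norm u"
proof -
  have m: "(\<lambda>x. c *\<^sub>R u x) \<in> borel_measurable borel" using assms Linf_measurable by (intro borel_measurable_scaleR) auto
  have AE: "AE x in torus. norm (c *\<^sub>R u x) \<le> \<bar>c\<bar> * Linf_norm u"
    using Linf_norm_AE[OF assms(1)] by eventually_elim (simp add: mult_left_mono)
  show "(\<lambda>x. c *\<^sub>R u x) \<in> Linf"
    using assms m AE periodic_comp[of u "\<lambda>x. c *\<^sub>R x"] by (auto simp: Linf_iff)
  show "Linf_norm (\<lambda>x. c *\<^sub>R u x) \<le> \<bar>c\<bar> * Linf_norm u"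
    using m AE by (intro Linf_norm_le) auto
qed

lemma Linf_zero: "(\<lambda>x. 0) \<in> Linf" "Linf_norm (\<lambda>x. 0) = 0"
proof -
  show "(\<lambda>x. 0) \<in> Linf" by (auto simp: Linf_iff periodic_def)
  show "Linf_norm (\<lambda>x. 0) = 0" by (rule antisym) (auto intro!: Linf_norm_le)
qed

text \<open>
  Fields are carried together with a representative of their weak gradient, so that $W^{1,d}$
  becomes a closed subspace of an $L^d$ space.
\<close>

definition sobolev :: "(real^'n \<Rightarrow> (real^'n) \<times> (real^'n^'n)) set" where
  "sobolev = {G \<in> Lp (real CARD('n)). \<forall>i j. has_weak_deriv i (\<lambda>x. fst (G x) $ j) (\<lambda>x. snd (G x) $ j $ i)}"

lemma bounded_linear_trace: "bounded_linear (trace :: real^'n^'n \<Rightarrow> real)"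
  unfolding trace_def by (intro bounded_linear_sum bounded_linear_compose[OF bounded_linear_vec_nth bounded_linear_vec_nth])

lemma sobolevD:
  assumes "G \<in> sobolev"
  shows "(G :: real^'n \<Rightarrow> _) \<in> Lp (real CARD('n))" "(\<lambda>x. fst (G x)) \<in> Lp (real CARD('n))" "(\<lambda>x. snd (G x)) \<in> Lp (real CARD('n))"
    "(\<lambda>x. trace (snd (G x))) \<in> Lp (real CARD('n))"
proof -
  show G: "G \<in> Lp (real CARD('n))" using assms by (simp add: sobolev_def)
  show "(\<lambda>x. fst (G x)) \<in> Lp (real CARD('n))" "(\<lambda>x. snd (G x)) \<in> Lp (real CARD('n))"
    "(\<lambda>x. trace (snd (G x))) \<in> Lp (real CARD('n))"
    by (rule Lp_bounded_linear[OF _ G], simp,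
        intro bounded_linear_fst bounded_linear_snd bounded_linear_compose[OF bounded_linear_trace bounded_linear_snd])+
qed

lemma sobolev_add:
  assumes "F \<in> sobolev" "G \<in> sobolev"
  shows "(\<lambda>x. F x + G x) \<in> sobolev"
  using assms by (auto simp: sobolev_def intro!: Lp_add has_weak_deriv_add)

lemma sobolev_scaleR:
  assumes "F \<in> sobolev"
  shows "(\<lambda>x. c *\<^sub>R F x) \<in> sobolev"
  using assms by (auto simp: sobolev_def intro!: Lp_scaleR has_weak_deriv_scale)

lemma sobolev_zero: "(\<lambda>x. 0) \<in> sobolev"
proof -
  have "(\<lambda>x. 0 :: real) \<in> Lp (real 1)" by (rule Lp_zero) simp
  then show ?thesis by (auto simp: sobolev_def has_weak_deriv_def intro!: Lp_zero)
qed

lemma sobolev_diff: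
  assumes "F \<in> sobolev" "G \<in> sobolev"
  shows "(\<lambda>x. F x - G x) \<in> sobolev"
  using sobolev_add[OF assms(1) sobolev_scaleR[OF assms(2), of "-1"]] by simp

text \<open>A divergence has mean zero, so subtracting it preserves the mean; hence each residual of
  the refinement is again admissible data for \<open>solve_div\<close>.\<close>

lemma sobolev_integral_trace:
  assumes "G \<in> sobolev"
  shows "(\<integral>x. trace (snd (G x)) \<partial>torus) = 0"
proof -
  have w: "has_weak_deriv i (\<lambda>x. fst (G x) $ i) (\<lambda>x. snd (G x) $ i $ i)" for i
    using assms by (simp add: sobolev_def)
  have "integrable torus (\<lambda>x. snd (G x) $ i $ i)" for i
    using w[of i] Lp_integrable[of 1] by (auto simp: has_weak_deriv_def)
  then show ?thesis
    unfolding trace_def using has_weak_deriv_integral_0[OF w] by simp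
qed

text \<open>All components of a pair are linear functionals bounded by its norm, so convergence in
  L^d gives L^1 convergence of each component and of its derivatives.\<close>

lemma sobolev_closed:
  assumes d: "CARD('n) \<ge> 2"
  shows "Lp_closed (real CARD('n)) (sobolev :: (real^'n \<Rightarrow> _) set)"
proof (rule Lp_closedI)
  fix X :: "nat \<Rightarrow> real^'n \<Rightarrow> (real^'n) \<times> (real^'n^'n)" and G
  assume X: "\<And>k. X k \<in> sobolev" and G: "G \<in> Lp (real CARD('n))"
    and l: "(\<lambda>k. Ld_norm (\<lambda>x. X k x - G x)) \<longlonglongrightarrow> 0"
  have XL: "X k \<in> Lp (real CARD('n))" for k using X sobolevD by blast
  have DL: "(\<lambda>x. X k x - G x) \<in> Lp (real CARD('n))" for k using XL G by auto
  have Di: "integrable torus (\<lambda>x. norm (X k x - G x))" for k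
    using Lp_integrable[OF _ DL] by auto
  have "has_weak_deriv i (\<lambda>x. fst (G x) $ j) (\<lambda>x. snd (G x) $ j $ i)" for i j
  proof -
    have bl: "bounded_linear (\<lambda>y::(real^'n) \<times> (real^'n^'n). fst y $ j)" "bounded_linear (\<lambda>y::(real^'n) \<times> (real^'n^'n). snd y $ j $ i)"
      by (intro bounded_linear_compose[OF bounded_linear_vec_nth] bounded_linear_fst bounded_linear_snd)+
    have L1: "(\<lambda>x. L (G x)) \<in> Lp (real 1)" if "bounded_linear L" for L :: "_ \<Rightarrow> real"
      by (rule Lp_mono[OF _ _ Lp_bounded_linear[OF _ G that]]) auto
    have lim: "(\<lambda>k. \<integral>x. \<bar>L (X k x) - L (G x)\<bar> \<partial>torus) \<longlonglongrightarrow> 0"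
      if L: "bounded_linear L" and N: "\<And>y. \<bar>L y\<bar> \<le> norm y" for L :: "_ \<Rightarrow> real"
    proof (rule Lim_null_comparison[OF _ l], intro always_eventually allI)
      fix k
      have LD: "(\<lambda>x. L (X k x - G x)) \<in> Lp (real CARD('n))"
        by (rule Lp_bounded_linear[OF _ DL L]) simp
      have "(\<integral>x. \<bar>L (X k x) - L (G x)\<bar> \<partial>torus) = (\<integral>x. \<bar>L (X k x - G x)\<bar> \<partial>torus)"
        by (simp add: linear_diff[OF bounded_linear.linear[OF L]])
      also have "\<dots> \<le> (\<integral>x. norm (X k x - G x) \<partial>torus)"
        using Lp_integrable[OF _ LD] Di[of k] by (intro integral_mono N) auto
      also have "\<dots> \<le> Ld_norm (\<lambda>x. X k x - G x)"
        by (rule Lp_norm_1_le[OF d DL])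
      finally show "norm (\<integral>x. \<bar>L (X k x) - L (G x)\<bar> \<partial>torus) \<le> Ld_norm (\<lambda>x. X k x - G x)"
        by simp
    qed
    have n1: "\<bar>fst y $ j\<bar> \<le> norm y" for y :: "(real^'n) \<times> (real^'n^'n)"
      using component_le_norm_cart[of "fst y" j] norm_fst_le[of "fst y" "snd y"] by simp
    have n2: "\<bar>snd y $ j $ i\<bar> \<le> norm y" for y :: "(real^'n) \<times> (real^'n^'n)"
      using component_le_norm_cart[of "snd y $ j" i] Finite_Cartesian_Product.norm_nth_le[of "snd y" j] norm_snd_le[of "snd y" "fst y"]
      by simp
    show ?thesis
      by (rule has_weak_deriv_limit[OF _ L1[OF bl(1)] L1[OF bl(2)] lim[OF bl(1) n1] lim[OF bl(2) n2]])
        (use X in \<open>simp add: sobolev_def\<close>)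
  qed
  then show "G \<in> sobolev" using G by (simp add: sobolev_def)
qed

lemma vec_measurable:
  fixes f :: "real^'n \<Rightarrow> 'b::euclidean_space^'m"
  assumes "\<And>j. (\<lambda>x. f x $ j) \<in> borel_measurable borel"
  shows "f \<in> borel_measurable borel"
proof (subst borel_measurable_euclidean_space, intro ballI)
  fix b :: "'b^'m" assume "b \<in> Basis"
  then obtain i u where b: "b = axis i u" by (auto simp: Basis_vec_def)
  have [measurable]: "(\<lambda>x. f x $ i) \<in> borel_measurable borel" by (rule assms)
  show "(\<lambda>x. f x \<bullet> b) \<in> borel_measurable borel" unfolding b inner_axis by measurable
qed

lemma norm_vec_le_sum: "norm (x :: 'b::real_normed_vector^'m) \<le> (\<Sum>j\<in>UNIV. norm (x $ j))"
  unfolding norm_vec_def by (rule L2_set_le_sum) simp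

lemma Lp_norm_fun:
  assumes "q > 0" "f \<in> Lp (real q)"
  shows "(\<lambda>x. norm (f x)) \<in> Lp (real q)"
  by (rule Lp_bound[OF assms]) (use assms periodic_comp[of f norm] in \<open>auto simp: Lp_def\<close>)

lemma sobolevI:
  fixes v :: "real^'n \<Rightarrow> real^'n"
  assumes w: "\<And>i j. has_weak_deriv i (\<lambda>x. v x $ j) (w i j)"
    and v: "\<And>j. (\<lambda>x. v x $ j) \<in> Lp (real CARD('n))" and L: "\<And>i j. w i j \<in> Lp (real CARD('n))"
  shows "(\<lambda>x. (v x, \<chi> j i. w i j x)) \<in> sobolev"
proof -
  define W where "W x = (\<chi> j i. w i j x)" for x
  have p: "periodic (\<lambda>x. (v x, W x))"
    using v L by (simp add: periodic_def Lp_def vec_eq_iff W_def)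
  have vm: "v \<in> borel_measurable borel" by (rule vec_measurable) (use v in \<open>simp add: Lp_def\<close>)
  have Wm: "W \<in> borel_measurable borel"
    by (rule vec_measurable, rule vec_measurable) (use L in \<open>simp add: Lp_def W_def\<close>)
  have m: "(\<lambda>x. (v x, W x)) \<in> borel_measurable borel" using vm Wm by (rule borel_measurable_Pair)
  \<comment> \<open>A scalar function that dominates the norm of the pair and lies in L^d because
    each component does.\<close>
  define b where "b x = (\<Sum>j\<in>UNIV. \<bar>v x $ j\<bar>) + (\<Sum>j\<in>UNIV. \<Sum>i\<in>UNIV. \<bar>w i j x\<bar>)" for x
  have abs: "(\<lambda>x. \<bar>f x\<bar>) \<in> Lp (real CARD('n))" if "f \<in> Lp (real CARD('n))" for f :: "real^'n \<Rightarrow> real"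
    using Lp_norm_fun[OF _ that] by simp
  have bL: "b \<in> Lp (real CARD('n))" unfolding b_def by (intro Lp_add Lp_sum abs v L) auto
  have "norm (v x, W x) \<le> norm (b x)" for x
  proof -
    have "norm (v x, W x) \<le> norm (v x) + norm (W x)" by (rule norm_Pair_le)
    also have "norm (v x) \<le> (\<Sum>j\<in>UNIV. \<bar>v x $ j\<bar>)" by (rule norm_le_l1_cart)
    also have "norm (W x) \<le> (\<Sum>j\<in>UNIV. norm (W x $ j))" by (rule norm_vec_le_sum)
    also have "\<dots> \<le> (\<Sum>j\<in>UNIV. \<Sum>i\<in>UNIV. \<bar>W x $ j $ i\<bar>)" by (intro sum_mono norm_le_l1_cart)
    finally show ?thesis by (simp add: b_def W_def)
  qed
  then have "(\<lambda>x. (v x, W x)) \<in> Lp (real CARD('n))" by (intro Lp_bound[OF _ bL p m]) auto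
  then show ?thesis using w by (simp add: sobolev_def W_def)
qed

lemma has_weak_deriv_weak_deriv: "has_weak_deriv i g h \<Longrightarrow> has_weak_deriv i g (weak_deriv i g)"
  unfolding weak_deriv_def by (rule someI[of "has_weak_deriv i g"])

text \<open>The choice behind \<open>weak_deriv\<close> only guarantees an L^1 function. Its
  integrability to the power d is inherited from the derivative \<open>h\<close> provided by
  \<open>Linf_W1d\<close>, with which it agrees almost everywhere.\<close>

lemma sobolev_weak_grad:
  fixes v :: "real^'n \<Rightarrow> real^'n"
  assumes "v \<in> Linf_W1d"
  shows "(\<lambda>x. (v x, weak_grad v x)) \<in> sobolev"
  unfolding weak_grad_def
proof (rule sobolevI)
  fix i j
  obtain h where h: "h \<in> Lp (real CARD('n))" "has_weak_deriv i (\<lambda>x. v x $ j) h"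
    using assms unfolding Linf_W1d_def by blast
  show w: "has_weak_deriv i (\<lambda>x. v x $ j) (weak_deriv i (\<lambda>y. v y $ j))"
    by (rule has_weak_deriv_weak_deriv[OF h(2)])
  let ?w = "weak_deriv i (\<lambda>y. v y $ j)"
  have AE: "AE x in torus. ?w x = h x" by (rule weak_deriv_unique[OF w h(2)])
  have p: "periodic ?w" and m: "?w \<in> borel_measurable borel" using w by (auto simp: has_weak_deriv_def Lp_def)
  have hm: "h \<in> borel_measurable borel" using h by (auto simp: Lp_def)
  have "integrable torus (\<lambda>x. norm (h x) ^ CARD('n))" using h by (simp add: Lp_nat)
  then have "integrable torus (\<lambda>x. norm (?w x) ^ CARD('n))"
    by (subst integrable_cong_AE) (use AE m hm in auto)
  then show "?w \<in> Lp (real CARD('n))" using p m by (simp add: Lp_nat)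
  have "v \<in> Linf" using assms by (simp add: Linf_W1d_def)
  then show "(\<lambda>x. v x $ j) \<in> Lp (real CARD('n))"
    by (intro Lp_bounded_linear[OF _ Linf_Lp(1)] bounded_linear_vec_nth) auto
qed

lemma Linf_W1d_sobolev:
  fixes G :: "real^'n \<Rightarrow> (real^'n) \<times> (real^'n^'n)"
  assumes G: "G \<in> sobolev" and L: "(\<lambda>x. fst (G x)) \<in> Linf"
  shows "(\<lambda>x. fst (G x)) \<in> Linf_W1d" "AE x in torus. weak_grad (\<lambda>x. fst (G x)) x = snd (G x)"
proof -
  have w: "has_weak_deriv i (\<lambda>x. fst (G x) $ j) (\<lambda>x. snd (G x) $ j $ i)" for i j
    using G by (simp add: sobolev_def)
  have "(\<lambda>x. snd (G x) $ j $ i) \<in> Lp (real CARD('n))" for i j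
    by (rule Lp_bounded_linear[OF _ sobolevD(3)[OF G]])
      (auto intro: bounded_linear_compose[OF bounded_linear_vec_nth bounded_linear_vec_nth])
  then show "(\<lambda>x. fst (G x)) \<in> Linf_W1d"
    using L w unfolding Linf_W1d_def by blast
  have "AE x in torus. weak_deriv i (\<lambda>x. fst (G x) $ j) x = snd (G x) $ j $ i" for i j
    by (rule weak_deriv_unique[OF has_weak_deriv_weak_deriv[OF w] w])
  then have "AE x in torus. \<forall>j i. weak_deriv i (\<lambda>x. fst (G x) $ j) x = snd (G x) $ j $ i"
    by (simp add: AE_all_countable)
  then show "AE x in torus. weak_grad (\<lambda>x. fst (G x)) x = snd (G x)"
    by eventually_elim (simp add: weak_grad_def vec_eq_iff)
qed

lemma sobolev_test_field:
  fixes \<Phi> :: "real^'n \<Rightarrow> real^'n"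
  assumes "test_field \<Phi>"
  shows "(\<lambda>x. (\<Phi> x, classical_grad \<Phi> x)) \<in> sobolev"
  unfolding classical_grad_def
proof (rule sobolevI)
  fix i j
  have t: "test_fun (\<lambda>x. \<Phi> x $ j)" using assms by (simp add: test_field_def)
  show "has_weak_deriv i (\<lambda>x. \<Phi> x $ j) (partial_deriv i (\<lambda>y. \<Phi> y $ j))"
    by (rule has_weak_deriv_test_fun[OF t])
  obtain K where K: "\<And>x. \<bar>\<Phi> x $ j\<bar> \<le> K"
    using test_fun_bounded(1)[OF t] by auto
  obtain L where L: "\<And>x. \<bar>partial_deriv i (\<lambda>y. \<Phi> y $ j) x\<bar> \<le> L"
    using test_fun_bounded(2)[OF t, of i] by auto
  show "(\<lambda>x. \<Phi> x $ j) \<in> Lp (real CARD('n))"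
    by (rule bounded_Lp[OF _ test_fun_facts(1)[OF t] test_fun_measurable(1)[OF t], where K = K]) (use K in auto)
  show "partial_deriv i (\<lambda>y. \<Phi> y $ j) \<in> Lp (real CARD('n))"
    by (rule bounded_Lp[OF _ test_fun_facts(5)[OF t] test_fun_measurable(2)[OF t], where K = L]) (use L in auto)
qed

lemma test_field_bounded:
  fixes \<Phi> :: "real^'n \<Rightarrow> real^'n"
  assumes "test_field \<Phi>" "q > 0"
  shows "\<Phi> \<in> Lp (real q)"
proof -
  have t: "test_fun (\<lambda>x. \<Phi> x $ j)" for j using assms by (simp add: test_field_def)
  have "\<exists>K. \<forall>x. \<bar>\<Phi> x $ j\<bar> \<le> K" for j by (rule test_fun_bounded(1)[OF t])
  then obtain K where K: "\<And>j x. \<bar>\<Phi> x $ j\<bar> \<le> K j" by metis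
  have "norm (\<Phi> x) \<le> (\<Sum>j\<in>UNIV. K j)" for x
    by (rule order_trans[OF norm_le_l1_cart sum_mono[OF K]])
  moreover have "periodic \<Phi>"
    using test_fun_facts(1)[OF t] by (simp add: periodic_def vec_eq_iff)
  moreover have "\<Phi> \<in> borel_measurable borel"
    by (rule vec_measurable[OF test_fun_measurable(1)[OF t]])
  ultimately show ?thesis by (intro bounded_Lp[OF assms(2)])
qed

lemma classical_div_eq_trace: "classical_div \<Phi> x = trace (classical_grad \<Phi> x)"
  by (simp add: classical_div_def classical_grad_def trace_def)

lemma weak_div_eq_trace: "weak_div v x = trace (weak_grad v x)"
  by (simp add: weak_div_def weak_grad_def trace_def)

section \<open>Derivatives of power integrals\<close>

text \<open>For \<open>q \<ge> 2\<close> this is the gradient of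
  \<open>norm x ^ q / real q\<close>.\<close>

definition duality_map :: "nat \<Rightarrow> 'b \<Rightarrow> 'b::real_inner" where
  "duality_map q x = norm x ^ (q - 2) *\<^sub>R x"

lemma ge_2_cases: "q \<ge> 2 \<Longrightarrow> \<exists>n. q = Suc (Suc n)"
  by presburger

lemma norm_duality_map: "q \<ge> 2 \<Longrightarrow> norm (duality_map q x) = norm x ^ (q - 1)"
  using ge_2_cases[of q] by (auto simp: duality_map_def)

lemma duality_map_inner_self: "q \<ge> 2 \<Longrightarrow> duality_map q x \<bullet> x = norm x ^ q"
  using ge_2_cases[of q] by (auto simp: duality_map_def dot_square_norm power2_eq_square)

lemma continuous_on_duality_map: "continuous_on UNIV (duality_map q)"
  unfolding duality_map_def[abs_def] by (intro continuous_intros)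

lemma duality_map_measurable [measurable]: "(duality_map q :: 'b::euclidean_space \<Rightarrow> 'b) \<in> borel_measurable borel"
  by (rule borel_measurable_continuous_onI[OF continuous_on_duality_map])

text \<open>Cauchy-Schwarz bounds the inner product by a difference of norms, after which the scalar
  tangent inequality applies.\<close>

lemma norm_pow_ge_tangent:
  fixes a b :: "'b::real_inner"
  assumes "q \<ge> 2"
  shows "norm a ^ q + real q * (duality_map q a \<bullet> (b - a)) \<le> norm b ^ q"
proof -
  obtain n where q: "q = Suc (Suc n)" using ge_2_cases[OF assms] by blast
  have "a \<bullet> (b - a) \<le> norm a * (norm b - norm a)"
    using norm_cauchy_schwarz[of a b] by (simp add: inner_diff_right dot_square_norm power2_eq_square algebra_simps)
  then have "norm a ^ n * (a \<bullet> (b - a)) \<le> norm a ^ n * (norm a * (norm b - norm a))"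
    by (rule mult_left_mono) simp
  then have "real q * (duality_map q a \<bullet> (b - a)) \<le> real (Suc (Suc n)) * norm a ^ Suc n * (norm b - norm a)"
    unfolding q duality_map_def mult.assoc by (intro mult_left_mono) (auto simp: mult_ac)
  then show ?thesis
    using pow_ge_tangent[OF norm_ge_zero norm_ge_zero, of a "Suc n" b] unfolding q by linarith
qed

text \<open>A crude substitute for Young's inequality without conjugate exponents: both factors are
  bounded through the larger of the two numbers.\<close>

lemma pow_mult_le:
  fixes a b :: real
  assumes "q \<ge> 1" "a \<ge> 0" "b \<ge> 0"
  shows "a ^ (q - 1) * b \<le> a ^ q + b ^ q"
proof -
  have "a ^ (q - 1) * b \<le> max a b ^ (q - 1) * max a b"
    using assms by (intro mult_mono power_mono) auto
  also have "\<dots> = max a b ^ q" using assms by (simp add: power_eq_if mult.commute)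
  also have "\<dots> \<le> a ^ q + b ^ q" using assms by (simp add: max_def)
  finally show ?thesis .
qed

lemma norm_duality_map_inner_le:
  assumes "q \<ge> 2"
  shows "\<bar>duality_map q x \<bullet> y\<bar> \<le> norm x ^ q + norm y ^ q"
proof -
  have "\<bar>duality_map q x \<bullet> y\<bar> \<le> norm (duality_map q x) * norm y" by (rule Cauchy_Schwarz_ineq2)
  also have "\<dots> \<le> norm x ^ q + norm y ^ q"
    unfolding norm_duality_map[OF assms] by (rule pow_mult_le) (use assms in auto)
  finally show ?thesis .
qed

lemma duality_map_integrable:
  assumes q: "q \<ge> 2" and X: "X \<in> Lp (real q)" and Y: "Y \<in> Lp (real q)"
  shows "integrable torus (\<lambda>x. duality_map q (X x) \<bullet> Y x)"
proof -
  have [measurable]: "X \<in> borel_measurable borel" "Y \<in> borel_measurable borel"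
    using X Y by (auto simp: Lp_def)
  have "integrable torus (\<lambda>x. norm (X x) ^ q + norm (Y x) ^ q)"
    using q X Y by (auto simp: Lp_nat)
  then show ?thesis
    by (rule Bochner_Integration.integrable_bound)
      (auto intro!: AE_I2 order_trans[OF norm_duality_map_inner_le[OF q]])
qed

text \<open>The tangent is taken at the perturbed point and evaluated at \<open>X\<close>. Convexity
  then bounds the perturbed integral from above with no remainder, so the integral never has to be
  differentiated.\<close>

lemma norm_pow_integral_le:
  assumes q: "q \<ge> 2" and X: "X \<in> Lp (real q)" and Y: "Y \<in> Lp (real q)"
  shows "pow_integral q (\<lambda>x. X x + t *\<^sub>R Y x)
     \<le> pow_integral q X + t * real q * (\<integral>x. duality_map q (X x + t *\<^sub>R Y x) \<bullet> Y x \<partial>torus)"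
proof -
  have q0: "q > 0" using q by simp
  have XY: "(\<lambda>x. X x + t *\<^sub>R Y x) \<in> Lp (real q)" using q0 X Y by auto
  note i = Lp_integrable_pow[OF q0 X] Lp_integrable_pow[OF q0 XY] duality_map_integrable[OF q XY Y]
  have "pow_integral q (\<lambda>x. X x + t *\<^sub>R Y x) \<le> (\<integral>x. norm (X x) ^ q + t * real q * (duality_map q (X x + t *\<^sub>R Y x) \<bullet> Y x) \<partial>torus)"
  proof (rule integral_mono)
    fix x
    show "norm (X x + t *\<^sub>R Y x) ^ q \<le> norm (X x) ^ q + t * real q * (duality_map q (X x + t *\<^sub>R Y x) \<bullet> Y x)"
      using norm_pow_ge_tangent[OF q, of "X x + t *\<^sub>R Y x" "X x"] by (simp add: mult_ac)
  qed (use i in auto)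
  then show ?thesis using i by simp
qed

lemma duality_map_integral_tendsto:
  assumes q: "q \<ge> 2" and X: "X \<in> Lp (real q)" and Y: "Y \<in> Lp (real q)"
    and \<tau>: "\<tau> \<longlonglongrightarrow> 0" "\<And>n. 0 \<le> \<tau> n" "\<And>n. \<tau> n \<le> 1"
  shows "(\<lambda>n. \<integral>x. duality_map q (X x + \<tau> n *\<^sub>R Y x) \<bullet> Y x \<partial>torus) \<longlonglongrightarrow> (\<integral>x. duality_map q (X x) \<bullet> Y x \<partial>torus)"
proof -
  have [measurable]: "X \<in> borel_measurable borel" "Y \<in> borel_measurable borel"
    using X Y by (auto simp: Lp_def)
  have q0: "q > 0" using q by simp
  define w where "w x = 2 ^ q * (norm (X x) ^ q + norm (Y x) ^ q) + norm (Y x) ^ q" for x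
  show ?thesis
  proof (rule integral_dominated_convergence[where w = w])
    show "integrable torus w"
      unfolding w_def using Lp_integrable_pow[OF q0 X] Lp_integrable_pow[OF q0 Y] by auto
    show "AE x in torus. (\<lambda>n. duality_map q (X x + \<tau> n *\<^sub>R Y x) \<bullet> Y x) \<longlonglongrightarrow> duality_map q (X x) \<bullet> Y x"
    proof (intro AE_I2 tendsto_intros)
      fix x
      have "(\<lambda>n. X x + \<tau> n *\<^sub>R Y x) \<longlonglongrightarrow> X x + 0 *\<^sub>R Y x" by (intro tendsto_intros \<tau>)
      then show "(\<lambda>n. duality_map q (X x + \<tau> n *\<^sub>R Y x)) \<longlonglongrightarrow> duality_map q (X x)"
        using continuous_on_tendsto_compose[OF continuous_on_duality_map] by simp
    qed
    show "AE x in torus. norm (duality_map q (X x + \<tau> n *\<^sub>R Y x) \<bullet> Y x) \<le> w x" for n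
    proof (rule AE_I2)
      fix x
      have "norm (duality_map q (X x + \<tau> n *\<^sub>R Y x) \<bullet> Y x) \<le> norm (X x + \<tau> n *\<^sub>R Y x) ^ q + norm (Y x) ^ q"
        using norm_duality_map_inner_le[OF q] by simp
      also have "norm (X x + \<tau> n *\<^sub>R Y x) ^ q \<le> 2 ^ q * (norm (X x) ^ q + norm (\<tau> n *\<^sub>R Y x) ^ q)"
        by (rule norm_add_pow_le)
      also have "norm (\<tau> n *\<^sub>R Y x) ^ q \<le> norm (Y x) ^ q"
        using \<tau>(2,3)[of n] by (intro power_mono) (auto simp: mult_left_le_one_le)
      finally show "norm (duality_map q (X x + \<tau> n *\<^sub>R Y x) \<bullet> Y x) \<le> w x" by (simp add: w_def)
    qed
  qed auto
qed

lemma integral_mid_le: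
  assumes q: "q \<ge> 2" and f: "f \<in> Lp (real q)" and g: "g \<in> Lp (real q)"
  shows "pow_integral q (\<lambda>x. (1/2) *\<^sub>R (f x + g x)) \<le> (pow_integral q f + pow_integral q g) / 2"
proof -
  have q0: "q > 0" using q by simp
  show ?thesis
    using Clarkson[OF assms] zero_le_power[OF Lp_norm_nonneg[of "real q" "\<lambda>x. (1/2) *\<^sub>R (f x - g x)"], of q]
    unfolding Lp_norm_pow[OF q0] by linarith
qed

lemma Lp_linear_tendsto:
  fixes X :: "nat \<Rightarrow> real^'n \<Rightarrow> 'b::euclidean_space" and L :: "'b \<Rightarrow> 'c::euclidean_space"
  assumes q: "q > 0" and L: "bounded_linear L" and X: "\<And>k. X k \<in> Lp (real q)" and G: "G \<in> Lp (real q)"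
    and l: "(\<lambda>k. Lp_norm (real q) (\<lambda>x. X k x - G x)) \<longlonglongrightarrow> 0"
  shows "(\<lambda>k. Lp_norm (real q) (\<lambda>x. L (X k x) - L (G x))) \<longlonglongrightarrow> 0"
proof -
  obtain K where K: "\<And>y. norm (L y) \<le> norm y * K" using bounded_linear.bounded[OF L] by blast
  have "Lp_norm (real q) (\<lambda>x. L (X k x) - L (G x)) \<le> \<bar>K\<bar> * Lp_norm (real q) (\<lambda>x. X k x - G x)" for k
  proof -
    have D: "(\<lambda>x. X k x - G x) \<in> Lp (real q)" using X G q by auto
    have "Lp_norm (real q) (\<lambda>x. L (X k x - G x)) \<le> Lp_norm (real q) (\<lambda>x. \<bar>K\<bar> *\<^sub>R (X k x - G x))"
    proof (rule Lp_norm_mono[OF q Lp_scaleR[OF q D] Lp_measurable[OF Lp_bounded_linear[OF q D L]]], rule AE_I2)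
      fix x
      show "norm (L (X k x - G x)) \<le> norm (\<bar>K\<bar> *\<^sub>R (X k x - G x))"
        using K[of "X k x - G x"] mult_right_mono[OF abs_ge_self[of K], of "norm (X k x - G x)"]
        by (simp add: mult.commute)
    qed
    then show ?thesis unfolding Lp_norm_scaleR[OF q] by (simp add: linear_diff[OF bounded_linear.linear[OF L]])
  qed
  then show ?thesis
    by (intro Lim_null_comparison[OF _ tendsto_mult_right_zero[OF l, of "\<bar>K\<bar>"]] always_eventually allI) simp
qed

lemma sobolev_norm_le:
  fixes G :: "real^'n \<Rightarrow> (real^'n) \<times> (real^'n^'n)"
  assumes "G \<in> sobolev"
  shows "Ld_norm G \<le> Ld_norm (\<lambda>x. fst (G x)) + Ld_norm (\<lambda>x. snd (G x))"
proof -
  note L = sobolevD[OF assms]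
  let ?p = "real CARD('n)"
  have n: "(\<lambda>x. norm (fst (G x))) \<in> Lp ?p" "(\<lambda>x. norm (snd (G x))) \<in> Lp ?p"
    using Lp_norm_fun[OF _ L(2)] Lp_norm_fun[OF _ L(3)] by auto
  have le: "norm (G x) \<le> norm (fst (G x)) + norm (snd (G x))" for x
    using norm_Pair_le[of "fst (G x)" "snd (G x)"] by simp
  have "Lp_norm ?p G \<le> Lp_norm ?p (\<lambda>x. norm (fst (G x)) + norm (snd (G x)))"
    by (rule Lp_norm_mono[OF _ Lp_add[OF _ n] Lp_measurable[OF L(1)]]) (use le in auto)
  also have "\<dots> \<le> Lp_norm ?p (\<lambda>x. norm (fst (G x))) + Lp_norm ?p (\<lambda>x. norm (snd (G x)))"
    by (rule Lp_norm_triangle[OF _ n]) simp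
  also have "\<dots> = Lp_norm ?p (\<lambda>x. fst (G x)) + Lp_norm ?p (\<lambda>x. snd (G x))"
    by (simp add: Lp_norm_def)
  finally show ?thesis .
qed

section \<open>The penalised energy\<close>

text \<open>The divergence is read off as the trace of the gradient component, so the residual is
  affine in the pair at every point and not merely almost everywhere.\<close>

definition residual :: "(real^'n \<Rightarrow> real) \<Rightarrow> (real^'n \<Rightarrow> (real^'n) \<times> (real^'n^'n)) \<Rightarrow> real^'n \<Rightarrow> real" where
  "residual r G x = r x - trace (snd (G x))"

lemma residual_Lp:
  assumes "r \<in> Lp (real CARD('n))" "G \<in> sobolev"
  shows "residual r (G :: real^'n \<Rightarrow> _) \<in> Lp (real CARD('n))"
  unfolding residual_def[abs_def] using assms(1) sobolevD(4)[OF assms(2)] by auto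

lemma trace_scaleR: "trace (c *\<^sub>R A) = c *\<^sub>R trace (A :: real^'n^'n)"
  by (rule linear_cmul[OF bounded_linear.linear[OF bounded_linear_trace]])

lemma residual_mid: "residual r (\<lambda>x. (1/2) *\<^sub>R (G x + H x)) = (\<lambda>x. (1/2) *\<^sub>R (residual r G x + residual r H x))"
  by (simp add: residual_def fun_eq_iff trace_scaleR trace_add field_simps)

lemma residual_add_scaleR: "residual r (\<lambda>x. G x + t *\<^sub>R H x) = (\<lambda>x. residual r G x + t *\<^sub>R - trace (snd (H x)))"
  by (simp add: residual_def fun_eq_iff trace_scaleR trace_add)

lemma residual_tendsto:
  fixes X :: "nat \<Rightarrow> real^'n \<Rightarrow> (real^'n) \<times> (real^'n^'n)"
  assumes r: "r \<in> Lp (real CARD('n))" and X: "\<And>k. X k \<in> sobolev" and G: "G \<in> sobolev"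
    and l: "(\<lambda>k. Ld_norm (\<lambda>x. X k x - G x)) \<longlonglongrightarrow> 0"
  shows "(\<lambda>k. Ld_norm (residual r (X k))) \<longlonglongrightarrow> Ld_norm (residual r G)"
proof (rule Lp_norm_tendsto[OF _ residual_Lp[OF r G] residual_Lp[OF r X]])
  have "(\<lambda>k. Ld_norm (\<lambda>x. - trace (snd (X k x)) - (- trace (snd (G x))))) \<longlonglongrightarrow> 0"
    by (rule Lp_linear_tendsto[OF _ _ sobolevD(1)[OF X] sobolevD(1)[OF G] l])
      (auto intro!: bounded_linear_minus bounded_linear_compose[OF bounded_linear_trace] bounded_linear_snd)
  then show "(\<lambda>k. Ld_norm (\<lambda>x. residual r (X k) x - residual r G x)) \<longlonglongrightarrow> 0"
    by (simp add: residual_def algebra_simps)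
qed simp

lemma snd_tendsto:
  fixes X :: "nat \<Rightarrow> real^'n \<Rightarrow> (real^'n) \<times> (real^'n^'n)"
  assumes X: "\<And>k. X k \<in> sobolev" and G: "G \<in> sobolev"
    and l: "(\<lambda>k. Ld_norm (\<lambda>x. X k x - G x)) \<longlonglongrightarrow> 0"
  shows "(\<lambda>k. Ld_norm (\<lambda>x. snd (X k x))) \<longlonglongrightarrow> Ld_norm (\<lambda>x. snd (G x))"
  by (rule Lp_norm_tendsto[OF _ sobolevD(3)[OF G] sobolevD(3)[OF X]
        Lp_linear_tendsto[OF _ bounded_linear_snd sobolevD(1)[OF X] sobolevD(1)[OF G] l]]) simp_all

definition sobolev_Lp :: "nat \<Rightarrow> (real^'n \<Rightarrow> (real^'n) \<times> (real^'n^'n)) set" where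
  "sobolev_Lp p = {G \<in> sobolev. (\<lambda>x. fst (G x)) \<in> Lp (real p)}"

definition energy :: "nat \<Rightarrow> real \<Rightarrow> (real^'n \<Rightarrow> real) \<Rightarrow> (real^'n \<Rightarrow> (real^'n) \<times> (real^'n^'n)) \<Rightarrow> real" where
  "energy p \<Lambda> r G = pow_integral p (\<lambda>x. fst (G x)) / real p
     + pow_integral CARD('n) (\<lambda>x. snd (G x)) / real CARD('n)
     + \<Lambda> / real CARD('n) * pow_integral CARD('n) (residual r G)"

lemma sobolev_Lp_add_scaleR:
  assumes "p > 0" "G \<in> sobolev_Lp p" "H \<in> sobolev_Lp p"
  shows "(\<lambda>x. G x + t *\<^sub>R H x) \<in> sobolev_Lp p"
  using assms by (auto simp: sobolev_Lp_def intro!: sobolev_add sobolev_scaleR)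

lemma sobolev_Lp_mid:
  assumes "p > 0" "G \<in> sobolev_Lp p" "H \<in> sobolev_Lp p"
  shows "(\<lambda>x. (1/2) *\<^sub>R (G x + H x)) \<in> sobolev_Lp p"
proof -
  have "(\<lambda>x. (1/2) *\<^sub>R (fst (G x) + fst (H x))) \<in> Lp (real p)"
    using assms by (intro Lp_scaleR Lp_add) (auto simp: sobolev_Lp_def)
  then show ?thesis using assms by (auto simp: sobolev_Lp_def intro!: sobolev_add sobolev_scaleR)
qed

lemma energy_mid:
  fixes G H :: "real^'n \<Rightarrow> (real^'n) \<times> (real^'n^'n)"
  assumes d: "CARD('n) \<ge> 2" and p: "p \<ge> 2" and \<Lambda>: "\<Lambda> \<ge> 0" and r: "r \<in> Lp (real CARD('n))"
    and G: "G \<in> sobolev_Lp p" and H: "H \<in> sobolev_Lp p"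
  shows "energy p \<Lambda> r (\<lambda>x. (1/2) *\<^sub>R (G x + H x)) \<le> (energy p \<Lambda> r G + energy p \<Lambda> r H) / 2"
proof -
  have S: "G \<in> sobolev" "H \<in> sobolev" and Lp: "(\<lambda>x. fst (G x)) \<in> Lp (real p)" "(\<lambda>x. fst (H x)) \<in> Lp (real p)"
    using G H by (auto simp: sobolev_Lp_def)
  have a: "pow_integral p (\<lambda>x. fst ((1/2) *\<^sub>R (G x + H x)))
      \<le> (pow_integral p (\<lambda>x. fst (G x)) + pow_integral p (\<lambda>x. fst (H x))) / 2"
    using integral_mid_le[OF p Lp] by simp
  have b: "pow_integral CARD('n) (\<lambda>x. snd ((1/2) *\<^sub>R (G x + H x)))
      \<le> (pow_integral CARD('n) (\<lambda>x. snd (G x)) + pow_integral CARD('n) (\<lambda>x. snd (H x))) / 2"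
    using integral_mid_le[OF d sobolevD(3)[OF S(1)] sobolevD(3)[OF S(2)]] by simp
  have c: "pow_integral CARD('n) (\<lambda>x. residual r (\<lambda>x. (1/2) *\<^sub>R (G x + H x)) x)
      \<le> (pow_integral CARD('n) (residual r G) + pow_integral CARD('n) (residual r H)) / 2"
    unfolding residual_mid by (rule integral_mid_le[OF d residual_Lp[OF r S(1)] residual_Lp[OF r S(2)]])
  have "energy p \<Lambda> r (\<lambda>x. (1/2) *\<^sub>R (G x + H x))
    \<le> (pow_integral p (\<lambda>x. fst (G x)) + pow_integral p (\<lambda>x. fst (H x))) / 2 / real p
     + (pow_integral CARD('n) (\<lambda>x. snd (G x)) + pow_integral CARD('n) (\<lambda>x. snd (H x))) / 2 / real CARD('n)
     + \<Lambda> / real CARD('n) * ((pow_integral CARD('n) (residual r G) + pow_integral CARD('n) (residual r H)) / 2)"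
    unfolding energy_def by (intro add_mono divide_right_mono mult_left_mono a b c) (use \<Lambda> in auto)
  also have "\<dots> = (energy p \<Lambda> r G + energy p \<Lambda> r H) / 2"
    unfolding energy_def by (simp add: add_divide_distrib algebra_simps)
  finally show ?thesis .
qed

lemma energy_terms_le:
  fixes G :: "real^'n \<Rightarrow> (real^'n) \<times> (real^'n^'n)"
  assumes p: "p > 0" and \<Lambda>: "\<Lambda> \<ge> 0" and c: "energy p \<Lambda> r G \<le> c"
  shows "pow_integral p (\<lambda>x. fst (G x)) \<le> real p * c" "pow_integral CARD('n) (\<lambda>x. snd (G x)) \<le> real CARD('n) * c"
proof -
  define A B C where "A = pow_integral p (\<lambda>x. fst (G x)) / real p"
    and "B = pow_integral CARD('n) (\<lambda>x. snd (G x)) / real CARD('n)"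
    and "C = \<Lambda> / real CARD('n) * pow_integral CARD('n) (residual r G)"
  have "A \<ge> 0" "B \<ge> 0" "C \<ge> 0" using \<Lambda> by (auto simp: A_def B_def C_def)
  moreover have "A + B + C \<le> c" using c by (simp add: energy_def A_def B_def C_def)
  ultimately have "A \<le> c" "B \<le> c" by linarith+
  then show "pow_integral p (\<lambda>x. fst (G x)) \<le> real p * c" "pow_integral CARD('n) (\<lambda>x. snd (G x)) \<le> real CARD('n) * c"
    using p by (auto simp: A_def B_def divide_le_eq mult.commute)
qed

lemma energy_nonneg: "\<Lambda> \<ge> 0 \<Longrightarrow> energy p \<Lambda> r G \<ge> 0"
  unfolding energy_def by (intro add_nonneg_nonneg mult_nonneg_nonneg divide_nonneg_nonneg integral_nonneg) auto

lemma energy_minimizer: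
  fixes r :: "real^'n \<Rightarrow> real"
  assumes d: "CARD('n) \<ge> 2" and p: "p \<ge> CARD('n)" and \<Lambda>: "\<Lambda> \<ge> 0" and r: "r \<in> Lp (real CARD('n))"
  obtains G where "G \<in> sobolev_Lp p" "\<And>H. H \<in> sobolev_Lp p \<Longrightarrow> energy p \<Lambda> r G \<le> energy p \<Lambda> r H"
proof (rule minimizer_exists[of "CARD('n)" "sobolev_Lp p" "energy p \<Lambda> r"])
  have p2: "p \<ge> 2" and p0: "p > 0" using p d by auto
  show "(sobolev_Lp p :: (real^'n \<Rightarrow> _) set) \<subseteq> Lp (real CARD('n))" using sobolevD(1) by (auto simp: sobolev_Lp_def)
  have "(\<lambda>x. 0) \<in> (sobolev_Lp p :: (real^'n \<Rightarrow> _) set)" using p0 by (simp add: sobolev_Lp_def sobolev_zero)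
  then show "(sobolev_Lp p :: (real^'n \<Rightarrow> _) set) \<noteq> {}" by blast
  show "energy p \<Lambda> r G \<ge> 0" for G by (rule energy_nonneg[OF \<Lambda>])
  show "mid_convex {G \<in> sobolev_Lp p. energy p \<Lambda> r G \<le> c}" for c
    unfolding mid_convex_def
  proof (intro ballI)
    fix G H assume GH: "G \<in> {G \<in> sobolev_Lp p. energy p \<Lambda> r G \<le> c}" "H \<in> {G \<in> sobolev_Lp p. energy p \<Lambda> r G \<le> c}"
    then have "energy p \<Lambda> r (\<lambda>x. (1/2) *\<^sub>R (G x + H x)) \<le> c"
      using energy_mid[OF d p2 \<Lambda> r, of G H] by simp
    then show "(\<lambda>x. (1/2) *\<^sub>R (G x + H x)) \<in> {G \<in> sobolev_Lp p. energy p \<Lambda> r G \<le> c}"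
      using GH sobolev_Lp_mid[OF p0, of G H] by simp
  qed
  show "\<exists>B. \<forall>G\<in>sobolev_Lp p. energy p \<Lambda> r G \<le> c \<longrightarrow> Ld_norm G \<le> B" for c
  proof (intro exI ballI impI)
    fix G :: "real^'n \<Rightarrow> _" assume G: "G \<in> sobolev_Lp p" and c: "energy p \<Lambda> r G \<le> c"
    have S: "G \<in> sobolev" and Lp: "(\<lambda>x. fst (G x)) \<in> Lp (real p)" using G by (auto simp: sobolev_Lp_def)
    have c0: "c \<ge> 0" using c energy_nonneg[OF \<Lambda>, of p r G] by linarith
    note t = energy_terms_le[OF p0 \<Lambda> c]
    \<comment> \<open>Coercivity in L^d for the field itself comes from its p-th power integral,
      using that \<open>p\<close> is at least the dimension.\<close>
    have "pow_integral CARD('n) (\<lambda>x. fst (G x)) \<le> (\<integral>x. 1 + norm (fst (G x)) ^ p \<partial>torus)"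
      using Lp_integrable_pow[OF _ sobolevD(2)[OF S]] Lp_integrable_pow[OF p0 Lp] by (intro integral_mono pow_le_1_plus_pow p) auto
    also have "\<dots> = 1 + pow_integral p (\<lambda>x. fst (G x))"
      using Lp_integrable_pow[OF p0 Lp] by (simp add: torus.prob_space)
    also have "\<dots> \<le> 1 + real p * c" using t(1) by simp
    also have "\<dots> \<le> (1 + real p * c) ^ CARD('n)" using c0 by (intro self_le_power) auto
    finally have 1: "Ld_norm (\<lambda>x. fst (G x)) \<le> 1 + real p * c"
      using c0 by (subst Lp_norm_le_iff) auto
    have "real CARD('n) * c \<le> 1 + real CARD('n) * c" by simp
    also have "\<dots> \<le> (1 + real CARD('n) * c) ^ CARD('n)" using c0 by (intro self_le_power) auto
    finally have 2: "Ld_norm (\<lambda>x. snd (G x)) \<le> 1 + real CARD('n) * c"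
      using c0 t(2) by (subst Lp_norm_le_iff) auto
    show "Ld_norm G \<le> (1 + real p * c) + (1 + real CARD('n) * c)"
      using sobolev_norm_le[OF S] 1 2 by linarith
  qed
  show "Lp_closed (real CARD('n)) {G \<in> sobolev_Lp p. energy p \<Lambda> r G \<le> c}" for c
  proof (rule Lp_closedI)
    fix X :: "nat \<Rightarrow> real^'n \<Rightarrow> (real^'n) \<times> (real^'n^'n)" and G
    assume X: "\<And>k. X k \<in> {G \<in> sobolev_Lp p. energy p \<Lambda> r G \<le> c}" and G: "G \<in> Lp (real CARD('n))"
      and ae: "AE x in torus. (\<lambda>k. X k x) \<longlonglongrightarrow> G x"
      and l: "(\<lambda>k. Ld_norm (\<lambda>x. X k x - G x)) \<longlonglongrightarrow> 0"
    have XS: "X k \<in> sobolev" and XL: "(\<lambda>x. fst (X k x)) \<in> Lp (real p)" for k using X[of k] by (auto simp: sobolev_Lp_def)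
    have GS: "G \<in> sobolev" by (rule Lp_closedD[OF sobolev_closed[OF d] G XS ae l])
    \<comment> \<open>The gradient and penalty terms are continuous under convergence in L^d, but
      the p-th power term need not be. \<open>B k\<close> is what the energy bound leaves for that
      term; it converges to \<open>L\<close>, so Fatou's lemma applies with a varying bound.\<close>
    define B where "B k = real p * (c - Ld_norm (\<lambda>x. snd (X k x)) ^ CARD('n) / real CARD('n)
        - \<Lambda> / real CARD('n) * Ld_norm (residual r (X k)) ^ CARD('n))" for k
    define L where "L = real p * (c - Ld_norm (\<lambda>x. snd (G x)) ^ CARD('n) / real CARD('n)
        - \<Lambda> / real CARD('n) * Ld_norm (residual r G) ^ CARD('n))"
    have BL: "B \<longlonglongrightarrow> L" unfolding B_def L_def
      by (intro tendsto_intros snd_tendsto[OF XS GS l] residual_tendsto[OF r XS GS l]) simp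
    have Bk: "pow_integral p (\<lambda>x. fst (X k x)) \<le> B k" for k
    proof -
      have "pow_integral p (\<lambda>x. fst (X k x)) / real p \<le> B k / real p"
        using X[of k] p0 by (simp add: energy_def B_def Lp_norm_pow)
      then show ?thesis using p0 by (simp add: divide_le_cancel)
    qed
    have ae': "AE x in torus. (\<lambda>k. fst (X k x)) \<longlonglongrightarrow> fst (G x)"
      using ae by eventually_elim (rule tendsto_fst)
    have pm: "periodic (\<lambda>x. fst (G x))" "(\<lambda>x. fst (G x)) \<in> borel_measurable borel"
      using sobolevD(2)[OF GS] by (auto simp: Lp_def)
    note F = Lp_Fatou[OF p0 XL ae' pm always_eventually[OF allI[OF Bk]] BL]
    have "pow_integral p (\<lambda>x. fst (G x)) / real p \<le> L / real p"
      using F(2) by (intro divide_right_mono) auto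
    then have "energy p \<Lambda> r G \<le> c"
      using p0 by (simp add: energy_def L_def Lp_norm_pow)
    then show "G \<in> {G \<in> sobolev_Lp p. energy p \<Lambda> r G \<le> c}"
      using GS F(1) by (simp add: sobolev_Lp_def)
  qed
qed (use d that in auto)

text \<open>Minimality against \<open>G + t H\<close>, combined with the upper bounds by tangents at
  the perturbed point, gives a nonnegative quantity after division by \<open>t > 0\<close>;
  dominated convergence then lets \<open>t\<close> tend to 0.\<close>

lemma energy_variation:
  fixes r :: "real^'n \<Rightarrow> real"
  assumes d: "CARD('n) \<ge> 2" and p: "p \<ge> 2" and \<Lambda>: "\<Lambda> \<ge> 0" and r: "r \<in> Lp (real CARD('n))"
    and G: "G \<in> sobolev_Lp p" and H: "H \<in> sobolev_Lp p"
    and min: "\<And>H. H \<in> sobolev_Lp p \<Longrightarrow> energy p \<Lambda> r G \<le> energy p \<Lambda> r H"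
  shows "0 \<le> (\<integral>x. duality_map p (fst (G x)) \<bullet> fst (H x) \<partial>torus)
     + (\<integral>x. duality_map CARD('n) (snd (G x)) \<bullet> snd (H x) \<partial>torus)
     + \<Lambda> * (\<integral>x. duality_map CARD('n) (residual r G x) \<bullet> - trace (snd (H x)) \<partial>torus)"
proof -
  define \<tau> where "\<tau> n = 1 / (real n + 1)" for n
  have \<tau>: "0 \<le> \<tau> n" "\<tau> n \<le> 1" "0 < \<tau> n" for n by (auto simp: \<tau>_def)
  have \<tau>0: "\<tau> \<longlonglongrightarrow> 0"
    unfolding \<tau>_def by (rule LIMSEQ_one_over_add_1)
  have S: "G \<in> sobolev" "H \<in> sobolev" and Lp: "(\<lambda>x. fst (G x)) \<in> Lp (real p)" "(\<lambda>x. fst (H x)) \<in> Lp (real p)"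
    using G H by (auto simp: sobolev_Lp_def)
  have tr: "(\<lambda>x. - trace (snd (H x))) \<in> Lp (real CARD('n))"
    using Lp_scaleR[OF _ sobolevD(4)[OF S(2)], of "-1"] by simp
  define a b c where "a t = (\<integral>x. duality_map p (fst (G x) + t *\<^sub>R fst (H x)) \<bullet> fst (H x) \<partial>torus)"
    and "b t = (\<integral>x. duality_map CARD('n) (snd (G x) + t *\<^sub>R snd (H x)) \<bullet> snd (H x) \<partial>torus)"
    and "c t = (\<integral>x. duality_map CARD('n) (residual r G x + t *\<^sub>R - trace (snd (H x))) \<bullet> - trace (snd (H x)) \<partial>torus)"
    for t :: real
  have nonneg: "0 \<le> a (\<tau> n) + b (\<tau> n) + \<Lambda> * c (\<tau> n)" for n
  proof -
    let ?t = "\<tau> n"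
    define A B C where "A = pow_integral p (\<lambda>x. fst (G x))" and "B = pow_integral CARD('n) (\<lambda>x. snd (G x))"
      and "C = pow_integral CARD('n) (residual r G)"
    have "energy p \<Lambda> r G \<le> energy p \<Lambda> r (\<lambda>x. G x + ?t *\<^sub>R H x)"
      using p by (intro min sobolev_Lp_add_scaleR G H) auto
    also have "\<dots> \<le> (A + ?t * real p * a ?t) / real p
        + (B + ?t * real CARD('n) * b ?t) / real CARD('n)
        + \<Lambda> / real CARD('n) * (C + ?t * real CARD('n) * c ?t)"
      unfolding energy_def residual_add_scaleR A_def B_def C_def a_def b_def c_def fst_add snd_add fst_scaleR snd_scaleR
      by (intro add_mono divide_right_mono mult_left_mono norm_pow_integral_le p d Lp tr sobolevD S residual_Lp r)
        (use \<Lambda> in auto)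
    also have "\<dots> = energy p \<Lambda> r G + ?t * (a ?t + b ?t + \<Lambda> * c ?t)"
      using p by (simp add: energy_def A_def B_def C_def add_divide_distrib algebra_simps)
    finally show ?thesis using \<tau>(3)[of n] by (simp add: zero_le_mult_iff)
  qed
  have "(\<lambda>n. a (\<tau> n) + b (\<tau> n) + \<Lambda> * c (\<tau> n)) \<longlonglongrightarrow> (\<integral>x. duality_map p (fst (G x)) \<bullet> fst (H x) \<partial>torus)
     + (\<integral>x. duality_map CARD('n) (snd (G x)) \<bullet> snd (H x) \<partial>torus)
     + \<Lambda> * (\<integral>x. duality_map CARD('n) (residual r G x) \<bullet> - trace (snd (H x)) \<partial>torus)"
    unfolding a_def b_def c_def
    by (intro tendsto_add tendsto_mult tendsto_const duality_map_integral_tendsto p d Lp tr sobolevD S residual_Lp r \<tau> \<tau>0)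
  then show ?thesis by (rule LIMSEQ_le_const) (use nonneg in auto)
qed

text \<open>The first variation is linear in \<open>H\<close>, so its sign for both \<open>H\<close>
  and \<open>- H\<close> makes it vanish.\<close>

lemma energy_Euler_Lagrange:
  fixes r :: "real^'n \<Rightarrow> real"
  assumes d: "CARD('n) \<ge> 2" and p: "p \<ge> 2" and \<Lambda>: "\<Lambda> \<ge> 0" and r: "r \<in> Lp (real CARD('n))"
    and G: "G \<in> sobolev_Lp p" and H: "H \<in> sobolev_Lp p"
    and min: "\<And>H. H \<in> sobolev_Lp p \<Longrightarrow> energy p \<Lambda> r G \<le> energy p \<Lambda> r H"
  shows "(\<integral>x. duality_map p (fst (G x)) \<bullet> fst (H x) \<partial>torus)
     + (\<integral>x. duality_map CARD('n) (snd (G x)) \<bullet> snd (H x) \<partial>torus)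
     = \<Lambda> * (\<integral>x. duality_map CARD('n) (residual r G x) * trace (snd (H x)) \<partial>torus)"
proof -
  have "(\<lambda>x. 0) \<in> (sobolev_Lp p :: (real^'n \<Rightarrow> _) set)" using p by (simp add: sobolev_Lp_def sobolev_zero)
  then have H': "(\<lambda>x. 0 + (-1) *\<^sub>R H x) \<in> sobolev_Lp p"
    using p by (intro sobolev_Lp_add_scaleR H) auto
  have tr: "trace (- A) = - trace A" for A :: "real^'n^'n" using trace_scaleR[of "-1" A] by simp
  show ?thesis
    using energy_variation[OF d p \<Lambda> r G H min] energy_variation[OF d p \<Lambda> r G H' min]
    by (simp add: tr)
qed

section \<open>Bounded solutions of the divergence equation\<close>

text \<open>A separate argument for real exponents, needed to subtract the average from the
  multiplier in the conjugate space.\<close>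

lemma Lp_diff_const:
  fixes g :: "real^'n \<Rightarrow> real"
  assumes p: "p > 0" and g: "g \<in> Lp p"
  shows "(\<lambda>x. g x - m) \<in> Lp p"
proof -
  have [measurable]: "g \<in> borel_measurable borel" using g by (simp add: Lp_def)
  have "integrable torus (\<lambda>x. 2 powr p * (norm (g x) powr p + \<bar>m\<bar> powr p))"
    using g by (simp add: Lp_def)
  then have "integrable torus (\<lambda>x. norm (g x - m) powr p)"
  proof (rule Bochner_Integration.integrable_bound)
    have "norm (g x - m) powr p \<le> 2 powr p * (norm (g x) powr p + \<bar>m\<bar> powr p)" for x
    proof -
      have "norm (g x - m) powr p \<le> (2 * max \<bar>g x\<bar> \<bar>m\<bar>) powr p"
        using p by (intro powr_mono2) auto
      also have "\<dots> = 2 powr p * (max \<bar>g x\<bar> \<bar>m\<bar>) powr p" by (rule powr_mult)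
      also have "\<dots> \<le> 2 powr p * (norm (g x) powr p + \<bar>m\<bar> powr p)"
        by (intro mult_left_mono) (auto simp: max_def)
      finally show ?thesis .
    qed
    then show "AE x in torus. norm (norm (g x - m) powr p) \<le> norm (2 powr p * (norm (g x) powr p + \<bar>m\<bar> powr p))"
      by (intro AE_I2) simp
  qed measurable
  then show ?thesis using g periodic_comp[of g "\<lambda>y. y - m"] by (simp add: Lp_def)
qed

text \<open>The conjugate exponent satisfies \<open>(q - 1) * q' = q\<close>, so the power
  \<open>q'\<close> of the image is a multiple of \<open>norm (s x) ^ q\<close>.\<close>

lemma duality_map_Lp_conjugate:
  fixes s :: "real^'n \<Rightarrow> real"
  assumes q: "q \<ge> 2" and s: "s \<in> Lp (real q)"
  shows "(\<lambda>x. c * duality_map q (s x)) \<in> Lp (real q / (real q - 1))"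
proof -
  define q' where "q' = real q / (real q - 1)"
  have q': "real (q - 1) * q' = real q" "q' > 0" using q by (auto simp: q'_def of_nat_diff)
  have [measurable]: "s \<in> borel_measurable borel" using s by (simp add: Lp_def)
  have "norm (c * duality_map q (s x)) powr q' = \<bar>c\<bar> powr q' * norm (s x) ^ q" for x
  proof -
    have "norm (c * duality_map q (s x)) powr q' = \<bar>c\<bar> powr q' * (norm (s x) ^ (q - 1)) powr q'"
      unfolding norm_mult norm_duality_map[OF q] by (simp add: powr_mult)
    also have "(norm (s x) ^ (q - 1)) powr q' = norm (s x) ^ q"
    proof (cases "s x = 0")
      case False
      then have "(norm (s x) ^ (q - 1)) powr q' = norm (s x) powr (real (q - 1) * q')"
        by (simp add: powr_powr flip: powr_realpow)
      also have "\<dots> = norm (s x) ^ q" unfolding q'(1) using False by (simp add: powr_realpow)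
      finally show ?thesis .
    qed (use q in \<open>simp add: power_0_left\<close>)
    finally show ?thesis .
  qed
  moreover have "integrable torus (\<lambda>x. norm (s x) ^ q)" using s q by (simp add: Lp_nat)
  moreover have "periodic (\<lambda>x. c * duality_map q (s x))" using s by (simp add: Lp_def periodic_def)
  ultimately show ?thesis by (simp add: Lp_def q'_def)
qed

text \<open>The type argument carries the dimension, which \<open>\<beta>\<close> alone would not
  determine.\<close>

definition Bourgain_Brezis :: "'n::finite itself \<Rightarrow> real \<Rightarrow> bool" where
  "Bourgain_Brezis _ \<beta> \<longleftrightarrow> (\<forall>g \<in> Lp (real CARD('n) / (real CARD('n) - 1)).
     ennreal (Lp_norm (real CARD('n) / (real CARD('n) - 1)) (\<lambda>x. g x - average g))
       \<le> ennreal \<beta> * L1_plus_dual_norm (distr_grad (g :: real^'n \<Rightarrow> real)))"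

text \<open>With A, B, C the three integrals and g the multiplier, testing with \<open>G\<close>
  gives \<open>A + B + \<Lambda> * C\<close> as the integral of \<open>g * r\<close>. Hoelder and
  the Bourgain-Brezis estimate bound this by \<open>(2 + A + B) / 4\<close>, and absorbing A + B
  leaves bounds independent of \<open>p\<close> and \<open>\<Lambda>\<close>.\<close>

lemma penalized_solution:
  fixes r :: "real^'n \<Rightarrow> real"
  assumes d: "CARD('n) \<ge> 2" and \<beta>: "\<beta> > 0"
    and beta: "Bourgain_Brezis TYPE('n) \<beta>"
    and r: "r \<in> Lp (real CARD('n))" "average r = 0" "\<beta> * Ld_norm r \<le> 1 / 4"
    and p: "p \<ge> CARD('n)" and \<Lambda>: "\<Lambda> > 0"
  obtains G where "G \<in> sobolev_Lp p" "pow_integral p (\<lambda>x. fst (G x)) \<le> 1"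
    "pow_integral CARD('n) (\<lambda>x. snd (G x)) \<le> 1"
    "pow_integral CARD('n) (residual r G) \<le> 1 / \<Lambda>"
proof -
  let ?d = "CARD('n)"
  define d' where "d' = real ?d / (real ?d - 1)"
  have d': "d' > 1" "1 / real ?d + 1 / d' = 1" "real ?d > 1" using d by (auto simp: d'_def field_simps)
  have p2: "p \<ge> 2" and p0: "p > 0" using p d by auto
  have \<Lambda>0: "\<Lambda> \<ge> 0" using \<Lambda> by simp
  obtain G where G: "G \<in> sobolev_Lp p" and min: "\<And>H. H \<in> sobolev_Lp p \<Longrightarrow> energy p \<Lambda> r G \<le> energy p \<Lambda> r H"
    using energy_minimizer[OF d p \<Lambda>0 r(1)] by metis
  have S: "G \<in> sobolev" and Lp: "(\<lambda>x. fst (G x)) \<in> Lp (real p)" using G by (auto simp: sobolev_Lp_def)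
  note EL = energy_Euler_Lagrange[OF d p2 \<Lambda>0 r(1) G _ min]
  define s where "s = residual r G"
  have s: "s \<in> Lp (real ?d)" unfolding s_def by (rule residual_Lp[OF r(1) S])
  define g where "g x = \<Lambda> * duality_map ?d (s x)" for x
  have gL: "g \<in> Lp d'" unfolding g_def d'_def by (rule duality_map_Lp_conjugate[OF d s])
  define A B C where "A = pow_integral p (\<lambda>x. fst (G x))" and "B = pow_integral ?d (\<lambda>x. snd (G x))"
    and "C = pow_integral ?d s"
  have nn: "A \<ge> 0" "B \<ge> 0" "C \<ge> 0" by (auto simp: A_def B_def C_def)
  have [measurable]: "(\<lambda>x. fst (G x)) \<in> borel_measurable borel" "(\<lambda>x. snd (G x)) \<in> borel_measurable borel"
    using Lp_measurable[OF Lp] Lp_measurable[OF sobolevD(3)[OF S]] by auto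
  \<comment> \<open>The Euler-Lagrange equation for a test field and its gradient says that the
    action of \<open>a\<close> plus \<open>b\<close> is that of \<open>distr_grad g\<close>; the
    minus signs match the one in the distributional gradient.\<close>
  define a where "a x = - duality_map p (fst (G x))" for x
  define b where "b \<Psi> = - (\<integral>x. duality_map ?d (snd (G x)) \<bullet> classical_grad \<Psi> x \<partial>torus)" for \<Psi>
  have na: "norm (a x) \<le> 1 + norm (fst (G x)) ^ p" for x
    using pow_mult_le[of p "norm (fst (G x))" 1] p2 by (simp add: a_def norm_duality_map)
  have pi: "integrable torus (\<lambda>x. 1 + norm (fst (G x)) ^ p)"
    using Lp_integrable_pow[OF p0 Lp] by simp
  have am [measurable]: "a \<in> borel_measurable borel" unfolding a_def by measurable
  have ai: "integrable torus (\<lambda>x. norm (a x))"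
    using pi by (rule Bochner_Integration.integrable_bound) (use na in \<open>auto intro!: AE_I2 intro: order_trans\<close>)
  have aL: "a \<in> Lp 1"
    using ai Lp periodic_comp[of "\<lambda>x. fst (G x)" "\<lambda>y. - duality_map p y"] am
    by (simp add: Lp_def a_def[abs_def])
  have "Lp_norm 1 a = (\<integral>x. norm (a x) \<partial>torus)" by (simp add: Lp_norm_def)
  also have "\<dots> \<le> (\<integral>x. 1 + norm (fst (G x)) ^ p \<partial>torus)" by (intro integral_mono ai pi na)
  also have "\<dots> = 1 + A" using Lp_integrable_pow[OF p0 Lp] by (simp add: A_def torus.prob_space)
  finally have a_norm: "Lp_norm 1 a \<le> 1 + A" .
  \<comment> \<open>The crude Young inequality bounds the pairing by \<open>B\<close> plus the
    integral for the test gradient, which is at most 1 by normalisation.\<close>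
  have b_norm: "dual_W1d_norm b \<le> ennreal (1 + B)"
    unfolding dual_W1d_norm_def
  proof (rule SUP_least, rule ennreal_leI)
    fix \<Psi> :: "real^'n \<Rightarrow> real^'n"
    assume \<Psi>: "\<Psi> \<in> {\<Phi>. test_field \<Phi> \<and> Ld_norm (classical_grad \<Phi>) \<le> 1}"
    have cL: "classical_grad \<Psi> \<in> Lp (real ?d)"
      using sobolevD(3)[OF sobolev_test_field[of \<Psi>]] \<Psi> by simp
    have c1: "pow_integral ?d (\<lambda>x. classical_grad \<Psi> x) \<le> 1"
      using \<Psi> by (subst (asm) Lp_norm_le_iff) auto
    have di: "integrable torus (\<lambda>x. duality_map ?d (snd (G x)) \<bullet> classical_grad \<Psi> x)"
      by (rule duality_map_integrable[OF d sobolevD(3)[OF S] cL])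
    have "\<bar>b \<Psi>\<bar> = \<bar>\<integral>x. duality_map ?d (snd (G x)) \<bullet> classical_grad \<Psi> x \<partial>torus\<bar>" by (simp add: b_def)
    also have "\<dots> \<le> (\<integral>x. norm (snd (G x)) ^ ?d + norm (classical_grad \<Psi> x) ^ ?d \<partial>torus)"
      using di Lp_integrable_pow[OF _ sobolevD(3)[OF S]] Lp_integrable_pow[OF _ cL]
      by (intro order_trans[OF integral_abs_bound integral_mono] norm_duality_map_inner_le d) auto
    also have "\<dots> = B + pow_integral ?d (\<lambda>x. classical_grad \<Psi> x)"
      using Lp_integrable_pow[OF _ sobolevD(3)[OF S]] Lp_integrable_pow[OF _ cL] by (simp add: B_def)
    finally show "\<bar>b \<Psi>\<bar> \<le> 1 + B" using c1 by linarith
  qed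
  have split: "distr_grad g \<Psi> = distr_of_field a \<Psi> + b \<Psi>" if \<Psi>: "test_field \<Psi>" for \<Psi>
  proof -
    have "(\<lambda>x. (\<Psi> x, classical_grad \<Psi> x)) \<in> sobolev_Lp p"
      using sobolev_test_field[OF \<Psi>] test_field_bounded[OF \<Psi> p0] by (simp add: sobolev_Lp_def)
    from EL[OF this] show ?thesis
      unfolding distr_grad_def distr_of_field_def a_def b_def g_def s_def
      by (simp add: classical_div_eq_trace mult.assoc)
  qed
  have "L1_plus_dual_norm (distr_grad g) \<le> ennreal (Lp_norm 1 a) + dual_W1d_norm b"
    unfolding L1_plus_dual_norm_def by (rule INF_lower2[of "(a, b)"]) (use aL split in auto)
  also have "\<dots> \<le> ennreal (1 + A) + ennreal (1 + B)"
    by (intro add_mono ennreal_leI a_norm b_norm)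
  also have "\<dots> = ennreal (2 + A + B)" using nn by (simp flip: ennreal_plus)
  finally have L1: "L1_plus_dual_norm (distr_grad g) \<le> ennreal (2 + A + B)" .
  have "ennreal (Lp_norm d' (\<lambda>x. g x - average g)) \<le> ennreal \<beta> * L1_plus_dual_norm (distr_grad g)"
    unfolding d'_def by (rule beta[unfolded Bourgain_Brezis_def, rule_format]) (use gL in \<open>simp add: d'_def\<close>)
  also have "\<dots> \<le> ennreal \<beta> * ennreal (2 + A + B)" by (intro mult_left_mono L1) simp
  also have "\<dots> = ennreal (\<beta> * (2 + A + B))" using \<beta> by (simp add: ennreal_mult')
  finally have gn: "Lp_norm d' (\<lambda>x. g x - average g) \<le> \<beta> * (2 + A + B)"
    using \<beta> nn by (subst (asm) ennreal_le_iff) auto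
  have gmL: "(\<lambda>x. g x - average g) \<in> Lp d'" by (rule Lp_diff_const[OF _ gL]) (use d' in simp)
  have int_gr: "integrable torus (\<lambda>x. g x * r x)" and int_gs: "integrable torus (\<lambda>x. g x * s x)"
    using duality_map_integrable[OF d s r(1)] duality_map_integrable[OF d s s] by (auto simp: g_def mult.assoc)
  have ri: "integrable torus r" by (rule Lp_integrable[OF _ r(1)]) simp
  have "A + B = (\<integral>x. duality_map p (fst (G x)) \<bullet> fst (G x) \<partial>torus) + (\<integral>x. duality_map ?d (snd (G x)) \<bullet> snd (G x) \<partial>torus)"
    using p2 d by (simp add: A_def B_def duality_map_inner_self)
  also have "\<dots> = \<Lambda> * (\<integral>x. duality_map ?d (s x) * trace (snd (G x)) \<partial>torus)"
    unfolding s_def by (rule EL[OF G])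
  also have "\<dots> = (\<integral>x. g x * r x - g x * s x \<partial>torus)"
    unfolding g_def s_def residual_def by (subst integral_mult_right_zero[symmetric]) (simp add: algebra_simps)
  also have "\<dots> = (\<integral>x. g x * r x \<partial>torus) - (\<integral>x. g x * s x \<partial>torus)"
    by (rule Bochner_Integration.integral_diff[OF int_gr int_gs])
  also have "(\<integral>x. g x * s x \<partial>torus) = \<Lambda> * C"
    using duality_map_inner_self[OF d, of "s _"] by (simp add: g_def C_def mult.assoc)
  finally have AB: "A + B + \<Lambda> * C = (\<integral>x. g x * r x \<partial>torus)" by simp
  \<comment> \<open>Zero mean of \<open>r\<close> permits subtracting the average, the only form in
    which \<open>g\<close> is controlled.\<close>
  have "(\<integral>x. g x * r x \<partial>torus) = (\<integral>x. r x * (g x - average g) \<partial>torus)"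
    using r(2) ri int_gr by (simp add: right_diff_distrib average_def mult.commute)
  also have "\<dots> \<le> (\<integral>x. norm (r x) * norm (g x - average g) \<partial>torus)"
  proof (rule integral_mono)
    show "integrable torus (\<lambda>x. r x * (g x - average g))"
      using ri int_gr by (simp add: right_diff_distrib mult.commute)
    show "integrable torus (\<lambda>x. norm (r x) * norm (g x - average g))"
      by (rule Holder_integrable[OF d'(3,1,2) r(1) gmL])
    show "r x * (g x - average g) \<le> norm (r x) * norm (g x - average g)" for x
      by (simp flip: abs_mult)
  qed
  also have "\<dots> \<le> Ld_norm r * Lp_norm d' (\<lambda>x. g x - average g)"
    by (rule Holder_le[OF d'(3,1,2) r(1) gmL])
  also have "\<dots> \<le> Ld_norm r * (\<beta> * (2 + A + B))"
    by (intro mult_left_mono gn) simp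
  also have "\<dots> = (\<beta> * Ld_norm r) * (2 + A + B)" by simp
  also have "\<dots> \<le> 1 / 4 * (2 + A + B)"
    by (intro mult_right_mono r(3)) (use nn in simp)
  finally have "A + B + \<Lambda> * C \<le> 1 / 4 * (2 + A + B)" unfolding AB .
  moreover have "\<Lambda> * C \<ge> 0" using \<Lambda> nn by simp
  ultimately have "A \<le> 1" "B \<le> 1" "\<Lambda> * C \<le> 1" using nn by argo+
  moreover have "C \<le> 1 / \<Lambda>" using \<open>\<Lambda> * C \<le> 1\<close> \<Lambda> by (simp add: field_simps)
  ultimately show ?thesis using that[OF G] by (simp add: A_def B_def C_def s_def)
qed

text \<open>Chebyshev's inequality: for \<open>c > 1\<close> the set where the norm exceeds
  \<open>c\<close> has measure at most \<open>(1 / c) ^ q\<close> for every large \<open>q\<close>,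
  hence measure 0.\<close>

lemma AE_norm_le_1:
  assumes q0: "q0 > 0" and f: "\<And>q. q \<ge> q0 \<Longrightarrow> f \<in> Lp (real q)"
    and le: "\<And>q. q \<ge> q0 \<Longrightarrow> pow_integral q f \<le> 1"
  shows "AE x in torus. norm (f x) \<le> 1"
proof -
  have [measurable]: "f \<in> borel_measurable borel" using f[of q0] by (simp add: Lp_def)
  have "AE x in torus. norm (f x) \<le> 1 + 1 / (real m + 1)" for m :: nat
  proof -
    define c where "c = 1 + 1 / (real m + 1)"
    define E where "E = {x \<in> space torus. c < norm (f x)}"
    have c: "c > 1" by (simp add: c_def)
    have E: "E \<in> sets torus" unfolding E_def by measurable
    have "measure torus E \<le> (1 / c) ^ q" if q: "q \<ge> q0" for q
    proof -
      have fi: "integrable torus (\<lambda>x. norm (f x) ^ q)" using f[OF q] q q0 by (simp add: Lp_nat)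
      have "c ^ q * measure torus E = (\<integral>x. c ^ q * indicator E x \<partial>torus)"
        using E by simp
      also have "\<dots> \<le> pow_integral q f"
      proof (rule integral_mono[OF _ fi])
        show "c ^ q * indicator E x \<le> norm (f x) ^ q" for x
          using c by (auto simp: E_def indicator_def intro!: power_mono)
        show "integrable torus (\<lambda>x. c ^ q * indicator E x :: real)"
          using E by (intro integrable_mult_right integrable_real_indicator) (simp_all add: torus.emeasure_eq_measure)
      qed
      also have "\<dots> \<le> 1" by (rule le[OF q])
      finally show ?thesis using c by (simp add: power_divide field_simps)
    qed
    then have "measure torus E \<le> 0"
      by (intro LIMSEQ_le_const[OF LIMSEQ_power_zero[of "1 / c"]]) (use c in auto)
    then have "emeasure torus E = 0"
      by (simp add: torus.emeasure_eq_measure measure_le_0_iff)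
    then have "AE x in torus. x \<notin> E"
      using E by (intro AE_not_in) auto
    then show ?thesis using AE_space by eventually_elim (auto simp: E_def c_def not_less)
  qed
  then have "AE x in torus. \<forall>m::nat. norm (f x) \<le> 1 + 1 / (real m + 1)"
    by (simp add: AE_all_countable)
  then show ?thesis
  proof eventually_elim
    case (elim x)
    have "(\<lambda>m. 1 + 1 / (real m + 1)) \<longlonglongrightarrow> 1 + 0"
      by (intro tendsto_intros LIMSEQ_one_over_add_1)
    then show ?case using elim by (intro LIMSEQ_le_const[of _ "1::real"]) auto
  qed
qed

lemma solve_div_small:
  fixes r :: "real^'n \<Rightarrow> real"
  assumes d: "CARD('n) \<ge> 2" and \<beta>: "\<beta> > 0"
    and beta: "Bourgain_Brezis TYPE('n) \<beta>"
    and r: "r \<in> Lp (real CARD('n))" "average r = 0" "\<beta> * Ld_norm r \<le> 1 / 4"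
  obtains G where "G \<in> sobolev" "AE x in torus. norm (fst (G x)) \<le> 1"
    "Ld_norm (\<lambda>x. snd (G x)) \<le> 1" "AE x in torus. trace (snd (G x)) = r x"
proof -
  let ?d = "CARD('n)"
  \<comment> \<open>One index drives both limits: exponent \<open>?d + n\<close> and penalty
    \<open>real n + 1\<close>. A common point of all these sets satisfies every power bound at once
    and has zero residual.\<close>
  define C where "C n = {G \<in> sobolev_Lp (?d + n). pow_integral (?d + n) (\<lambda>x. fst (G x)) \<le> 1 \<and>
    pow_integral ?d (\<lambda>x. snd (G x)) \<le> 1 \<and> pow_integral ?d (residual r G) \<le> 1 / (real n + 1)}" for n
  have CI: "G \<in> C n" if "G \<in> sobolev" "(\<lambda>x. fst (G x)) \<in> Lp (real (?d + n))" "pow_integral (?d + n) (\<lambda>x. fst (G x)) \<le> 1"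
    "pow_integral ?d (\<lambda>x. snd (G x)) \<le> 1" "pow_integral ?d (residual r G) \<le> 1 / (real n + 1)" for G n
    using that unfolding C_def sobolev_Lp_def by blast
  have CD: "G \<in> sobolev" "(\<lambda>x. fst (G x)) \<in> Lp (real (?d + n))" "pow_integral (?d + n) (\<lambda>x. fst (G x)) \<le> 1"
    "pow_integral ?d (\<lambda>x. snd (G x)) \<le> 1" "pow_integral ?d (residual r G) \<le> 1 / (real n + 1)"
    if "G \<in> C n" for G n
    using that unfolding C_def sobolev_Lp_def by blast+
  have "\<exists>G. \<forall>n. G \<in> C n"
  proof (rule nested_inter_nonempty[OF d, of C])
    show "C n \<subseteq> Lp (real ?d)" for n using CD(1) sobolevD(1) by blast
    show "decseq C"
    proof (rule decseq_SucI, rule subsetI)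
      fix n G assume G: "G \<in> C (Suc n)"
      note D = CD[OF G]
      show "G \<in> C n"
      proof (rule CI[OF D(1) _ _ D(4)])
        show "(\<lambda>x. fst (G x)) \<in> Lp (real (?d + n))" by (rule Lp_mono[OF _ _ D(2)]) auto
        show "pow_integral (?d + n) (\<lambda>x. fst (G x)) \<le> 1" by (rule integral_pow_le_1[OF _ D(2,3)]) auto
        have "1 / (real (Suc n) + 1) \<le> 1 / (real n + 1)" by (simp add: frac_le)
        then show "pow_integral ?d (residual r G) \<le> 1 / (real n + 1)" using D(5) by linarith
      qed
    qed
    show "C n \<noteq> {}" for n
    proof -
      obtain G where "G \<in> sobolev_Lp (?d + n)" "pow_integral (?d + n) (\<lambda>x. fst (G x)) \<le> 1"
        "pow_integral ?d (\<lambda>x. snd (G x)) \<le> 1" "pow_integral ?d (residual r G) \<le> 1 / (real n + 1)"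
        by (rule penalized_solution[OF d \<beta> beta r, of "?d + n" "real n + 1"]) auto
      then show ?thesis unfolding C_def by blast
    qed
    show "mid_convex (C n)" for n
      unfolding mid_convex_def
    proof (intro ballI)
      fix F G assume "F \<in> C n" "G \<in> C n"
      note F = CD[OF \<open>F \<in> C n\<close>] and G = CD[OF \<open>G \<in> C n\<close>]
      show "(\<lambda>x. (1/2) *\<^sub>R (F x + G x)) \<in> C n"
      proof (rule CI)
        show "(\<lambda>x. (1/2) *\<^sub>R (F x + G x)) \<in> sobolev" by (intro sobolev_scaleR sobolev_add F G)
        have "(\<lambda>x. (1/2) *\<^sub>R (fst (F x) + fst (G x))) \<in> Lp (real (?d + n))"
          by (intro Lp_scaleR Lp_add F G) auto
        then show "(\<lambda>x. fst ((1/2) *\<^sub>R (F x + G x))) \<in> Lp (real (?d + n))" by simp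
        show "pow_integral (?d + n) (\<lambda>x. fst ((1/2) *\<^sub>R (F x + G x))) \<le> 1"
          using integral_mid_le[OF _ F(2) G(2)] F(3) G(3) d by simp
        show "pow_integral ?d (\<lambda>x. snd ((1/2) *\<^sub>R (F x + G x))) \<le> 1"
          using integral_mid_le[OF d sobolevD(3)[OF F(1)] sobolevD(3)[OF G(1)]] F(4) G(4) by simp
        show "pow_integral ?d (\<lambda>x. residual r (\<lambda>x. (1/2) *\<^sub>R (F x + G x)) x) \<le> 1 / (real n + 1)"
          unfolding residual_mid
          by (rule order_trans[OF integral_mid_le[OF d residual_Lp[OF r(1) F(1)] residual_Lp[OF r(1) G(1)]]])
            (use F(5) G(5) in argo)
      qed
    qed
    show "Lp_closed (real ?d) (C n)" for n
    proof (rule Lp_closedI)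
      fix X :: "nat \<Rightarrow> real^'n \<Rightarrow> (real^'n) \<times> (real^'n^'n)" and G
      assume X: "\<And>k. X k \<in> C n" and G: "G \<in> Lp (real ?d)"
        and ae: "AE x in torus. (\<lambda>k. X k x) \<longlonglongrightarrow> G x"
        and l: "(\<lambda>k. Ld_norm (\<lambda>x. X k x - G x)) \<longlonglongrightarrow> 0"
      note XD = CD[OF X]
      have GS: "G \<in> sobolev" by (rule Lp_closedD[OF sobolev_closed[OF d] G XD(1) ae l])
      have f: "AE x in torus. (\<lambda>k. fst (X k x)) \<longlonglongrightarrow> fst (G x)"
        using ae by eventually_elim (rule tendsto_fst)
      have s: "AE x in torus. (\<lambda>k. snd (X k x)) \<longlonglongrightarrow> snd (G x)"
        using ae by eventually_elim (rule tendsto_snd)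
      have t: "AE x in torus. (\<lambda>k. residual r (X k) x) \<longlonglongrightarrow> residual r G x"
        using s unfolding residual_def
        by eventually_elim (intro tendsto_diff tendsto_const bounded_linear.tendsto[OF bounded_linear_trace])
      have pf: "periodic (\<lambda>x. fst (G x))" "(\<lambda>x. fst (G x)) \<in> borel_measurable borel"
        and ps: "periodic (\<lambda>x. snd (G x))" "(\<lambda>x. snd (G x)) \<in> borel_measurable borel"
        and pt: "periodic (residual r G)" "residual r G \<in> borel_measurable borel"
        using sobolevD(2,3)[OF GS] residual_Lp[OF r(1) GS] by (auto simp: Lp_def)
      note F1 = Lp_Fatou[OF _ XD(2) f pf always_eventually[OF allI[OF XD(3)]] tendsto_const]
      note F2 = Lp_Fatou[OF _ sobolevD(3)[OF XD(1)] s ps always_eventually[OF allI[OF XD(4)]] tendsto_const]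
      note F3 = Lp_Fatou[OF _ residual_Lp[OF r(1) XD(1)] t pt always_eventually[OF allI[OF XD(5)]] tendsto_const]
      show "G \<in> C n" by (rule CI[OF GS F1 F2(2) F3(2)]) auto
    qed
    show "Ld_norm G \<le> 2" if "G \<in> C 0" for G
    proof -
      note D = CD[OF that]
      have "Ld_norm (\<lambda>x. fst (G x)) \<le> 1" "Ld_norm (\<lambda>x. snd (G x)) \<le> 1"
        using D(3,4) by (auto simp: Lp_norm_le_iff)
      then show ?thesis using sobolev_norm_le[OF D(1)] by linarith
    qed
  qed blast
  then obtain G where G: "\<And>n. G \<in> C n" by blast
  note D = CD[OF G]
  have 1: "AE x in torus. norm (fst (G x)) \<le> 1"
  proof (rule AE_norm_le_1[of ?d])
    fix q assume "q \<ge> ?d"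
    then obtain n where "q = ?d + n" using le_Suc_ex by blast
    then show "(\<lambda>x. fst (G x)) \<in> Lp (real q)" "pow_integral q (\<lambda>x. fst (G x)) \<le> 1" using D(2,3) by blast+
  qed simp
  have 2: "Ld_norm (\<lambda>x. snd (G x)) \<le> 1" using D(4) by (simp add: Lp_norm_le_iff)
  have "pow_integral ?d (residual r G) \<le> 0"
  proof (rule LIMSEQ_le_const)
    show "(\<lambda>n. 1 / (real n + 1)) \<longlonglongrightarrow> 0" by (rule LIMSEQ_one_over_add_1)
  qed (use D(5) in auto)
  then have "Ld_norm (residual r G) ^ ?d \<le> 0" by (simp add: Lp_norm_pow)
  then have "Ld_norm (residual r G) = 0"
    using zero_le_power[OF Lp_norm_nonneg[of "real ?d" "residual r G"], of ?d] by (simp add: antisym)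
  then have "AE x in torus. residual r G x = 0"
    by (rule Lp_norm_eq_0_AE[OF _ residual_Lp[OF r(1) D(1)], rotated]) simp
  then have 3: "AE x in torus. trace (snd (G x)) = r x" by eventually_elim (simp add: residual_def)
  show ?thesis by (rule that[OF D(1) 1 2 3])
qed

lemma solve_div:
  fixes r :: "real^'n \<Rightarrow> real"
  assumes d: "CARD('n) \<ge> 2" and \<beta>: "\<beta> > 0"
    and beta: "Bourgain_Brezis TYPE('n) \<beta>"
    and r: "r \<in> Lp (real CARD('n))" "average r = 0"
  obtains G where "G \<in> sobolev" "(\<lambda>x. fst (G x)) \<in> Linf" "AE x in torus. trace (snd (G x)) = r x"
    "Linf_norm (\<lambda>x. fst (G x)) + Ld_norm (\<lambda>x. snd (G x)) \<le> 8 * \<beta> * Ld_norm r"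
proof (cases "Ld_norm r = 0")
  case True
  then have "AE x in torus. r x = 0" by (intro Lp_norm_eq_0_AE[OF _ r(1)]) auto
  then have "AE x in torus. trace (snd (0 :: (real^'n) \<times> (real^'n^'n))) = r x"
    by eventually_elim (simp add: trace_def)
  then show ?thesis
    using True by (intro that[OF sobolev_zero]) (auto simp: Linf_zero)
next
  case False
  let ?d = "real CARD('n)"
  \<comment> \<open>Dividing by \<open>c\<close> brings the data exactly to the threshold 1/4.
    Scaling back makes each of the two norms at most \<open>c\<close>, and their sum at most
    \<open>2 * c\<close>.\<close>
  define c where "c = 4 * \<beta> * Lp_norm ?d r"
  have c: "c > 0" using False \<beta> Lp_norm_nonneg[of ?d r] by (simp add: c_def less_le)
  have "(\<lambda>x. (1 / c) *\<^sub>R r x) \<in> Lp ?d" by (rule Lp_scaleR[OF _ r(1)]) simp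
  moreover have "average (\<lambda>x. (1 / c) *\<^sub>R r x) = 0" using r(2) by (simp add: average_def)
  moreover have "\<beta> * Lp_norm ?d (\<lambda>x. (1 / c) *\<^sub>R r x) \<le> 1 / 4"
    using c \<beta> False by (subst Lp_norm_scaleR) (auto simp: c_def)
  ultimately obtain G where G: "G \<in> sobolev" "AE x in torus. norm (fst (G x)) \<le> 1"
    "Lp_norm ?d (\<lambda>x. snd (G x)) \<le> 1" "AE x in torus. trace (snd (G x)) = (1 / c) *\<^sub>R r x"
    using solve_div_small[OF d \<beta> beta, of "\<lambda>x. (1 / c) *\<^sub>R r x"] by blast
  have Linf: "(\<lambda>x. fst (G x)) \<in> Linf"
    using sobolevD(2)[OF G(1)] G(2) by (auto simp: Linf_iff Lp_def)
  have n1: "Linf_norm (\<lambda>x. fst (G x)) \<le> 1"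
    using Linf_norm_le[OF Linf_measurable[OF Linf] _ G(2)] by simp
  show ?thesis
  proof (rule that[of "\<lambda>x. c *\<^sub>R G x"])
    show "(\<lambda>x. c *\<^sub>R G x) \<in> sobolev" by (rule sobolev_scaleR[OF G(1)])
    show "(\<lambda>x. fst (c *\<^sub>R G x)) \<in> Linf" using Linf_scaleR(1)[OF Linf] by simp
    show "AE x in torus. trace (snd (c *\<^sub>R G x)) = r x"
      using G(4) by eventually_elim (use c in \<open>simp add: trace_scaleR\<close>)
    have "Linf_norm (\<lambda>x. fst (c *\<^sub>R G x)) \<le> c * 1"
      using order_trans[OF Linf_scaleR(2)[OF Linf, of c] mult_left_mono[OF n1 abs_ge_zero]] c by simp
    moreover have "Lp_norm ?d (\<lambda>x. snd (c *\<^sub>R G x)) \<le> c * 1"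
      using c mult_left_mono[OF G(3), of c] by (simp add: Lp_norm_scaleR)
    ultimately show "Linf_norm (\<lambda>x. fst (c *\<^sub>R G x)) + Lp_norm ?d (\<lambda>x. snd (c *\<^sub>R G x)) \<le> 8 * \<beta> * Lp_norm ?d r"
      by (simp add: c_def)
  qed
qed

section \<open>The hierarchical decomposition\<close>

lemma Linf_sum:
  assumes "finite A" "\<And>k. k \<in> A \<Longrightarrow> v k \<in> Linf"
  shows "(\<lambda>x. \<Sum>k\<in>A. v k x) \<in> Linf" "Linf_norm (\<lambda>x. \<Sum>k\<in>A. v k x) \<le> (\<Sum>k\<in>A. Linf_norm (v k))"
proof -
  have "(\<lambda>x. \<Sum>k\<in>A. v k x) \<in> Linf \<and> Linf_norm (\<lambda>x. \<Sum>k\<in>A. v k x) \<le> (\<Sum>k\<in>A. Linf_norm (v k))"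
    using assms
  proof induction
    case (insert a A)
    then have v: "v a \<in> Linf" and IH: "(\<lambda>x. \<Sum>k\<in>A. v k x) \<in> Linf" "Linf_norm (\<lambda>x. \<Sum>k\<in>A. v k x) \<le> (\<Sum>k\<in>A. Linf_norm (v k))"
      by auto
    show ?case using Linf_add[OF v IH(1)] IH(2) insert.hyps by simp
  qed (simp add: Linf_zero)
  then show "(\<lambda>x. \<Sum>k\<in>A. v k x) \<in> Linf" "Linf_norm (\<lambda>x. \<Sum>k\<in>A. v k x) \<le> (\<Sum>k\<in>A. Linf_norm (v k))" by auto
qed

lemma Lp_norm_sum:
  assumes q: "q > 0" and "finite A" "\<And>k. k \<in> A \<Longrightarrow> v k \<in> Lp (real q)"
  shows "Lp_norm (real q) (\<lambda>x. \<Sum>k\<in>A. v k x) \<le> (\<Sum>k\<in>A. Lp_norm (real q) (v k))"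
  using assms(2,3)
proof induction
  case (insert a A)
  have v: "v a \<in> Lp (real q)" "(\<lambda>x. \<Sum>k\<in>A. v k x) \<in> Lp (real q)"
    using insert.prems by (auto intro!: Lp_sum q)
  show ?case using Lp_norm_triangle[OF q v] insert by auto
qed (simp add: q)

definition sobolev_Linf :: "(real^'n \<Rightarrow> (real^'n) \<times> (real^'n^'n)) set" where
  "sobolev_Linf = {G \<in> sobolev. (\<lambda>x. fst (G x)) \<in> Linf}"

definition sobolev_Linf_norm :: "(real^'n \<Rightarrow> (real^'n) \<times> (real^'n^'n)) \<Rightarrow> real" where
  "sobolev_Linf_norm G = Linf_norm (\<lambda>x. fst (G x)) + Ld_norm (\<lambda>x. snd (G x))"

text \<open>The refinement functional in terms of pairs, with the earlier terms absorbed into the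
  data \<open>r\<close> and the weight \<open>lam1 * 2 ^ j\<close> into \<open>c\<close>.\<close>

definition penalty_objective :: "real \<Rightarrow> (real^'n \<Rightarrow> real) \<Rightarrow> (real^'n \<Rightarrow> (real^'n) \<times> (real^'n^'n)) \<Rightarrow> real" where
  "penalty_objective c r G = sobolev_Linf_norm G + c * Ld_norm (residual r G) ^ CARD('n)"

definition with_grad :: "(real^'n \<Rightarrow> real^'n) \<Rightarrow> real^'n \<Rightarrow> (real^'n) \<times> (real^'n^'n)" where
  "with_grad v x = (v x, weak_grad v x)"

lemma with_grad_mem:
  assumes "v \<in> Linf_W1d"
  shows "with_grad v \<in> sobolev_Linf"
  using sobolev_weak_grad[OF assms] assms
  by (simp add: sobolev_Linf_def with_grad_def[abs_def] Linf_W1d_def)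

lemma weak_grad_measurable: "v \<in> Linf_W1d \<Longrightarrow> weak_grad v \<in> borel_measurable borel"
  using Lp_measurable[OF sobolevD(3)[OF sobolev_weak_grad]] by simp

lemma sobolev_LinfD:
  assumes "G \<in> sobolev_Linf"
  shows "G \<in> sobolev" "(\<lambda>x. fst (G x)) \<in> Linf" "(\<lambda>x. fst (G x)) \<in> Linf_W1d"
    "AE x in torus. weak_grad (\<lambda>x. fst (G x)) x = snd (G x)"
    "Linf_W1d_norm (\<lambda>x. fst (G x)) = sobolev_Linf_norm G"
proof -
  show S: "G \<in> sobolev" and L: "(\<lambda>x. fst (G x)) \<in> Linf" using assms by (auto simp: sobolev_Linf_def)
  show W: "(\<lambda>x. fst (G x)) \<in> Linf_W1d" by (rule Linf_W1d_sobolev(1)[OF S L])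
  show AE: "AE x in torus. weak_grad (\<lambda>x. fst (G x)) x = snd (G x)" by (rule Linf_W1d_sobolev(2)[OF S L])
  have "Lp_norm (real CARD('a)) (weak_grad (\<lambda>x. fst (G x))) = Lp_norm (real CARD('a)) (\<lambda>x. snd (G x))"
    by (rule Lp_norm_cong_AE[OF _ weak_grad_measurable[OF W] Lp_measurable[OF sobolevD(3)[OF S]]])
      (use AE in eventually_elim, simp)
  then show "Linf_W1d_norm (\<lambda>x. fst (G x)) = sobolev_Linf_norm G"
    by (simp add: Linf_W1d_norm_def sobolev_Linf_norm_def)
qed

lemma sobolev_Linf_add:
  assumes "F \<in> sobolev_Linf" "G \<in> sobolev_Linf"
  shows "(\<lambda>x. F x + G x) \<in> sobolev_Linf"
  using assms Linf_add(1)[of "\<lambda>x. fst (F x)" "\<lambda>x. fst (G x)"] by (auto simp: sobolev_Linf_def intro: sobolev_add)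

lemma sobolev_Linf_scaleR:
  assumes "F \<in> sobolev_Linf"
  shows "(\<lambda>x. c *\<^sub>R F x) \<in> sobolev_Linf"
  using assms Linf_scaleR(1)[of "\<lambda>x. fst (F x)" c] by (auto simp: sobolev_Linf_def intro: sobolev_scaleR)

lemma sobolev_Linf_zero: "(\<lambda>x. 0) \<in> sobolev_Linf"
  by (simp add: sobolev_Linf_def sobolev_zero Linf_zero)

lemma sobolev_Linf_sum:
  assumes "finite A" "\<And>k. k \<in> A \<Longrightarrow> F k \<in> sobolev_Linf"
  shows "(\<lambda>x. \<Sum>k\<in>A. F k x) \<in> sobolev_Linf"
  using assms by induction (auto intro: sobolev_Linf_zero sobolev_Linf_add)

lemma sobolev_Linf_norm_nonneg: "sobolev_Linf_norm G \<ge> 0"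
  by (simp add: sobolev_Linf_norm_def)

lemma sobolev_Lp_norm_le:
  fixes G :: "real^'n \<Rightarrow> (real^'n) \<times> (real^'n^'n)"
  assumes "G \<in> sobolev_Linf"
  shows "Ld_norm G \<le> sobolev_Linf_norm G"
  using sobolev_norm_le[OF sobolev_LinfD(1)[OF assms]] Linf_Lp(2)[OF _ sobolev_LinfD(2)[OF assms], of "CARD('n)"]
  by (simp add: sobolev_Linf_norm_def)

text \<open>This makes every refinement step the same minimisation problem, with the current
  residual as data.\<close>

lemma residual_residual: "residual (residual r P) G = residual r (\<lambda>x. P x + G x)"
  by (simp add: residual_def fun_eq_iff trace_add)

lemma penalty_minimizer:
  fixes r :: "real^'n \<Rightarrow> real"
  assumes d: "CARD('n) \<ge> 2" and c: "c \<ge> 0" and r: "r \<in> Lp (real CARD('n))"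
  obtains G where "G \<in> sobolev_Linf" "\<And>H. H \<in> sobolev_Linf \<Longrightarrow> penalty_objective c r G \<le> penalty_objective c r H"
proof (rule minimizer_exists[of "CARD('n)" sobolev_Linf "penalty_objective c r"])
  let ?d = "CARD('n)"
  have d0: "?d > 0" by simp
  show "(sobolev_Linf :: (real^'n \<Rightarrow> _) set) \<subseteq> Lp (real ?d)"
    using sobolev_LinfD(1) sobolevD(1) by blast
  show "(sobolev_Linf :: (real^'n \<Rightarrow> _) set) \<noteq> {}" using sobolev_Linf_zero by blast
  have nn: "c * Ld_norm (residual r G) ^ ?d \<ge> 0" for G using c by simp
  show "penalty_objective c r G \<ge> 0" for G
    unfolding penalty_objective_def using nn[of G] sobolev_Linf_norm_nonneg[of G] by linarith
  show "mid_convex {G \<in> sobolev_Linf. penalty_objective c r G \<le> t}" for t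
    unfolding mid_convex_def
  proof (intro ballI)
    fix F G assume "F \<in> {G \<in> sobolev_Linf. penalty_objective c r G \<le> t}" "G \<in> {G \<in> sobolev_Linf. penalty_objective c r G \<le> t}"
    then have F: "F \<in> sobolev_Linf" "penalty_objective c r F \<le> t" and G: "G \<in> sobolev_Linf" "penalty_objective c r G \<le> t"
      by auto
    note FD = sobolev_LinfD[OF F(1)] and GD = sobolev_LinfD[OF G(1)]
    have "Linf_norm (\<lambda>x. (1/2) *\<^sub>R (fst (F x) + fst (G x))) \<le> \<bar>1/2\<bar> * Linf_norm (\<lambda>x. fst (F x) + fst (G x))"
      by (rule Linf_scaleR(2)[OF Linf_add(1)[OF FD(2) GD(2)]])
    also have "\<dots> \<le> \<bar>1/2\<bar> * (Linf_norm (\<lambda>x. fst (F x)) + Linf_norm (\<lambda>x. fst (G x)))"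
      by (intro mult_left_mono Linf_add(2) FD GD) simp
    finally have 1: "Linf_norm (\<lambda>x. fst ((1/2) *\<^sub>R (F x + G x))) \<le> (Linf_norm (\<lambda>x. fst (F x)) + Linf_norm (\<lambda>x. fst (G x))) / 2"
      by simp
    have "Ld_norm (\<lambda>x. (1/2) *\<^sub>R (snd (F x) + snd (G x))) = \<bar>1/2\<bar> * Ld_norm (\<lambda>x. snd (F x) + snd (G x))"
      by (rule Lp_norm_scaleR[OF d0])
    also have "\<dots> \<le> \<bar>1/2\<bar> * (Ld_norm (\<lambda>x. snd (F x)) + Ld_norm (\<lambda>x. snd (G x)))"
      by (intro mult_left_mono Lp_norm_triangle d0 sobolevD FD GD) simp
    finally have 2: "Ld_norm (\<lambda>x. snd ((1/2) *\<^sub>R (F x + G x))) \<le> (Ld_norm (\<lambda>x. snd (F x)) + Ld_norm (\<lambda>x. snd (G x))) / 2"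
      by simp
    have "Ld_norm (residual r (\<lambda>x. (1/2) *\<^sub>R (F x + G x))) ^ ?d
      \<le> (Ld_norm (residual r F) ^ ?d + Ld_norm (residual r G) ^ ?d) / 2"
      unfolding residual_mid Lp_norm_pow[OF d0]
      by (rule integral_mid_le[OF d residual_Lp[OF r FD(1)] residual_Lp[OF r GD(1)]])
    then have 3: "c * Ld_norm (residual r (\<lambda>x. (1/2) *\<^sub>R (F x + G x))) ^ ?d
      \<le> c * ((Ld_norm (residual r F) ^ ?d + Ld_norm (residual r G) ^ ?d) / 2)"
      by (rule mult_left_mono[OF _ c])
    have "penalty_objective c r (\<lambda>x. (1/2) *\<^sub>R (F x + G x)) \<le> (penalty_objective c r F + penalty_objective c r G) / 2"
      using 1 2 3 unfolding penalty_objective_def sobolev_Linf_norm_def by argo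
    then have "penalty_objective c r (\<lambda>x. (1/2) *\<^sub>R (F x + G x)) \<le> t" using F(2) G(2) by argo
    then show "(\<lambda>x. (1/2) *\<^sub>R (F x + G x)) \<in> {G \<in> sobolev_Linf. penalty_objective c r G \<le> t}"
      using sobolev_Linf_scaleR[OF sobolev_Linf_add[OF F(1) G(1)], of "1/2"] by simp
  qed
  show "\<exists>B. \<forall>G\<in>sobolev_Linf. penalty_objective c r G \<le> t \<longrightarrow> Ld_norm G \<le> B" for t
  proof (intro exI ballI impI)
    fix G :: "real^'n \<Rightarrow> _" assume "G \<in> sobolev_Linf" "penalty_objective c r G \<le> t"
    then show "Ld_norm G \<le> t"
      using sobolev_Lp_norm_le[of G] nn[of G] by (simp add: penalty_objective_def)
  qed
  show "Lp_closed (real ?d) {G \<in> sobolev_Linf. penalty_objective c r G \<le> t}" for t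
  proof (rule Lp_closedI)
    fix X :: "nat \<Rightarrow> real^'n \<Rightarrow> (real^'n) \<times> (real^'n^'n)" and G
    assume X: "\<And>k. X k \<in> {G \<in> sobolev_Linf. penalty_objective c r G \<le> t}" and G: "G \<in> Lp (real ?d)"
      and ae: "AE x in torus. (\<lambda>k. X k x) \<longlonglongrightarrow> G x"
      and l: "(\<lambda>k. Ld_norm (\<lambda>x. X k x - G x)) \<longlonglongrightarrow> 0"
    have XL: "X k \<in> sobolev_Linf" for k using X by blast
    note XS = sobolev_LinfD(1)[OF XL]
    have GS: "G \<in> sobolev" by (rule Lp_closedD[OF sobolev_closed[OF d] G XS ae l])
    \<comment> \<open>The L-infinity norm is not continuous under convergence in L^d.
      \<open>M k\<close> is what the two continuous terms leave for it, and the pointwise limit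
      inherits the limiting bound \<open>L\<close>.\<close>
    define M where "M k = t - Ld_norm (\<lambda>x. snd (X k x)) - c * Ld_norm (residual r (X k)) ^ ?d" for k
    define L where "L = t - Ld_norm (\<lambda>x. snd (G x)) - c * Ld_norm (residual r G) ^ ?d"
    have Mlim: "M \<longlonglongrightarrow> L" unfolding M_def L_def
      by (intro tendsto_intros snd_tendsto[OF XS GS l] residual_tendsto[OF r XS GS l])
    have XM: "Linf_norm (\<lambda>x. fst (X k x)) \<le> M k" for k
      using X[of k] by (simp add: M_def penalty_objective_def sobolev_Linf_norm_def)
    have L0: "0 \<le> L"
      by (rule LIMSEQ_le_const[OF Mlim]) (use XM order_trans[OF Linf_norm_nonneg XM] in blast)
    have "AE x in torus. \<forall>k. norm (fst (X k x)) \<le> Linf_norm (\<lambda>x. fst (X k x))"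
      unfolding AE_all_countable using Linf_norm_AE[OF sobolev_LinfD(2)[OF XL]] by blast
    then have AE: "AE x in torus. norm (fst (G x)) \<le> L"
      using ae
    proof eventually_elim
      case (elim x)
      have "(\<lambda>k. norm (fst (X k x))) \<longlonglongrightarrow> norm (fst (G x))"
        by (intro tendsto_norm tendsto_fst elim)
      moreover have "norm (fst (X k x)) \<le> M k" for k
        using elim(1) XM order_trans by blast
      ultimately show ?case by (intro LIMSEQ_le[OF _ Mlim]) auto
    qed
    have GL: "(\<lambda>x. fst (G x)) \<in> Linf"
      using AE sobolevD(2)[OF GS] by (auto simp: Linf_iff Lp_def)
    have "Linf_norm (\<lambda>x. fst (G x)) \<le> L"
      by (rule Linf_norm_le[OF Linf_measurable[OF GL] L0 AE])
    then show "G \<in> {G \<in> sobolev_Linf. penalty_objective c r G \<le> t}"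
      using GS GL by (simp add: sobolev_Linf_def penalty_objective_def sobolev_Linf_norm_def L_def)
  qed
qed (use d that in auto)

section \<open>Refinement steps and sequences\<close>

definition partial_sum :: "(nat \<Rightarrow> real^'n \<Rightarrow> real^'n) \<Rightarrow> nat \<Rightarrow> real^'n \<Rightarrow> (real^'n) \<times> (real^'n^'n)" where
  "partial_sum u j x = (\<Sum>k=1..j. with_grad (u k) x)"

lemma partial_sum_mem: "(\<And>k. k \<in> {1..j} \<Longrightarrow> u k \<in> Linf_W1d) \<Longrightarrow> partial_sum u j \<in> sobolev_Linf"
  unfolding partial_sum_def[abs_def] by (intro sobolev_Linf_sum with_grad_mem) auto

lemma fst_partial_sum: "fst (partial_sum u j x) = (\<Sum>k=1..j. u k x)"
  by (simp add: partial_sum_def fst_sum with_grad_def)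

text \<open>The chosen weak gradient of a sum agrees almost everywhere with the sum of the gradient
  components, and the norms do not see the difference.\<close>

lemma refinement_objective_eq:
  fixes f :: "real^'n \<Rightarrow> real"
  assumes f: "f \<in> Lp (real CARD('n))" and u: "\<And>k. k \<in> {1..j} \<Longrightarrow> u k \<in> Linf_W1d" and G: "G \<in> sobolev_Linf"
  shows "refinement_objective f lam u j (\<lambda>x. fst (G x)) = penalty_objective (lam * 2 ^ j) (residual f (partial_sum u j)) G"
proof -
  define H where "H x = partial_sum u j x + G x" for x
  have H: "H \<in> sobolev_Linf" unfolding H_def[abs_def] by (rule sobolev_Linf_add[OF partial_sum_mem[OF u] G])
  have fH: "(\<lambda>x. fst (H x)) = (\<lambda>y. (\<Sum>k=1..j. u k y) + fst (G y))"
    by (simp add: H_def fst_partial_sum)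
  have m: "(\<lambda>x. f x - weak_div (\<lambda>x. fst (H x)) x) \<in> borel_measurable borel"
    unfolding weak_div_eq_trace
    using Lp_measurable[OF f] Lp_measurable[OF sobolevD(4)[OF sobolev_weak_grad[OF sobolev_LinfD(3)[OF H]]]]
    by (intro borel_measurable_diff) auto
  have "Ld_norm (\<lambda>x. f x - weak_div (\<lambda>x. fst (H x)) x) = Ld_norm (residual f H)"
    by (rule Lp_norm_cong_AE[OF _ m Lp_measurable[OF residual_Lp[OF f sobolev_LinfD(1)[OF H]]]])
      (use sobolev_LinfD(4)[OF H] in \<open>eventually_elim, simp add: weak_div_eq_trace residual_def\<close>)
  then show ?thesis
    unfolding refinement_objective_def penalty_objective_def residual_residual fH
    by (simp add: H_def[abs_def] sobolev_LinfD(5)[OF G])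
qed

lemma refinement_objective_with_grad:
  fixes f :: "real^'n \<Rightarrow> real"
  assumes "f \<in> Lp (real CARD('n))" "\<And>k. k \<in> {1..j} \<Longrightarrow> u k \<in> Linf_W1d" "v \<in> Linf_W1d"
  shows "refinement_objective f lam u j v = penalty_objective (lam * 2 ^ j) (residual f (partial_sum u j)) (with_grad v)"
  using refinement_objective_eq[OF assms(1,2) with_grad_mem[OF assms(3)], where lam = lam]
  by (simp add: with_grad_def)

lemma refinement_minimizer_exists:
  fixes f :: "real^'n \<Rightarrow> real"
  assumes d: "CARD('n) \<ge> 2" and lam: "lam \<ge> 0" and f: "f \<in> Lp (real CARD('n))"
    and u: "\<And>k. k \<in> {1..j} \<Longrightarrow> u k \<in> Linf_W1d"
  shows "\<exists>v. refinement_minimizer f lam u j v"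
proof -
  have r: "residual f (partial_sum u j) \<in> Lp (real CARD('n))"
    by (rule residual_Lp[OF f sobolev_LinfD(1)[OF partial_sum_mem[OF u]]])
  have "lam * 2 ^ j \<ge> 0" using lam by simp
  then obtain G where G: "G \<in> sobolev_Linf" and min: "\<And>H. H \<in> sobolev_Linf \<Longrightarrow>
      penalty_objective (lam * 2 ^ j) (residual f (partial_sum u j)) G \<le> penalty_objective (lam * 2 ^ j) (residual f (partial_sum u j)) H"
    using penalty_minimizer[OF d _ r] by metis
  have "refinement_minimizer f lam u j (\<lambda>x. fst (G x))"
    unfolding refinement_minimizer_def is_arg_min_def
  proof (intro conjI notI)
    show "(\<lambda>x. fst (G x)) \<in> Linf_W1d" by (rule sobolev_LinfD(3)[OF G])
    assume "\<exists>w. w \<in> Linf_W1d \<and> refinement_objective f lam u j w < refinement_objective f lam u j (\<lambda>x. fst (G x))"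
    then obtain w where w: "w \<in> Linf_W1d" "refinement_objective f lam u j w < refinement_objective f lam u j (\<lambda>x. fst (G x))"
      by blast
    have "refinement_objective f lam u j (\<lambda>x. fst (G x)) = penalty_objective (lam * 2 ^ j) (residual f (partial_sum u j)) G"
      by (rule refinement_objective_eq[OF f u G])
    moreover have "refinement_objective f lam u j w = penalty_objective (lam * 2 ^ j) (residual f (partial_sum u j)) (with_grad w)"
      by (rule refinement_objective_with_grad[OF f u w(1)])
    ultimately show False using w(2) min[OF with_grad_mem[OF w(1)]] by linarith
  qed
  then show ?thesis by blast
qed

lemma refinement_minimizer_mem: "refinement_minimizer f lam u j v \<Longrightarrow> v \<in> Linf_W1d"
  by (simp add: refinement_minimizer_def is_arg_min_def)

text \<open>Appending a term to a finite run leaves its earlier steps intact, which the recursive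
  construction relies on.\<close>

lemma refinement_minimizer_cong:
  assumes "\<And>k. k \<in> {1..j} \<Longrightarrow> u k = u' k"
  shows "refinement_minimizer f lam u j = refinement_minimizer f lam u' j"
proof -
  have "(\<Sum>k=1..j. u k y) = (\<Sum>k=1..j. u' k y)" for y
    by (rule sum.cong) (use assms in auto)
  then have "refinement_objective f lam u j = refinement_objective f lam u' j"
    by (intro ext) (simp only: refinement_objective_def)
  then show ?thesis by (intro ext) (simp only: refinement_minimizer_def)
qed

text \<open>Each step depends on all earlier choices, so dependent choice is made on whole
  sequences, of which \<open>U j\<close> is valid up to index \<open>j\<close>. Later sequences keep
  the earlier entries, and the diagonal is the desired run.\<close>

lemma refinement_sequence_exists:
  assumes step: "\<And>j u. (\<And>i. i < j \<Longrightarrow> refinement_minimizer f lam u i (u (Suc i))) \<Longrightarrow> \<exists>v. refinement_minimizer f lam u j v"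
  shows "\<exists>u. \<forall>j. refinement_minimizer f lam u j (u (Suc j))"
proof -
  define P where "P j u \<longleftrightarrow> (\<forall>i<j. refinement_minimizer f lam u i (u (Suc i)))" for j u
  have "\<exists>U. \<forall>j. P j (U j) \<and> (\<forall>k\<le>j. U (Suc j) k = U j k)"
  proof (rule dependent_nat_choice)
    show "\<exists>u. P 0 u" by (simp add: P_def)
    fix u j assume "P j u"
    then obtain v where v: "refinement_minimizer f lam u j v" using step unfolding P_def by blast
    let ?u = "u(Suc j := v)"
    have "refinement_minimizer f lam ?u i (?u (Suc i))" if "i < Suc j" for i
    proof -
      have "refinement_minimizer f lam ?u i = refinement_minimizer f lam u i"
        by (rule refinement_minimizer_cong) (use that in auto)
      then show ?thesis using that v \<open>P j u\<close> by (auto simp: P_def less_Suc_eq)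
    qed
    then show "\<exists>u'. P (Suc j) u' \<and> (\<forall>k\<le>j. u' k = u k)"
      unfolding P_def by (intro exI[of _ ?u]) auto
  qed
  then obtain U where U: "\<And>j. P j (U j)" "\<And>j k. k \<le> j \<Longrightarrow> U (Suc j) k = U j k" by blast
  have eq: "U j k = U k k" if "k \<le> j" for j k
    using that by (induction rule: dec_induct) (auto simp: U(2))
  define u where "u k = U k k" for k
  have "refinement_minimizer f lam u j (u (Suc j))" for j
  proof -
    have "refinement_minimizer f lam (U (Suc j)) j (U (Suc j) (Suc j))" using U(1)[of "Suc j"] by (simp add: P_def)
    moreover have "refinement_minimizer f lam (U (Suc j)) j = refinement_minimizer f lam u j"
      by (rule refinement_minimizer_cong) (auto simp: u_def intro!: eq)
    ultimately show ?thesis by (simp add: u_def)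
  qed
  then show ?thesis by blast
qed

section \<open>Convergence of the hierarchical series\<close>

lemma sum_diff_atLeast1:
  fixes g :: "nat \<Rightarrow> 'b::ab_group_add"
  assumes "N \<le> M"
  shows "(\<Sum>k=1..M. g k) - (\<Sum>k=1..N. g k) = (\<Sum>k\<in>{N<..M}. g k)"
proof -
  have "{1..M} = {1..N} \<union> {N<..M}" using assms by auto
  moreover have "sum g ({1..N} \<union> {N<..M}) = sum g {1..N} + sum g {N<..M}"
    by (rule sum.union_disjoint) auto
  ultimately have "(\<Sum>k=1..M. g k) = (\<Sum>k=1..N. g k) + (\<Sum>k\<in>{N<..M}. g k)" by simp
  then show ?thesis by simp
qed

lemma sobolev_Linf_norm_sum:
  fixes G :: "nat \<Rightarrow> real^'n \<Rightarrow> (real^'n) \<times> (real^'n^'n)"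
  assumes "finite A" "\<And>k. k \<in> A \<Longrightarrow> G k \<in> sobolev_Linf"
  shows "sobolev_Linf_norm (\<lambda>x. \<Sum>k\<in>A. G k x) \<le> (\<Sum>k\<in>A. sobolev_Linf_norm (G k))"
proof -
  have "Linf_norm (\<lambda>x. \<Sum>k\<in>A. fst (G k x)) \<le> (\<Sum>k\<in>A. Linf_norm (\<lambda>x. fst (G k x)))"
    by (rule Linf_sum(2)[OF assms(1)]) (use assms(2) sobolev_LinfD(2) in blast)
  moreover have "Ld_norm (\<lambda>x. \<Sum>k\<in>A. snd (G k x)) \<le> (\<Sum>k\<in>A. Ld_norm (\<lambda>x. snd (G k x)))"
    by (rule Lp_norm_sum[OF _ assms(1)]) (use assms(2) sobolev_LinfD(1) sobolevD(3) in \<open>auto\<close>)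
  ultimately show ?thesis by (simp add: sobolev_Linf_norm_def fst_sum snd_sum sum.distrib)
qed

text \<open>An absolutely summable series converges. The limit is found by completeness of L^d; its
  L-infinity convergence is then recovered from pointwise tail bounds along the subsequence.\<close>

lemma sobolev_Linf_complete:
  fixes G :: "nat \<Rightarrow> real^'n \<Rightarrow> (real^'n) \<times> (real^'n^'n)"
  assumes d: "CARD('n) \<ge> 2" and G: "\<And>k. k \<ge> 1 \<Longrightarrow> G k \<in> sobolev_Linf"
    and sm: "summable (\<lambda>k. sobolev_Linf_norm (G (Suc k)))"
  obtains H where "H \<in> sobolev_Linf" "(\<lambda>N. sobolev_Linf_norm (\<lambda>x. H x - (\<Sum>k=1..N. G k x))) \<longlonglongrightarrow> 0"
proof -
  let ?d = "CARD('n)"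
  define P where "P N x = (\<Sum>k=1..N. G k x)" for N x
  define s where "s N = (\<Sum>k=1..N. sobolev_Linf_norm (G k))" for N
  define S where "S = (\<Sum>k. sobolev_Linf_norm (G (Suc k)))"
  have sS: "s \<longlonglongrightarrow> S"
    using summable_LIMSEQ[OF sm] unfolding s_def[abs_def] S_def by (simp add: sum.atLeast1_atMost_eq)
  have "incseq s" by (rule incseq_SucI) (simp add: s_def sobolev_Linf_norm_nonneg)
  then have s_le: "s N \<le> S" for N using sS by (rule incseq_le)
  have PL: "P N \<in> sobolev_Linf" for N unfolding P_def[abs_def] by (intro sobolev_Linf_sum G) auto
  have DL: "(\<lambda>x. P M x - P N x) \<in> sobolev_Linf" for M N
    using sobolev_Linf_add[OF PL sobolev_Linf_scaleR[OF PL, of "-1"], of M N] by simp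
  have D: "sobolev_Linf_norm (\<lambda>x. P M x - P N x) \<le> s M - s N" if "N \<le> M" for M N
    unfolding P_def s_def sum_diff_atLeast1[OF that]
    by (rule sobolev_Linf_norm_sum) (use G in auto)
  have D': "Ld_norm (\<lambda>x. P M x - P N x) \<le> \<bar>s M - s N\<bar>" for M N
  proof (cases "N \<le> M")
    case True
    then show ?thesis using sobolev_Lp_norm_le[OF DL[of M N]] D[of N M] by linarith
  next
    case False
    then show ?thesis
      using sobolev_Lp_norm_le[OF DL[of N M]] D[of M N] by (simp add: Lp_norm_minus[of _ "P M"])
  qed
  have PLp: "P N \<in> Lp (real ?d)" for N using PL sobolev_LinfD(1) sobolevD(1) by blast
  have cauchy: "\<exists>N. \<forall>m\<ge>N. \<forall>n\<ge>N. Ld_norm (\<lambda>x. P m x - P n x) < e" if e: "e > 0" for e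
  proof -
    have "Cauchy s" using sS by (rule LIMSEQ_imp_Cauchy)
    from CauchyD[OF this e] obtain N where N: "\<And>m n. m \<ge> N \<Longrightarrow> n \<ge> N \<Longrightarrow> \<bar>s m - s n\<bar> < e" by auto
    show ?thesis by (intro exI[of _ N] allI impI le_less_trans[OF D' N])
  qed
  obtain \<rho> H where \<rho>: "strict_mono \<rho>" and H: "H \<in> Lp (real ?d)" and ae: "AE x in torus. (\<lambda>k. P (\<rho> k) x) \<longlonglongrightarrow> H x"
    and l: "(\<lambda>k. Ld_norm (\<lambda>x. P (\<rho> k) x - H x)) \<longlonglongrightarrow> 0"
    by (rule Lp_complete[OF d PLp cauchy])
  have HS: "H \<in> sobolev"
    by (rule Lp_closedD[OF sobolev_closed[OF d] H sobolev_LinfD(1)[OF PL] ae l])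
  \<comment> \<open>Countably many pairs share one exceptional null set, so the limit can be taken
    at a fixed point.\<close>
  have AE_D: "AE x in torus. \<forall>M N. norm (fst (P M x - P N x)) \<le> Linf_norm (\<lambda>x. fst (P M x - P N x))"
    unfolding AE_all_countable by (intro allI Linf_norm_AE[OF sobolev_LinfD(2)[OF DL]])
  have ev: "\<forall>\<^sub>F k in sequentially. N \<le> \<rho> k" for N
    using eventually_ge_at_top[of N] by eventually_elim (rule order_trans[OF _ seq_suble[OF \<rho>]])
  have AE_H: "AE x in torus. norm (fst (H x - P N x)) \<le> S - s N" for N
    using AE_D ae
  proof eventually_elim
    case (elim x)
    note le = elim(1)[rule_format]
    have "(\<lambda>k. norm (fst (P (\<rho> k) x - P N x))) \<longlonglongrightarrow> norm (fst (H x - P N x))"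
      by (intro tendsto_norm tendsto_fst tendsto_diff elim tendsto_const)
    moreover have "\<forall>\<^sub>F k in sequentially. norm (fst (P (\<rho> k) x - P N x)) \<le> S - s N"
      using ev[of N]
    proof eventually_elim
      case (elim k)
      have "norm (fst (P (\<rho> k) x - P N x)) \<le> Linf_norm (\<lambda>x. fst (P (\<rho> k) x - P N x))"
        by (rule le)
      also have "\<dots> \<le> sobolev_Linf_norm (\<lambda>x. P (\<rho> k) x - P N x)" by (simp add: sobolev_Linf_norm_def)
      also have "\<dots> \<le> s (\<rho> k) - s N" by (rule D[OF elim])
      finally show ?case using s_le[of "\<rho> k"] by linarith
    qed
    ultimately show ?case by (rule tendsto_upperbound) simp
  qed
  have HPS: "(\<lambda>x. H x - P N x) \<in> sobolev" for N by (rule sobolev_diff[OF HS sobolev_LinfD(1)[OF PL]])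
  have HL: "H \<in> sobolev_Linf"
    using HS AE_H[of 0] sobolevD(2)[OF HS] by (auto simp: sobolev_Linf_def Linf_iff Lp_def P_def)
  \<comment> \<open>The tail \<open>S - s N\<close> bounds the L-infinity part and the gradient part
    separately, whence the factor 2.\<close>
  have "sobolev_Linf_norm (\<lambda>x. H x - P N x) \<le> 2 * (S - s N)" for N
  proof -
    have S0: "0 \<le> S - s N" using s_le[of N] by simp
    have 1: "Linf_norm (\<lambda>x. fst (H x - P N x)) \<le> S - s N"
      by (rule Linf_norm_le[OF Lp_measurable[OF sobolevD(2)[OF HPS]] S0 AE_H])
    have le: "norm (snd y) \<le> norm y" for y :: "(real^'n) \<times> (real^'n^'n)"
      using norm_snd_le[of "snd y" "fst y"] by simp
    have "Ld_norm (\<lambda>x. snd (H x - P N x)) \<le> Ld_norm (\<lambda>x. H x - P N x)"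
      by (rule Lp_norm_mono[OF _ sobolevD(1)[OF HPS] Lp_measurable[OF sobolevD(3)[OF HPS]] AE_I2[OF le]]) simp
    also have "\<dots> \<le> S - s N"
    proof (rule tendsto_lowerbound[where F = sequentially])
      show "(\<lambda>k. Ld_norm (\<lambda>x. P (\<rho> k) x - H x) + (S - s N)) \<longlonglongrightarrow> S - s N"
        using tendsto_add[OF l tendsto_const[of "S - s N"]] by simp
      show "\<forall>\<^sub>F k in sequentially. Ld_norm (\<lambda>x. H x - P N x) \<le> Ld_norm (\<lambda>x. P (\<rho> k) x - H x) + (S - s N)"
        using ev[of N]
      proof eventually_elim
        case (elim k)
        have "Ld_norm (\<lambda>x. H x - P N x) \<le> Ld_norm (\<lambda>x. H x - P (\<rho> k) x) + Ld_norm (\<lambda>x. P (\<rho> k) x - P N x)"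
          by (rule Lp_norm_diff_triangle[OF _ H PLp PLp]) simp
        also have "Ld_norm (\<lambda>x. H x - P (\<rho> k) x) = Ld_norm (\<lambda>x. P (\<rho> k) x - H x)"
          by (rule Lp_norm_minus)
        also have "Ld_norm (\<lambda>x. P (\<rho> k) x - P N x) \<le> s (\<rho> k) - s N"
          using sobolev_Lp_norm_le[OF DL[of "\<rho> k" N]] D[OF elim] by linarith
        finally show ?case using s_le[of "\<rho> k"] by linarith
      qed
    qed simp
    finally show ?thesis using 1 by (simp add: sobolev_Linf_norm_def)
  qed
  then have "\<forall>\<^sub>F N in sequentially. norm (sobolev_Linf_norm (\<lambda>x. H x - P N x)) \<le> 2 * (S - s N)"
    by (simp add: sobolev_Linf_norm_nonneg)
  moreover have "(\<lambda>N. 2 * (S - s N)) \<longlonglongrightarrow> 2 * (S - S)" by (intro tendsto_intros sS)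
  then have "(\<lambda>N. 2 * (S - s N)) \<longlonglongrightarrow> 0" by simp
  ultimately have "(\<lambda>N. sobolev_Linf_norm (\<lambda>x. H x - P N x)) \<longlonglongrightarrow> 0"
    by (rule Lim_null_comparison)
  then show ?thesis unfolding P_def by (rule that[OF HL])
qed

lemma refinement_converges:
  fixes f :: "real^'n \<Rightarrow> real"
  assumes d: "CARD('n) \<ge> 2" and \<beta>: "\<beta> > 0"
    and beta: "Bourgain_Brezis TYPE('n) \<beta>"
    and f: "f \<in> Lp (real CARD('n))" "average f = 0" and lam: "lam > 0"
    and u: "\<And>j. refinement_minimizer f lam u j (u (Suc j))"
  shows "\<exists>U \<in> Linf_W1d. (\<lambda>N. Linf_W1d_norm (\<lambda>x. U x - (\<Sum>j=1..N. u j x))) \<longlonglongrightarrow> 0 \<and>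
    (AE x in torus. weak_div U x = f x)"
proof -
  let ?d = "CARD('n)"
  have d0: "?d > 0" by simp
  have uW: "u k \<in> Linf_W1d" if "k \<ge> 1" for k
    using refinement_minimizer_mem[OF u[of "k - 1"]] that by simp
  define P where "P = partial_sum u"
  have PL: "P j \<in> sobolev_Linf" for j unfolding P_def by (rule partial_sum_mem) (use uW in auto)
  define r where "r j = residual f (P j)" for j
  have rL: "r j \<in> Lp (real ?d)" for j unfolding r_def by (rule residual_Lp[OF f(1) sobolev_LinfD(1)[OF PL]])
  have r0: "average (r j) = 0" for j
  proof -
    have "integrable torus (\<lambda>x. trace (snd (P j x)))" "integrable torus f"
      using Lp_integrable[OF d0 sobolevD(4)[OF sobolev_LinfD(1)[OF PL]]] Lp_integrable[OF d0 f(1)] by auto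
    then show ?thesis
      using f(2) sobolev_integral_trace[OF sobolev_LinfD(1)[OF PL]] by (simp add: average_def r_def residual_def)
  qed
  define R where "R j = Ld_norm (r j)" for j
  have R_nn: "R j \<ge> 0" for j by (simp add: R_def)
  define n where "n j = sobolev_Linf_norm (with_grad (u (Suc j)))" for j
  have n_nn: "n j \<ge> 0" for j by (simp add: n_def sobolev_Linf_norm_nonneg)
  have step: "n j + lam * 2 ^ j * R (Suc j) ^ ?d \<le> sobolev_Linf_norm H + lam * 2 ^ j * Ld_norm (residual (r j) H) ^ ?d"
    if H: "H \<in> sobolev_Linf" for j H
  proof -
    have uj: "k \<in> {1..j} \<Longrightarrow> u k \<in> Linf_W1d" for k using uW by auto
    have "refinement_objective f lam u j (u (Suc j)) \<le> refinement_objective f lam u j (\<lambda>x. fst (H x))"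
      using u[of j] sobolev_LinfD(3)[OF H] unfolding refinement_minimizer_def is_arg_min_def by force
    moreover have "refinement_objective f lam u j (u (Suc j)) = penalty_objective (lam * 2 ^ j) (r j) (with_grad (u (Suc j)))"
      unfolding r_def P_def by (rule refinement_objective_with_grad[OF f(1) uj uW]) auto
    moreover have "refinement_objective f lam u j (\<lambda>x. fst (H x)) = penalty_objective (lam * 2 ^ j) (r j) H"
      unfolding r_def P_def by (rule refinement_objective_eq[OF f(1) uj H]) auto
    moreover have "residual (r j) (with_grad (u (Suc j))) = r (Suc j)"
      unfolding r_def residual_residual P_def by (simp add: partial_sum_def[abs_def])
    ultimately show ?thesis by (simp add: penalty_objective_def n_def R_def)
  qed
  have pos: "lam * 2 ^ j > 0" for j using lam by simp
  \<comment> \<open>Comparison with the zero field, which leaves the residual unchanged at no cost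
    in norm.\<close>
  have R_dec: "R (Suc j) \<le> R j" for j
  proof -
    have "residual (r j) (\<lambda>x. 0) = r j" by (simp add: residual_def fun_eq_iff trace_def)
    then have "lam * 2 ^ j * R (Suc j) ^ ?d \<le> lam * 2 ^ j * R j ^ ?d"
      using step[OF sobolev_Linf_zero, of j] n_nn[of j] d0 by (simp add: sobolev_Linf_norm_def Linf_zero R_def)
    then have "R (Suc j) ^ ?d \<le> R j ^ ?d" using pos by (subst (asm) mult_le_cancel_left_pos) auto
    then show ?thesis using R_nn d0 by (simp add: power_mono_iff)
  qed
  have R_le: "R j \<le> R 0" for j by (induction j) (auto intro: order_trans[OF R_dec])
  \<comment> \<open>Comparison with an exact solution for the current residual, whose penalty
    vanishes and whose norm is linear in \<open>R j\<close>.\<close>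
  have main: "n j + lam * 2 ^ j * R (Suc j) ^ ?d \<le> 8 * \<beta> * R j" for j
  proof -
    obtain H where H: "H \<in> sobolev" "(\<lambda>x. fst (H x)) \<in> Linf" "AE x in torus. trace (snd (H x)) = r j x"
      "Linf_norm (\<lambda>x. fst (H x)) + Ld_norm (\<lambda>x. snd (H x)) \<le> 8 * \<beta> * Ld_norm (r j)"
      by (rule solve_div[OF d \<beta> beta rL[of j] r0[of j]])
    have "Ld_norm (residual (r j) H) = Ld_norm (\<lambda>x::real^'n. 0::real)"
      by (rule Lp_norm_cong_AE[OF _ Lp_measurable[OF residual_Lp[OF rL H(1)]]])
        (use H(3) in \<open>auto simp: residual_def elim!: eventually_mono\<close>)
    then have "Ld_norm (residual (r j) H) = 0" using d0 by simp
    moreover have "H \<in> sobolev_Linf" using H by (simp add: sobolev_Linf_def)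
    ultimately show ?thesis
      using step[of H j] H(4) by (simp add: sobolev_Linf_norm_def R_def zero_power)
  qed
  \<comment> \<open>Doubling the weight halves the bound on the d-th power of the residual, so the
    residual itself decays with ratio the d-th root of 1/2.\<close>
  define K \<theta> where "K = root ?d (8 * \<beta> * R 0 / lam)" and "\<theta> = root ?d (1/2)"
  have K: "K \<ge> 0" "K ^ ?d = 8 * \<beta> * R 0 / lam" and \<theta>: "\<theta> \<ge> 0" "\<theta> ^ ?d = 1/2"
    using \<beta> R_nn[of 0] lam d0 by (auto simp: K_def \<theta>_def)
  have \<theta>1: "\<theta> < 1"
  proof (rule ccontr)
    assume "\<not> \<theta> < 1"
    then have "1 \<le> \<theta> ^ ?d" by (intro one_le_power) simp
    then show False using \<theta>(2) by simp
  qed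
  have R_geo: "R (Suc j) \<le> K * \<theta> ^ j" for j
  proof -
    have "lam * 2 ^ j * R (Suc j) ^ ?d \<le> 8 * \<beta> * R 0"
      using main[of j] n_nn[of j] mult_left_mono[OF R_le[of j], of "8 * \<beta>"] \<beta> by linarith
    then have "R (Suc j) ^ ?d \<le> (8 * \<beta> * R 0) / (lam * 2 ^ j)"
      using pos[of j] by (simp add: pos_le_divide_eq mult.commute)
    also have "\<dots> = (8 * \<beta> * R 0 / lam) * (1/2) ^ j"
      by (simp add: power_divide)
    also have "\<dots> = (K * \<theta> ^ j) ^ ?d"
      unfolding power_mult_distrib K(2) power_mult[symmetric] mult.commute[of j] unfolding power_mult \<theta>(2) ..
    finally show ?thesis using R_nn K(1) \<theta>(1) d0 by (simp add: power_mono_iff)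
  qed
  have R_lim: "R \<longlonglongrightarrow> 0"
  proof (rule LIMSEQ_imp_Suc, rule Lim_null_comparison)
    show "\<forall>\<^sub>F j in sequentially. norm (R (Suc j)) \<le> K * \<theta> ^ j" using R_geo R_nn by simp
    show "(\<lambda>j. K * \<theta> ^ j) \<longlonglongrightarrow> 0"
      using \<theta>(1) \<theta>1 by (intro tendsto_mult_right_zero LIMSEQ_power_zero) simp
  qed
  \<comment> \<open>The index is shifted because decay is known for \<open>R (Suc j)\<close> only;
    the single increment \<open>n 0\<close> does not affect summability.\<close>
  have n_geo: "n (Suc j) \<le> 8 * \<beta> * K * \<theta> ^ j" for j
  proof -
    have "lam * 2 ^ Suc j * R (Suc (Suc j)) ^ ?d \<ge> 0" using lam R_nn by (intro mult_nonneg_nonneg) auto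
    then have "n (Suc j) \<le> 8 * \<beta> * R (Suc j)" using main[of "Suc j"] by linarith
    also have "\<dots> \<le> 8 * \<beta> * (K * \<theta> ^ j)" using \<beta> by (intro mult_left_mono R_geo) simp
    finally show ?thesis by (simp add: mult.assoc)
  qed
  have "summable (\<lambda>j. n (Suc j))"
  proof (rule summable_comparison_test')
    show "summable (\<lambda>j. 8 * \<beta> * K * \<theta> ^ j)" using \<theta>(1) \<theta>1 by (intro summable_mult summable_geometric) simp
    show "norm (n (Suc j)) \<le> 8 * \<beta> * K * \<theta> ^ j" for j using n_geo n_nn by simp
  qed
  then have "summable n" by (simp add: summable_Suc_iff)
  then have sm: "summable (\<lambda>k. sobolev_Linf_norm (with_grad (u (Suc k))))"
    by (simp add: n_def[abs_def])
  obtain H where HL: "H \<in> sobolev_Linf" and HP: "(\<lambda>N. sobolev_Linf_norm (\<lambda>x. H x - P N x)) \<longlonglongrightarrow> 0"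
    unfolding P_def partial_sum_def
    by (rule sobolev_Linf_complete[of "\<lambda>k. with_grad (u k)", OF d with_grad_mem[OF uW] sm])
  have HPL: "(\<lambda>x. H x - P N x) \<in> sobolev_Linf" for N
    using sobolev_Linf_add[OF HL sobolev_Linf_scaleR[OF PL, of "-1"], of N] by simp
  have "Linf_W1d_norm (\<lambda>x. fst (H x) - (\<Sum>j=1..N. u j x)) = sobolev_Linf_norm (\<lambda>x. H x - P N x)" for N
    using sobolev_LinfD(5)[OF HPL[of N]] by (simp add: P_def fst_partial_sum)
  then have conv: "(\<lambda>N. Linf_W1d_norm (\<lambda>x. fst (H x) - (\<Sum>j=1..N. u j x))) \<longlonglongrightarrow> 0" using HP by simp
  have "(\<lambda>N. Ld_norm (\<lambda>x. P N x - H x)) \<longlonglongrightarrow> 0"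
  proof (rule Lim_null_comparison[OF _ HP], intro always_eventually allI)
    fix N
    show "norm (Ld_norm (\<lambda>x. P N x - H x)) \<le> sobolev_Linf_norm (\<lambda>x. H x - P N x)"
      using sobolev_Lp_norm_le[OF HPL[of N]] by (simp add: Lp_norm_minus[of _ "P N"])
  qed
  then have "R \<longlonglongrightarrow> Ld_norm (residual f H)"
    unfolding R_def r_def
    by (rule residual_tendsto[OF f(1) sobolev_LinfD(1)[OF PL] sobolev_LinfD(1)[OF HL]])
  then have "Ld_norm (residual f H) = 0" using R_lim LIMSEQ_unique by blast
  then have "AE x in torus. residual f H x = 0"
    by (rule Lp_norm_eq_0_AE[OF d0 residual_Lp[OF f(1) sobolev_LinfD(1)[OF HL]]])
  then have "AE x in torus. weak_div (\<lambda>x. fst (H x)) x = f x"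
    using sobolev_LinfD(4)[OF HL]
    by eventually_elim (simp add: weak_div_eq_trace residual_def)
  then show ?thesis by (intro bexI[OF _ sobolev_LinfD(3)[OF HL]] conjI conv)
qed

text \<open>A minimiser is not unique as a function, since changing it on a periodic null set gives
  another. The arg min is therefore read as any minimiser: every finite run can be continued, an
  infinite run exists, and every infinite run sums to a solution.\<close>

theorem corollary2p1:
  fixes f :: "real^'n \<Rightarrow> real" and \<beta> lam1 d d' :: real
  defines "d \<equiv> real CARD('n)"
  defines "d' \<equiv> d / (d - 1)"
  assumes dim: "CARD('n) \<ge> 2"
    and f: "f \<in> Lp_zero_mean d"
    and beta_pos: "\<beta> > 0"
    and beta: "\<And>g :: real^'n \<Rightarrow> real. g \<in> Lp d' \<Longrightarrow>
        ennreal (Lp_norm d' (\<lambda>x. g x - average g)) \<le> ennreal \<beta> * L1_plus_dual_norm (distr_grad g)"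
    and lambda: "if AE x in torus. f x = 0 then lam1 > 0 else lam1 \<ge> \<beta> / d * Lp_norm d f powr (1 - d)"
  shows "(\<forall>j u. (\<forall>i<j. refinement_minimizer f lam1 u i (u (Suc i))) \<longrightarrow>
            (\<exists>v. refinement_minimizer f lam1 u j v)) \<and>
         (\<exists>u. \<forall>j. refinement_minimizer f lam1 u j (u (Suc j))) \<and>
         (\<forall>u. (\<forall>j. refinement_minimizer f lam1 u j (u (Suc j))) \<longrightarrow>
            (\<exists>U \<in> Linf_W1d.
               (\<lambda>N. Linf_W1d_norm (\<lambda>x. U x - (\<Sum>j=1..N. u j x))) \<longlonglongrightarrow> 0 \<and>
               (AE x in torus. weak_div U x = f x)))"
proof -
  have fL: "f \<in> Lp (real CARD('n))" and f0: "average f = 0"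
    using f by (auto simp: Lp_zero_mean_def d_def)
  have bb: "Bourgain_Brezis TYPE('n) \<beta>"
    unfolding Bourgain_Brezis_def using beta by (simp add: d'_def d_def)
  have lam: "lam1 > 0"
  proof (cases "AE x in torus. f x = 0")
    case True
    then show ?thesis using lambda by simp
  next
    case False
    then have "Lp_norm d f \<noteq> 0" using Lp_norm_eq_0_AE[OF _ fL] by (auto simp: d_def)
    \<comment> \<open>A nonzero norm makes the threshold positive, and positivity of
      \<open>lam1\<close> is what drives the geometric decay.\<close>
    then have "\<beta> / d * Lp_norm d f powr (1 - d) > 0" using beta_pos by (simp add: d_def)
    then show ?thesis using lambda False by (simp add: less_le_trans)
  qed
  have step: "\<exists>v. refinement_minimizer f lam1 u j v" if "\<And>i. i < j \<Longrightarrow> refinement_minimizer f lam1 u i (u (Suc i))" for j u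
  proof (rule refinement_minimizer_exists[OF dim less_imp_le[OF lam] fL])
    fix k assume "k \<in> {1..j}"
    then have "k - 1 < j" "Suc (k - 1) = k" by auto
    then show "u k \<in> Linf_W1d" using refinement_minimizer_mem[OF that[of "k - 1"]] by (simp only:)
  qed
  show ?thesis
  proof (intro conjI allI impI)
    fix j u assume "\<forall>i<j. refinement_minimizer f lam1 u i (u (Suc i))"
    then show "\<exists>v. refinement_minimizer f lam1 u j v" by (intro step) blast
  next
    show "\<exists>u. \<forall>j. refinement_minimizer f lam1 u j (u (Suc j))"
      by (rule refinement_sequence_exists[OF step])
  next
    fix u assume "\<forall>j. refinement_minimizer f lam1 u j (u (Suc j))"
    then show "\<exists>U \<in> Linf_W1d. (\<lambda>N. Linf_W1d_norm (\<lambda>x. U x - (\<Sum>j=1..N. u j x))) \<longlonglongrightarrow> 0 \<and>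
        (AE x in torus. weak_div U x = f x)"
      by (intro refinement_converges[OF dim beta_pos bb fL f0 lam]) auto
  qed
qed

end
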